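(* The plethystic bialgebra $\mathcal{P}$ is isomorphic to the homotopy cardinality of the incidence bialgebra of the simplicial groupoid $\mathcal{B}\,\mathcal{T}_{\mathsf{S}^{\mathrm r}}(\mathsf{Sym})$.
   Context: Monads and operads. $\mathbf{Grpd}$ is the category of groupoids. $\mathsf{M}^{\mathrm r}$ is the monad on $\mathbf{Grpd}$ sending a groupoid $A$ to $\bigsqcup_{n\ge 1}A^n$ (nonempty finite tuples, morphisms componentwise), with unit $a\mapsto (a)$ and multiplication $\mu$ given by concatenating a tuple of tuples. $\mathsf{S}^{\mathrm r}$ is the monad sending $A$ to $\bigsqcup_{n\ge1}A^n/\!/\mathfrak S_n$: same objects, and besides componentwise morphisms there is for each $\sigma\in\mathfrak S_n$ an isomorphism $(a_1,\dots,a_n)\to(a_{\sigma(1)},\dots,a_{\sigma(n)})$; unit and multiplication as for $\mathsf M^{\mathrm r}$. For $\mathsf P\in\{\mathsf M^{\mathrm r},\mathsf S^{\mathrm r}\}$, a $\mathsf P$-operad $Q$ consists of groupoids $Q_0$ (colours) and $Q_1$ (operations), functors $s\colon Q_1\to \mathsf PQ_0$ (inputs) and $t\colon Q_1\to Q_0$ (output), a composition $m\colon \mathsf PQ_1\times_{\mathsf PQ_0}Q_1\to Q_1$ (pullback of $\mathsf Pt$ and $s$; the $Q_1$ factor is the root operation, the $\mathsf PQ_1$ factor the operations plugged into its inputs) and units $e\colon Q_0\to Q_1$, satisfying $s\circ m=\mu_{Q_0}\circ \mathsf Ps\circ \mathrm{pr}_1$, $t\circ m=t\circ\mathrm{pr}_2$,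 $s\circ e=\eta_{Q_0}$, $t\circ e=\mathrm{id}$ and the associativity and unit laws. $\mathsf{Sym}$ is the terminal $\mathsf S^{\mathrm r}$-operad on one colour: $Q_0=1$, $Q_1=\mathsf S^{\mathrm r}1$ (one $n$-ary operation for each $n\ge1$, with automorphism group $\mathfrak S_n$), composition given by $\mu$. $\mathcal T$-construction. (i) For $\mathsf P\in\{\mathsf M^{\mathrm r},\mathsf S^{\mathrm r}\}$ and a category $C$ internal to $\mathbf{Grpd}$ with discrete groupoid of objects $C_0$, $\mathcal T_{\mathsf P}(C)$ is the $\mathsf P$-operad with colours $C_0$ whose groupoid of operations is the pullback of $\mathsf P(\text{target})\colon\mathsf PC_1\to\mathsf PC_0$ along $C_0\times\mathsf P1\to\mathsf PC_0$, $(c,(\ast,\dots,\ast))\mapsto(c,\dots,c)$: its objects are nonempty tuples $(f_1,\dots,f_n)$ of arrows of $C$ with common target $c$ (inputs: the sources of the $f_i$; output: $c$), its morphisms are the morphisms of $\mathsf PC_1$ between such tuples, composition is $(f_1,\dots,f_k)\circ\big((g^1_1,\dots,g^1_{n_1}),\dots,(g^k_1,\dots,g^k_{n_k})\big)=(f_1g^1_1,\dots,f_1g^1_{n_1},\dots,f_kg^k_1,\dots,f_kg^k_{n_k})$, and units are identity arrows. (ii) For $\mathsf P'\in\{\mathsf M^{\mathrm r},\mathsf S^{\mathrm r}\}$ and a $\mathsf P'$-operad $Q$ with discrete $Q_0$, $\mathcal T^{\mathsf P'}(Q)$ is the category internal to $\mathbf{Grpd}$ with objects $Q_0$ whose arrows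 $c\to d$ are the operations of $Q$ all of whose inputs are $c$ and whose output is $d$ (the groupoid of arrows is the pullback of $s$ along $Q_0\times\mathsf P'1\to\mathsf P'Q_0$), with composition $y\circ x=m((x,\dots,x);y)$ ($x$ repeated once for each input of $y$) and identities given by $e$. (iii) $\mathcal T_{\mathsf P}(Q):=\mathcal T_{\mathsf P}(\mathcal T^{\mathsf P'}(Q))$. Bar construction. For $\mathsf P,\mathsf R\in\{\mathsf M^{\mathrm r},\mathsf S^{\mathrm r}\}$ with $\mathsf P=\mathsf R$ or ($\mathsf P=\mathsf M^{\mathrm r}$, $\mathsf R=\mathsf S^{\mathrm r}$, related by the inclusion), and a $\mathsf P$-operad $Q$, set $Q_n:=\mathsf PQ_{n-1}\times_{\mathsf PQ_0}Q_1$ for $n\ge 2$ (groupoid of $n$-level trees of composable operations). $\mathcal B^{\mathsf R}Q$ is the simplicial groupoid with $\mathcal B^{\mathsf R}_nQ=\mathsf RQ_n$ ($\mathsf R$-configurations of $n$-level trees); $d_0$ discards the top (leafward) level keeping its outputs (for $n=1$, $d_0=\mathsf Rt$), $d_n$ discards the bottom (root) level and flattens the result using $\mathsf P\Rightarrow\mathsf R$ and the multiplication of $\mathsf R$ (for $n=1$, $d_1$ gives the flattened inputs), inner faces compose adjacent levels via $m$, degeneracies insert units $e$. $\mathcal BQ:=\mathcal B^{\mathsf P}Q$. Incidence bialgebra. For a groupoid $G$, $|G|=\sum_{[x]\in\pi_0G}1/|\mathrm{Aut}(x)|$. For $X=\mathcal B^{\mathsf R}Q$, let $\mathbb Q_{\pi_0X_1}$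 have basis $\delta_a$, $a\in\pi_0X_1$. Comultiplication: $\Delta(\delta_f)=\sum_{a,b\in\pi_0X_1}\frac{|\Phi_{f;a,b}|}{|\mathrm{Aut}(a)||\mathrm{Aut}(b)|}\delta_a\otimes\delta_b$, where $\Phi_{f;a,b}$ is the homotopy fibre over $(a,b)$ of $(d_2,d_0)$ restricted to the homotopy fibre of $d_1\colon X_2\to X_1$ over $f$; counit: $\epsilon(\delta_f)=$ cardinality of the homotopy fibre of $s_0\colon X_0\to X_1$ over $f$; product $\delta_a\delta_b=\delta_{a+b}$ where $+$ is juxtaposition of $\mathsf R$-configurations (unit adjoined). This is the homotopy cardinality of the incidence bialgebra of $X$. Plethystic bialgebra. $\Lambda$ is the set of sequences $\lambda=(\lambda_1,\lambda_2,\dots)$ of natural numbers, not all zero, with $\lambda_i=0$ for $i$ large; $\mathbf x^\lambda=\prod_i x_i^{\lambda_i}$ and $\mathrm{aut}(\lambda)=\prod_i i!^{\lambda_i}\lambda_i!$. Elements of the ring $\mathbb Q[[\mathbf x]]_+$ of power series in $x_1,x_2,\dots$ without constant term are written $F=\sum_{\lambda\in\Lambda}F_\lambda\mathbf x^\lambda/\mathrm{aut}(\lambda)$. Plethystic substitution: $(G\circledast F)(x_1,x_2,\dots)=G(F_1,F_2,\dots)$ where $F_k(x_1,x_2,\dots)=F(x_k,x_{2k},\dots)$. $\mathcal P$ is the polynomial algebra $\mathbb Q[A_\lambda:\lambda\in\Lambda]$, $A_\lambda(F)=F_\lambda$, with comultiplication determined by $\Delta(A_\lambda)(F,G)=A_\lambda(G\circledast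 F)$ (where $(u\otimes v)(F,G)=u(F)v(G)$) and counit $\epsilon(A_\lambda)=A_\lambda(x_1)$. *)

theory Defs
  imports Complex_Main "HOL-Library.Poly_Mapping" "HOL-Library.Product_Plus"
begin

section \<open>Groupoids and functors\<close>

record ('o, 'm) gpd =
  Ob :: "'o set"
  Ar :: "'m set"
  Dom :: "'m \<Rightarrow> 'o"
  Cod :: "'m \<Rightarrow> 'o"
  Idn :: "'o \<Rightarrow> 'm"
  Cmp :: "'m \<Rightarrow> 'm \<Rightarrow> 'm"  \<comment> \<open>\<open>Cmp G g f\<close> is \<open>g\<close> after \<open>f\<close>\<close>

record ('o, 'm, 'p, 'n) gfun =
  Fo :: "'o \<Rightarrow> 'p"
  Fa :: "'m \<Rightarrow> 'n"

definition gcomp :: "('p, 'n, 'q, 'k) gfun \<Rightarrow> ('o, 'm, 'p, 'n) gfun \<Rightarrow> ('o, 'm, 'q, 'k) gfun" where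
  "gcomp G F = \<lparr>Fo = Fo G \<circ> Fo F, Fa = Fa G \<circ> Fa F\<rparr>"

definition gpair :: "('o, 'm, 'p, 'n) gfun \<Rightarrow> ('o, 'm, 'q, 'k) gfun \<Rightarrow> ('o, 'm, 'p \<times> 'q, 'n \<times> 'k) gfun" where
  "gpair F G = \<lparr>Fo = (\<lambda>x. (Fo F x, Fo G x)), Fa = (\<lambda>f. (Fa F f, Fa G f))\<rparr>"

definition pr1 :: "('o \<times> 'p, 'm \<times> 'n, 'o, 'm) gfun" where
  "pr1 = \<lparr>Fo = fst, Fa = fst\<rparr>"

definition pr2 :: "('o \<times> 'p, 'm \<times> 'n, 'p, 'n) gfun" where
  "pr2 = \<lparr>Fo = snd, Fa = snd\<rparr>"

definition terminal_gpd :: "(unit, unit) gpd" where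
  "terminal_gpd = \<lparr>Ob = {()}, Ar = {()}, Dom = (\<lambda>_. ()), Cod = (\<lambda>_. ()),
     Idn = (\<lambda>_. ()), Cmp = (\<lambda>_ _. ())\<rparr>"

definition prod_gpd :: "('o, 'm) gpd \<Rightarrow> ('p, 'n) gpd \<Rightarrow> ('o \<times> 'p, 'm \<times> 'n) gpd" where
  "prod_gpd A B = \<lparr>Ob = Ob A \<times> Ob B, Ar = Ar A \<times> Ar B,
     Dom = (\<lambda>(f, g). (Dom A f, Dom B g)), Cod = (\<lambda>(f, g). (Cod A f, Cod B g)),
     Idn = (\<lambda>(x, y). (Idn A x, Idn B y)),
     Cmp = (\<lambda>(f', g') (f, g). (Cmp A f' f, Cmp B g' g))\<rparr>"

definition pullback_gpd ::
  "('o, 'm) gpd \<Rightarrow> ('p, 'n) gpd \<Rightarrow> ('o, 'm, 'c, 'k) gfun \<Rightarrow> ('p, 'n, 'c, 'k) gfun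
    \<Rightarrow> ('o \<times> 'p, 'm \<times> 'n) gpd" where
  "pullback_gpd A B F G = (prod_gpd A B)
     \<lparr>Ob := {(x, y). x \<in> Ob A \<and> y \<in> Ob B \<and> Fo F x = Fo G y},
      Ar := {(f, g). f \<in> Ar A \<and> g \<in> Ar B \<and> Fa F f = Fa G g}\<rparr>"

definition full_sub :: "('o, 'm) gpd \<Rightarrow> 'o set \<Rightarrow> ('o, 'm) gpd" where
  "full_sub A U = A\<lparr>Ob := {x \<in> Ob A. x \<in> U}, Ar := {f \<in> Ar A. Dom A f \<in> U \<and> Cod A f \<in> U}\<rparr>"

definition iso_rel :: "('o, 'm) gpd \<Rightarrow> ('o \<times> 'o) set" where
  "iso_rel G = {(x, y). x \<in> Ob G \<and> y \<in> Ob G \<and> (\<exists>f\<in>Ar G. Dom G f = x \<and> Cod G f = y)}"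

definition pi0 :: "('o, 'm) gpd \<Rightarrow> 'o set set" where
  "pi0 G = Ob G // iso_rel G"

definition rep :: "'o set \<Rightarrow> 'o" where
  "rep c = (SOME x. x \<in> c)"

definition Aut :: "('o, 'm) gpd \<Rightarrow> 'o \<Rightarrow> 'm set" where
  "Aut G x = {f \<in> Ar G. Dom G f = x \<and> Cod G f = x}"

definition hcard :: "('o, 'm) gpd \<Rightarrow> rat" where
  "hcard G = (\<Sum>c\<in>pi0 G. 1 / of_nat (card (Aut G (rep c))))"

text \<open>
  Homotopy fibre of \<open>F : A \<rightarrow> B\<close> over \<open>b\<close>: objects are pairs \<open>(x, \<phi> : F x \<rightarrow> b)\<close>. An arrow
  \<open>(\<phi>, f, \<phi>')\<close> is the arrow \<open>f : x \<rightarrow> x'\<close> of \<open>A\<close> with \<open>\<phi>' \<circ> F f = \<phi>\<close>, regarded as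
  \<open>(x, \<phi>) \<rightarrow> (x', \<phi>')\<close>.
\<close>

definition hofib :: "('o, 'm) gpd \<Rightarrow> ('p, 'n) gpd \<Rightarrow> ('o, 'm, 'p, 'n) gfun \<Rightarrow> 'p
    \<Rightarrow> ('o \<times> 'n, 'n \<times> 'm \<times> 'n) gpd" where
  "hofib A B F b = \<lparr>
     Ob = {(x, \<phi>). x \<in> Ob A \<and> \<phi> \<in> Ar B \<and> Dom B \<phi> = Fo F x \<and> Cod B \<phi> = b},
     Ar = {(\<phi>, f, \<phi>'). f \<in> Ar A
             \<and> \<phi> \<in> Ar B \<and> Dom B \<phi> = Fo F (Dom A f) \<and> Cod B \<phi> = b
             \<and> \<phi>' \<in> Ar B \<and> Dom B \<phi>' = Fo F (Cod A f) \<and> Cod B \<phi>' = b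
             \<and> Cmp B \<phi>' (Fa F f) = \<phi>},
     Dom = (\<lambda>(\<phi>, f, \<phi>'). (Dom A f, \<phi>)),
     Cod = (\<lambda>(\<phi>, f, \<phi>'). (Cod A f, \<phi>')),
     Idn = (\<lambda>(x, \<phi>). (\<phi>, Idn A x, \<phi>)),
     Cmp = (\<lambda>(\<psi>, g, \<psi>') (\<phi>, f, \<phi>'). (\<phi>, Cmp A g f, \<psi>'))\<rparr>"

text \<open>The projection from the homotopy fibre to the total groupoid.\<close>

definition hofib_proj :: "('o \<times> 'n, 'n \<times> 'm \<times> 'n, 'o, 'm) gfun" where
  "hofib_proj = \<lparr>Fo = fst, Fa = (\<lambda>(\<phi>, f, \<phi>'). f)\<rparr>"


section \<open>The monad S (nonempty tuples up to permutation)\<close>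

text \<open>
  An arrow of \<open>S A\<close> with target \<open>(y\<^sub>0, \<dots>, y\<^sub>n\<^sub>-\<^sub>1)\<close> and source \<open>(x\<^sub>0, \<dots>, x\<^sub>n\<^sub>-\<^sub>1)\<close> is given by a
  permutation \<open>\<sigma>\<close> and arrows \<open>f\<^sub>i : x\<^sub>\<sigma>\<^sub>(\<^sub>i\<^sub>) \<rightarrow> y\<^sub>i\<close>. It is encoded as the list
  \<open>[(\<sigma> 0, f\<^sub>0), \<dots>, (\<sigma> (n - 1), f\<^sub>n\<^sub>-\<^sub>1)]\<close>; for identities \<open>f\<^sub>i\<close> this is the
  isomorphism from \<open>(x\<^sub>0, \<dots>)\<close> to \<open>(x\<^sub>\<sigma>\<^sub>(\<^sub>0\<^sub>), \<dots>)\<close>.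
\<close>

definition S_gpd :: "('o, 'm) gpd \<Rightarrow> ('o list, (nat \<times> 'm) list) gpd" where
  "S_gpd A = \<lparr>
     Ob = {xs. xs \<noteq> [] \<and> set xs \<subseteq> Ob A},
     Ar = {\<phi>. \<phi> \<noteq> [] \<and> snd ` set \<phi> \<subseteq> Ar A
             \<and> distinct (map fst \<phi>) \<and> fst ` set \<phi> = {..<length \<phi>}},
     Dom = (\<lambda>\<phi>. map (\<lambda>k. Dom A (the (map_of \<phi> k))) [0..<length \<phi>]),
     Cod = map (\<lambda>(k, f). Cod A f),
     Idn = (\<lambda>xs. enumerate 0 (map (Idn A) xs)),
     Cmp = (\<lambda>\<psi> \<phi>. map (\<lambda>(k, g). (fst (\<phi> ! k), Cmp A g (snd (\<phi> ! k)))) \<psi>)\<rparr>"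

definition S_fun :: "('o, 'm, 'p, 'n) gfun \<Rightarrow> ('o list, (nat \<times> 'm) list, 'p list, (nat \<times> 'n) list) gfun" where
  "S_fun F = \<lparr>Fo = map (Fo F), Fa = map (\<lambda>(k, f). (k, Fa F f))\<rparr>"

definition S_unit :: "('o, 'm, 'o list, (nat \<times> 'm) list) gfun" where
  "S_unit = \<lparr>Fo = (\<lambda>x. [x]), Fa = (\<lambda>f. [(0, f)])\<rparr>"

text \<open>
  On arrows the multiplication is the block permutation: \<open>block_offset \<Phi> k\<close> is the position at
  which the \<open>k\<close>-th inner list of the source starts after concatenation (the inner arrow whose
  source is that list is the one labelled \<open>k\<close>).
\<close>

definition block_offset :: "(nat \<times> (nat \<times> 'm) list) list \<Rightarrow> nat \<Rightarrow> nat" where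
  "block_offset \<Phi> k = sum_list (map (\<lambda>(k', \<phi>). length \<phi>) (filter (\<lambda>(k', \<phi>). k' < k) \<Phi>))"

definition flatten_arrow :: "(nat \<times> (nat \<times> 'm) list) list \<Rightarrow> (nat \<times> 'm) list" where
  "flatten_arrow \<Phi> = concat (map (\<lambda>(k, \<phi>). map (\<lambda>(j, f). (block_offset \<Phi> k + j, f)) \<phi>) \<Phi>)"

definition S_mult :: "('o list list, (nat \<times> (nat \<times> 'm) list) list, 'o list, (nat \<times> 'm) list) gfun" where
  "S_mult = \<lparr>Fo = concat, Fa = flatten_arrow\<rparr>"


section \<open>Operads over S\<close>

text \<open>The data of an operad over \<open>S\<close> (the laws are not recorded); \<open>compos\<close> is a functor on \<open>S Q\<^sub>1 \<times>\<^bsub>S Q\<^sub>0\<^esub> Q\<^sub>1\<close>.\<close>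

record ('c, 'cm, 'q, 'qm) operad =
  colours :: "('c, 'cm) gpd"
  opers :: "('q, 'qm) gpd"
  inp :: "('q, 'qm, 'c list, (nat \<times> 'cm) list) gfun"
  outp :: "('q, 'qm, 'c, 'cm) gfun"
  compos :: "('q list \<times> 'q, (nat \<times> 'qm) list \<times> 'qm, 'q, 'qm) gfun"
  units :: "('c, 'cm, 'q, 'qm) gfun"

definition Sym :: "(unit, unit, unit list, (nat \<times> unit) list) operad" where
  "Sym = \<lparr>colours = terminal_gpd, opers = S_gpd terminal_gpd,
     inp = \<lparr>Fo = id, Fa = id\<rparr>,
     outp = \<lparr>Fo = (\<lambda>_. ()), Fa = (\<lambda>_. ())\<rparr>,
     compos = gcomp S_mult pr1,
     units = S_unit\<rparr>"


section \<open>The T-construction\<close>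

text \<open>
  Categories internal to groupoids. The domain of \<open>icompos\<close> is the pullback of \<open>itgt\<close> and
  \<open>isrc\<close>, so that it sends \<open>(x, y)\<close> to \<open>y \<circ> x\<close>.
\<close>

record ('c, 'cm, 'a, 'am) intcat =
  iobj :: "('c, 'cm) gpd"
  iarr :: "('a, 'am) gpd"
  isrc :: "('a, 'am, 'c, 'cm) gfun"
  itgt :: "('a, 'am, 'c, 'cm) gfun"
  icompos :: "('a \<times> 'a, 'am \<times> 'am, 'a, 'am) gfun"
  iident :: "('c, 'cm, 'a, 'am) gfun"

text \<open>
  From operads to internal categories. As the groupoid of colours is discrete and tuples are
  nonempty, the pullback of the input functor along \<open>(c, (*, \<dots>, *)) \<mapsto> (c, \<dots>, c)\<close> is the full
  subgroupoid of the operations all of whose inputs agree. The composite \<open>y \<circ> x\<close> plugs one copy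
  of \<open>x\<close> into each input of \<open>y\<close>; on arrows the copies are permuted as the inputs of \<open>y\<close> are.
\<close>

definition T_cat :: "('c, 'cm, 'q, 'qm) operad \<Rightarrow> ('c, 'cm, 'q, 'qm) intcat" where
  "T_cat Q = \<lparr>iobj = colours Q,
     iarr = full_sub (opers Q) {q. \<exists>c. set (Fo (inp Q) q) = {c}},
     isrc = \<lparr>Fo = (\<lambda>q. hd (Fo (inp Q) q)), Fa = (\<lambda>\<alpha>. snd (hd (Fa (inp Q) \<alpha>)))\<rparr>,
     itgt = outp Q,
     icompos = \<lparr>
       Fo = (\<lambda>(x, y). Fo (compos Q) (map (\<lambda>_. x) (Fo (inp Q) y), y)),
       Fa = (\<lambda>(\<xi>, \<upsilon>). Fa (compos Q) (map (\<lambda>(k, _). (k, \<xi>)) (Fa (inp Q) \<upsilon>), \<upsilon>))\<rparr>,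
     iident = units Q\<rparr>"

text \<open>
  From internal categories to operads. In \<open>compos\<close>, an object of
  \<open>S Q\<^sub>1 \<times>\<^bsub>S Q\<^sub>0\<^esub> Q\<^sub>1\<close> is a pair \<open>(gss, fs)\<close> of lists of the same length; in an arrow
  \<open>(\<Gamma>, \<phi>)\<close> the two lists carry the same permutation, by the pullback condition.
\<close>

definition T_operad :: "('c, 'cm, 'a, 'am) intcat \<Rightarrow> ('c, 'cm, 'a list, (nat \<times> 'am) list) operad" where
  "T_operad C = \<lparr>colours = iobj C,
     opers = full_sub (S_gpd (iarr C)) {fs. \<exists>c. set (map (Fo (itgt C)) fs) = {c}},
     inp = S_fun (isrc C),
     outp = \<lparr>Fo = (\<lambda>fs. Fo (itgt C) (hd fs)), Fa = (\<lambda>\<phi>. Fa (itgt C) (snd (hd \<phi>)))\<rparr>,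
     compos = \<lparr>
       Fo = (\<lambda>(gss, fs). concat
               (map2 (\<lambda>gs f. map (\<lambda>g. Fo (icompos C) (g, f)) gs) gss fs)),
       Fa = (\<lambda>(\<Gamma>, \<phi>). flatten_arrow
               (map2 (\<lambda>(k, \<gamma>) (_, f). (k, map (\<lambda>(l, g). (l, Fa (icompos C) (g, f))) \<gamma>)) \<Gamma> \<phi>))\<rparr>,
     units = gcomp S_unit (iident C)\<rparr>"

definition T_S :: "('c, 'cm, 'q, 'qm) operad \<Rightarrow> ('c, 'cm, 'q list, (nat \<times> 'qm) list) operad" where
  "T_S Q = T_operad (T_cat Q)"


section \<open>The bar construction\<close>

text \<open>
  The part of a simplicial groupoid in degrees at most 2; this is all that enters the incidence
  bialgebra.  \<open>dface n i\<close> stands for \<open>d\<^sub>i : X\<^sub>n \<rightarrow> X\<^sub>n\<^sub>-\<^sub>1\<close> and \<open>sdegen n i\<close> for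
  \<open>s\<^sub>i : X\<^sub>n \<rightarrow> X\<^sub>n\<^sub>+\<^sub>1\<close>.
\<close>

record ('o0, 'm0, 'o1, 'm1, 'o2, 'm2) simp_gpd2 =
  simp0 :: "('o0, 'm0) gpd"
  simp1 :: "('o1, 'm1) gpd"
  simp2 :: "('o2, 'm2) gpd"
  dface10 :: "('o1, 'm1, 'o0, 'm0) gfun"
  dface11 :: "('o1, 'm1, 'o0, 'm0) gfun"
  dface20 :: "('o2, 'm2, 'o1, 'm1) gfun"
  dface21 :: "('o2, 'm2, 'o1, 'm1) gfun"
  dface22 :: "('o2, 'm2, 'o1, 'm1) gfun"
  sdegen00 :: "('o0, 'm0, 'o1, 'm1) gfun"
  sdegen10 :: "('o1, 'm1, 'o2, 'm2) gfun"
  sdegen11 :: "('o1, 'm1, 'o2, 'm2) gfun"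

definition trees2 :: "('c, 'cm, 'q, 'qm) operad \<Rightarrow> ('q list \<times> 'q, (nat \<times> 'qm) list \<times> 'qm) gpd" where
  "trees2 Q = pullback_gpd (S_gpd (opers Q)) (opers Q) (S_fun (outp Q)) (inp Q)"

definition bar :: "('c, 'cm, 'q, 'qm) operad \<Rightarrow>
    ('c list, (nat \<times> 'cm) list, 'q list, (nat \<times> 'qm) list,
     ('q list \<times> 'q) list, (nat \<times> ((nat \<times> 'qm) list \<times> 'qm)) list) simp_gpd2" where
  "bar Q = \<lparr>
     simp0 = S_gpd (colours Q),
     simp1 = S_gpd (opers Q),
     simp2 = S_gpd (trees2 Q),
     dface10 = S_fun (outp Q),
     dface11 = gcomp S_mult (S_fun (inp Q)),
     dface20 = S_fun pr2,
     dface21 = S_fun (compos Q),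
     dface22 = gcomp S_mult (S_fun pr1),
     sdegen00 = S_fun (units Q),
     sdegen10 = S_fun (gpair (gcomp (S_fun (units Q)) (inp Q)) \<lparr>Fo = id, Fa = id\<rparr>),
     sdegen11 = S_fun (gpair S_unit (gcomp (units Q) (outp Q)))\<rparr>"


section \<open>Bialgebras over the rationals\<close>

text \<open>
  The underlying vector space is the free one on the set \<open>bbasis\<close>: the finitely supported
  functions supported there. The tensor square is the free vector space on \<open>bbasis \<times> bbasis\<close>.
\<close>

definition vscale :: "rat \<Rightarrow> ('b \<Rightarrow>\<^sub>0 rat) \<Rightarrow> ('b \<Rightarrow>\<^sub>0 rat)" where
  "vscale c v = Poly_Mapping.map ((*) c) v"

definition free_space :: "'b set \<Rightarrow> ('b \<Rightarrow>\<^sub>0 rat) set" where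
  "free_space B = {v. Poly_Mapping.keys v \<subseteq> B}"

text \<open>Linear extension of a map given on basis vectors.\<close>

definition lin_ext :: "('b \<Rightarrow> ('c \<Rightarrow>\<^sub>0 rat)) \<Rightarrow> ('b \<Rightarrow>\<^sub>0 rat) \<Rightarrow> ('c \<Rightarrow>\<^sub>0 rat)" where
  "lin_ext g v = (\<Sum>b\<in>Poly_Mapping.keys v. vscale (Poly_Mapping.lookup v b) (g b))"

definition lin_form :: "('b \<Rightarrow> rat) \<Rightarrow> ('b \<Rightarrow>\<^sub>0 rat) \<Rightarrow> rat" where
  "lin_form g v = (\<Sum>b\<in>Poly_Mapping.keys v. Poly_Mapping.lookup v b * g b)"

definition tensor :: "('b \<Rightarrow>\<^sub>0 rat) \<Rightarrow> ('c \<Rightarrow>\<^sub>0 rat) \<Rightarrow> ('b \<times> 'c \<Rightarrow>\<^sub>0 rat)" where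
  "tensor v w = lin_ext (\<lambda>a. lin_ext (\<lambda>b. Poly_Mapping.single (a, b) 1) w) v"

definition tensor_map :: "(('b \<Rightarrow>\<^sub>0 rat) \<Rightarrow> ('c \<Rightarrow>\<^sub>0 rat)) \<Rightarrow> ('b \<times> 'b \<Rightarrow>\<^sub>0 rat) \<Rightarrow> ('c \<times> 'c \<Rightarrow>\<^sub>0 rat)" where
  "tensor_map h = lin_ext (\<lambda>(a, b). tensor (h (Poly_Mapping.single a 1)) (h (Poly_Mapping.single b 1)))"

record 'b bialg =
  bbasis :: "'b set"
  bmult :: "('b \<Rightarrow>\<^sub>0 rat) \<Rightarrow> ('b \<Rightarrow>\<^sub>0 rat) \<Rightarrow> ('b \<Rightarrow>\<^sub>0 rat)"
  bunit :: "'b \<Rightarrow>\<^sub>0 rat"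
  bcomult :: "('b \<Rightarrow>\<^sub>0 rat) \<Rightarrow> ('b \<times> 'b \<Rightarrow>\<^sub>0 rat)"
  bcounit :: "('b \<Rightarrow>\<^sub>0 rat) \<Rightarrow> rat"

definition bialg_iso :: "'b bialg \<Rightarrow> 'c bialg \<Rightarrow> (('b \<Rightarrow>\<^sub>0 rat) \<Rightarrow> ('c \<Rightarrow>\<^sub>0 rat)) \<Rightarrow> bool" where
  "bialg_iso A B h \<longleftrightarrow>
     bij_betw h (free_space (bbasis A)) (free_space (bbasis B))
   \<and> (\<forall>v\<in>free_space (bbasis A). \<forall>w\<in>free_space (bbasis A). h (v + w) = h v + h w)
   \<and> (\<forall>c. \<forall>v\<in>free_space (bbasis A). h (vscale c v) = vscale c (h v))
   \<and> (\<forall>v\<in>free_space (bbasis A). \<forall>w\<in>free_space (bbasis A). h (bmult A v w) = bmult B (h v) (h w))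
   \<and> h (bunit A) = bunit B
   \<and> (\<forall>v\<in>free_space (bbasis A). tensor_map h (bcomult A v) = bcomult B (h v))
   \<and> (\<forall>v\<in>free_space (bbasis A). bcounit B (h v) = bcounit A v)"

definition bialg_isomorphic :: "'b bialg \<Rightarrow> 'c bialg \<Rightarrow> bool" where
  "bialg_isomorphic A B \<longleftrightarrow> (\<exists>h. bialg_iso A B h)"


section \<open>The incidence bialgebra\<close>

text \<open>
  \<open>\<Phi>\<^bsub>f;a,b\<^esub>\<close> for objects \<open>f\<close>, \<open>a\<close>, \<open>b\<close> of \<open>X\<^sub>1\<close>.
\<close>

definition incidence_fibre where
  "incidence_fibre X f a b =
     hofib (hofib (simp2 X) (simp1 X) (dface21 X) f) (prod_gpd (simp1 X) (simp1 X))
       (gcomp (gpair (dface22 X) (dface20 X)) hofib_proj) (a, b)"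

definition incidence_coeff ::
  "('o0, 'm0, 'o1, 'm1, 'o2, 'm2) simp_gpd2 \<Rightarrow> 'o1 set \<Rightarrow> 'o1 set \<Rightarrow> 'o1 set \<Rightarrow> rat" where
  "incidence_coeff X f a b =
     hcard (incidence_fibre X (rep f) (rep a) (rep b))
       / (of_nat (card (Aut (simp1 X) (rep a))) * of_nat (card (Aut (simp1 X) (rep b))))"

text \<open>
  The basis consists of \<open>\<delta>\<^sub>a = Some a\<close> for \<open>a \<in> \<pi>\<^sub>0 X\<^sub>1\<close> and of \<open>None\<close>, the adjoined unit (the
  empty configuration), which is grouplike. The objects of \<open>X\<^sub>1\<close> are lists, and the product
  is induced by their concatenation. A sum over an infinite set would be 0 in \<open>hcard\<close> and in
  the comultiplication; they are meant for \<open>X\<close> such that the groupoids involved are finite.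
\<close>

definition incidence_comult_basis ::
  "('o0, 'm0, 'o1, 'm1, 'o2, 'm2) simp_gpd2 \<Rightarrow> 'o1 set option
    \<Rightarrow> ('o1 set option \<times> 'o1 set option \<Rightarrow>\<^sub>0 rat)" where
  "incidence_comult_basis X u = (case u of
       None \<Rightarrow> Poly_Mapping.single (None, None) 1
     | Some f \<Rightarrow> (\<Sum>(a, b) | a \<in> pi0 (simp1 X) \<and> b \<in> pi0 (simp1 X) \<and> incidence_coeff X f a b \<noteq> 0.
                    Poly_Mapping.single (Some a, Some b) (incidence_coeff X f a b)))"

definition incidence_counit_basis ::
  "('o0, 'm0, 'o1, 'm1, 'o2, 'm2) simp_gpd2 \<Rightarrow> 'o1 set option \<Rightarrow> rat" where
  "incidence_counit_basis X u = (case u of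
       None \<Rightarrow> 1
     | Some f \<Rightarrow> hcard (hofib (simp0 X) (simp1 X) (sdegen00 X) (rep f)))"

definition juxtapose ::
  "('o0, 'm0, 'q list, 'm1, 'o2, 'm2) simp_gpd2 \<Rightarrow> 'q list set option \<Rightarrow> 'q list set option
    \<Rightarrow> 'q list set option" where
  "juxtapose X u v = (case (u, v) of
       (None, _) \<Rightarrow> v
     | (_, None) \<Rightarrow> u
     | (Some a, Some b) \<Rightarrow> Some (iso_rel (simp1 X) `` {rep a @ rep b}))"

definition incidence_bialgebra ::
  "('o0, 'm0, 'q list, 'm1, 'o2, 'm2) simp_gpd2 \<Rightarrow> 'q list set option bialg" where
  "incidence_bialgebra X = \<lparr>
     bbasis = insert None (Some ` pi0 (simp1 X)),
     bmult = (\<lambda>v w. lin_ext (\<lambda>a. lin_ext (\<lambda>b. Poly_Mapping.single (juxtapose X a b) 1) w) v),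
     bunit = Poly_Mapping.single None 1,
     bcomult = lin_ext (incidence_comult_basis X),
     bcounit = lin_form (incidence_counit_basis X)\<rparr>"


section \<open>Power series in infinitely many variables and plethysm\<close>

text \<open>
  An exponent \<open>\<alpha> :: nat \<Rightarrow>\<^sub>0 nat\<close> stands for the monomial \<open>x\<^sup>\<alpha> = \<Prod>\<^sub>i x\<^sub>i ^ \<alpha>\<^sub>i\<close>. The type allows a
  variable \<open>x\<^sub>0\<close>; it is excluded by the definitions of \<open>Lam\<close> and \<open>series_plus\<close> below. Series are
  given by their plain coefficients (not divided by \<open>aut\<close>).
\<close>

typedef series = "UNIV :: ((nat \<Rightarrow>\<^sub>0 nat) \<Rightarrow> rat) set"
  morphisms series_coeff Series ..

lemma series_coeff_Series [simp]: "series_coeff (Series f) = f"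
  by (simp add: Series_inverse)

lemma series_eqI: "(\<And>\<alpha>. series_coeff F \<alpha> = series_coeff G \<alpha>) \<Longrightarrow> F = G"
  by (metis ext series_coeff_inject)

lemma finite_exponent_le:
  "finite {\<alpha> :: nat \<Rightarrow>\<^sub>0 nat. \<exists>\<beta>. \<alpha> + \<beta> = \<gamma>}"
proof -
  let ?K = "Poly_Mapping.keys \<gamma>"
  let ?N = "Max (insert 0 (Poly_Mapping.lookup \<gamma> ` ?K))"
  let ?F = "{f. \<forall>x. (x \<in> ?K \<longrightarrow> f x \<in> {..?N}) \<and> (x \<notin> ?K \<longrightarrow> f x = (0::nat))}"
  have fin: "finite ?F"
    by (rule finite_set_of_finite_funs) auto
  have "Poly_Mapping.lookup ` {\<alpha>. \<exists>\<beta>. \<alpha> + \<beta> = \<gamma>} \<subseteq> ?F"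
  proof (intro subsetI)
    fix f assume "f \<in> Poly_Mapping.lookup ` {\<alpha>. \<exists>\<beta>. \<alpha> + \<beta> = \<gamma>}"
    then obtain \<alpha> \<beta> where f: "f = Poly_Mapping.lookup \<alpha>" and \<gamma>: "\<alpha> + \<beta> = \<gamma>" by auto
    have le: "f x \<le> Poly_Mapping.lookup \<gamma> x" for x
      by (simp add: f \<gamma>[symmetric] lookup_add)
    have "f x \<le> ?N" if "x \<in> ?K" for x
      using le[of x] that by (meson Max_ge dual_order.trans finite_imageI finite_insert finite_keys imageI insertI2)
    moreover have "f x = 0" if "x \<notin> ?K" for x
      using le[of x] that by (simp add: in_keys_iff)
    ultimately show "f \<in> ?F" by auto
  qed
  hence "finite (Poly_Mapping.lookup ` {\<alpha>. \<exists>\<beta>. \<alpha> + \<beta> = \<gamma>})"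
    using fin by (rule finite_subset)
  thus ?thesis
    by (rule finite_imageD) (auto simp: inj_on_def poly_mapping_eqI)
qed

lemma finite_exponent_splits:
  "finite {(\<alpha>, \<beta>). \<alpha> + \<beta> = (\<gamma> :: nat \<Rightarrow>\<^sub>0 nat)}"
proof -
  let ?D = "{\<alpha>. \<exists>\<beta>. \<alpha> + \<beta> = \<gamma>}"
  have "{(\<alpha>, \<beta>). \<alpha> + \<beta> = \<gamma>} \<subseteq> ?D \<times> ?D"
    by auto (metis add.commute)
  thus ?thesis
    using finite_exponent_le by (meson finite_SigmaI finite_subset)
qed

instantiation series :: comm_monoid_mult
begin

definition one_series :: series where
  "one_series = Series (\<lambda>\<gamma>. if \<gamma> = 0 then 1 else 0)"

definition times_series :: "series \<Rightarrow> series \<Rightarrow> series" where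
  "F * G = Series (\<lambda>\<gamma>. \<Sum>(\<alpha>, \<beta>) | \<alpha> + \<beta> = \<gamma>. series_coeff F \<alpha> * series_coeff G \<beta>)"

instance
proof
  fix F G H :: series
  show "F * G * H = F * (G * H)"
  proof (rule series_eqI)
    fix \<gamma> :: "nat \<Rightarrow>\<^sub>0 nat"
    let ?f = "series_coeff F" and ?g = "series_coeff G" and ?h = "series_coeff H"
    have "series_coeff (F * G * H) \<gamma>
        = (\<Sum>p\<in>{(\<delta>, \<epsilon>). \<delta> + \<epsilon> = \<gamma>}. \<Sum>q\<in>{(\<alpha>, \<beta>). \<alpha> + \<beta> = fst p}. ?f (fst q) * ?g (snd q) * ?h (snd p))"
      by (simp add: times_series_def sum_distrib_right case_prod_unfold)
    also have "\<dots> = (\<Sum>(p, q)\<in>(SIGMA p:{(\<delta>, \<epsilon>). \<delta> + \<epsilon> = \<gamma>}. {(\<alpha>, \<beta>). \<alpha> + \<beta> = fst p}).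
                      ?f (fst q) * ?g (snd q) * ?h (snd p))"
      by (rule sum.Sigma) (auto simp: finite_exponent_splits)
    also have "\<dots> = (\<Sum>(p, q)\<in>(SIGMA p:{(\<alpha>, \<delta>). \<alpha> + \<delta> = \<gamma>}. {(\<beta>, \<epsilon>). \<beta> + \<epsilon> = snd p}).
                      ?f (fst p) * (?g (fst q) * ?h (snd q)))"
      by (rule sum.reindex_bij_witness
            [where i = "\<lambda>(p, q). ((fst p + fst q, snd q), (fst p, fst q))"
               and j = "\<lambda>(p, q). ((fst q, snd q + snd p), (snd q, snd p))"])
         (auto simp: add.assoc mult.assoc)
    also have "\<dots> = (\<Sum>p\<in>{(\<alpha>, \<delta>). \<alpha> + \<delta> = \<gamma>}. \<Sum>q\<in>{(\<beta>, \<epsilon>). \<beta> + \<epsilon> = snd p}.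
                      ?f (fst p) * (?g (fst q) * ?h (snd q)))"
      by (rule sum.Sigma[symmetric]) (auto simp: finite_exponent_splits)
    also have "\<dots> = series_coeff (F * (G * H)) \<gamma>"
      by (simp add: times_series_def sum_distrib_left case_prod_unfold)
    finally show "series_coeff (F * G * H) \<gamma> = series_coeff (F * (G * H)) \<gamma>" .
  qed
  show "F * G = G * F"
  proof (rule series_eqI)
    fix \<gamma> :: "nat \<Rightarrow>\<^sub>0 nat"
    show "series_coeff (F * G) \<gamma> = series_coeff (G * F) \<gamma>"
      unfolding times_series_def series_coeff_Series
      by (rule sum.reindex_bij_witness[where i = prod.swap and j = prod.swap])
         (auto simp: add.commute mult.commute)
  qed
  show "1 * F = F"
  proof (rule series_eqI)
    fix \<gamma> :: "nat \<Rightarrow>\<^sub>0 nat"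
    have "series_coeff (1 * F) \<gamma>
        = (\<Sum>(\<alpha>, \<beta>)\<in>{(0 :: nat \<Rightarrow>\<^sub>0 nat, \<gamma>)}. (if \<alpha> = 0 then 1 else 0) * series_coeff F \<beta>)"
      unfolding times_series_def one_series_def series_coeff_Series
      by (rule sum.mono_neutral_right) (auto simp: finite_exponent_splits split: if_splits)
    thus "series_coeff (1 * F) \<gamma> = series_coeff F \<gamma>" by simp
  qed
qed

end

definition Lam :: "(nat \<Rightarrow>\<^sub>0 nat) set" where
  "Lam = {l. Poly_Mapping.lookup l 0 = 0 \<and> l \<noteq> 0}"

text \<open>The series in \<open>x\<^sub>1, x\<^sub>2, \<dots>\<close> without constant term.\<close>

definition series_plus :: "series set" where
  "series_plus = {F. \<forall>\<alpha>. series_coeff F \<alpha> \<noteq> 0 \<longrightarrow> \<alpha> \<in> Lam}"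

definition lam_aut :: "(nat \<Rightarrow>\<^sub>0 nat) \<Rightarrow> rat" where
  "lam_aut l = (\<Prod>i\<in>Poly_Mapping.keys l. fact i ^ Poly_Mapping.lookup l i * fact (Poly_Mapping.lookup l i))"

text \<open>The coefficient \<open>F\<^sub>\<lambda>\<close> of \<open>x\<^sup>\<lambda> / aut(\<lambda>)\<close>, that is, the value \<open>A\<^sub>\<lambda>(F)\<close>.\<close>

definition A_coeff :: "(nat \<Rightarrow>\<^sub>0 nat) \<Rightarrow> series \<Rightarrow> rat" where
  "A_coeff l F = lam_aut l * series_coeff F l"

definition series_x1 :: series where
  "series_x1 = Series (\<lambda>\<alpha>. if \<alpha> = Poly_Mapping.single 1 1 then 1 else 0)"

text \<open>
  \<open>F\<^sub>k = F(x\<^sub>k, x\<^sub>2\<^sub>k, \<dots>)\<close> for \<open>k \<ge> 1\<close>: only monomials in the variables \<open>x\<^sub>k\<^sub>i\<close> occur, and the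
  coefficient of \<open>\<Prod>\<^sub>i x\<^sub>k\<^sub>i ^ \<alpha>\<^sub>i\<close> is that of \<open>x\<^sup>\<alpha>\<close> in \<open>F\<close>.
\<close>

definition series_dilate :: "nat \<Rightarrow> series \<Rightarrow> series" where
  "series_dilate k F = Series (\<lambda>\<gamma>. if \<forall>j\<in>Poly_Mapping.keys \<gamma>. k dvd j
     then series_coeff F (Poly_Mapping.map_key (\<lambda>i. k * i) \<gamma>) else 0)"

text \<open>
  \<open>G \<circledast> F = \<Sum>\<^sub>\<mu> [x\<^sup>\<mu>]G \<cdot> \<Prod>\<^sub>k F\<^sub>k ^ \<mu>\<^sub>k\<close>. For \<open>F\<close> and \<open>G\<close> in \<open>series_plus\<close> only finitely many \<open>\<mu>\<close>
  contribute to each coefficient, so that the finite-support sum \<open>Sum_any\<close> is the formal sum.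
\<close>

definition plethysm :: "series \<Rightarrow> series \<Rightarrow> series" where
  "plethysm G F = Series (\<lambda>\<gamma>. Sum_any (\<lambda>\<mu>. series_coeff G \<mu> *
     series_coeff (\<Prod>k\<in>Poly_Mapping.keys \<mu>. series_dilate k F ^ Poly_Mapping.lookup \<mu> k) \<gamma>))"


section \<open>The plethystic bialgebra\<close>

text \<open>
  A monomial \<open>m :: (nat \<Rightarrow>\<^sub>0 nat) \<Rightarrow>\<^sub>0 nat\<close> stands for \<open>\<Prod>\<^sub>l A\<^sub>l ^ m\<^sub>l\<close>, and polynomials are finitely
  supported functions on monomials, with the convolution product of \<open>Poly_Mapping\<close>. Likewise the
  tensor square of the polynomial algebra is the algebra of finitely supported functions on
  pairs of monomials.
\<close>

type_synonym A_monom = "(nat \<Rightarrow>\<^sub>0 nat) \<Rightarrow>\<^sub>0 nat"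
type_synonym A_poly = "A_monom \<Rightarrow>\<^sub>0 rat"

definition A_monoms :: "A_monom set" where
  "A_monoms = {m. Poly_Mapping.keys m \<subseteq> Lam}"

definition monom_eval :: "A_monom \<Rightarrow> series \<Rightarrow> rat" where
  "monom_eval m F = (\<Prod>l\<in>Poly_Mapping.keys m. A_coeff l F ^ Poly_Mapping.lookup m l)"

definition tensor_eval :: "(A_monom \<times> A_monom \<Rightarrow>\<^sub>0 rat) \<Rightarrow> series \<Rightarrow> series \<Rightarrow> rat" where
  "tensor_eval t F G = lin_form (\<lambda>(m, n). monom_eval m F * monom_eval n G) t"

definition plethystic_comult_gen :: "(nat \<Rightarrow>\<^sub>0 nat) \<Rightarrow> (A_monom \<times> A_monom \<Rightarrow>\<^sub>0 rat)" where
  "plethystic_comult_gen l = (THE t. t \<in> free_space (A_monoms \<times> A_monoms) \<and>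
     (\<forall>F\<in>series_plus. \<forall>G\<in>series_plus. tensor_eval t F G = A_coeff l (plethysm G F)))"

text \<open>The comultiplication and the counit are the algebra maps with the prescribed values on generators.\<close>

definition plethystic_comult :: "A_poly \<Rightarrow> (A_monom \<times> A_monom \<Rightarrow>\<^sub>0 rat)" where
  "plethystic_comult = lin_ext (\<lambda>m. \<Prod>l\<in>Poly_Mapping.keys m. plethystic_comult_gen l ^ Poly_Mapping.lookup m l)"

definition plethystic_counit :: "A_poly \<Rightarrow> rat" where
  "plethystic_counit = lin_form (\<lambda>m. \<Prod>l\<in>Poly_Mapping.keys m. A_coeff l series_x1 ^ Poly_Mapping.lookup m l)"

definition plethystic_bialgebra :: "A_monom bialg" where
  "plethystic_bialgebra = \<lparr>
     bbasis = A_monoms,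
     bmult = (*),
     bunit = 1,
     bcomult = plethystic_comult,
     bcounit = plethystic_counit\<rparr>"

end

(*
A component of S(S(S 1)) is a finite multiset of multisets of positive integers, that is, a
monomial in the A_l, and the isomorphism sends each monomial to the basis vector of the
corresponding component. All homotopy cardinalities are evaluated with one device: a finite
groupoid has cardinality SUM x:Ob. 1/d(x), where d(x) counts the arrows out of x. Passing to a
homotopy fibre does not change d, so a comultiplication coefficient is |Aut f| times the sum of 1/d(x) over
the configurations x of two-level trees whose composite is isomorphic to f and whose two outer
faces are the prescribed ones. As d(x) is multiplicative (up to the factorial of the length of the
list), these sums factor over the members of the multiset f, and for a single member l they are
the coefficient of x^l in a plethysm expanded over lists (k_1, ..., k_r) representing the outer monomial.
That the comultiplication of P is thereby determined is the independence of distinct characters.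
*)

theory Submission
  imports Defs "HOL-Combinatorics.Multiset_Permutations"
begin

section \<open>Groupoids and homotopy fibres\<close>

text \<open>The faces of \<open>bar (T_S Sym)\<close> act on nested lists, and their arrows carry
  nested permutations. Homotopy fibres can be evaluated only for maps known to be functors, so much
  of the work on the groupoid side is functoriality. It is obtained by writing the operadic
  composition as a chain of general constructions (zipping, strength, copying, concatenation), each
  functorial for arbitrary groupoids. Summing 1/d(x) over objects avoids any choice of
  representatives among the trees: which configurations of trees are isomorphic never has to be
  decided, only which of their faces are. The sums are not formed one coefficient at a time but in
  the convolution ring of the tensor square, where basis vectors multiply like monomials. A single
  distributive law over lists, valid in every commutative semiring, then counts arrows, gives the
  orders of automorphism groups and factors the comultiplication. The constants aut(\<lambda>) enter
  as orders of automorphism groups in S(S 1), and both comultiplications are compared with the same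
  explicit element \<open>tree_gen l\<close>.\<close>

locale groupoid =
  fixes G :: "('o, 'm) gpd"
  assumes dom_ob: "f \<in> Ar G \<Longrightarrow> Dom G f \<in> Ob G"
    and cod_ob: "f \<in> Ar G \<Longrightarrow> Cod G f \<in> Ob G"
    and idn_ar: "x \<in> Ob G \<Longrightarrow> Idn G x \<in> Ar G"
    and dom_idn: "x \<in> Ob G \<Longrightarrow> Dom G (Idn G x) = x"
    and cod_idn: "x \<in> Ob G \<Longrightarrow> Cod G (Idn G x) = x"
    and cmp_ar: "f \<in> Ar G \<Longrightarrow> g \<in> Ar G \<Longrightarrow> Dom G g = Cod G f \<Longrightarrow> Cmp G g f \<in> Ar G"
    and dom_cmp: "f \<in> Ar G \<Longrightarrow> g \<in> Ar G \<Longrightarrow> Dom G g = Cod G f \<Longrightarrow> Dom G (Cmp G g f) = Dom G f"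
    and cod_cmp: "f \<in> Ar G \<Longrightarrow> g \<in> Ar G \<Longrightarrow> Dom G g = Cod G f \<Longrightarrow> Cod G (Cmp G g f) = Cod G g"
    and cmp_assoc: "f \<in> Ar G \<Longrightarrow> g \<in> Ar G \<Longrightarrow> h \<in> Ar G \<Longrightarrow> Dom G g = Cod G f \<Longrightarrow>
          Dom G h = Cod G g \<Longrightarrow> Cmp G h (Cmp G g f) = Cmp G (Cmp G h g) f"
    and cmp_idn_left: "f \<in> Ar G \<Longrightarrow> Cmp G (Idn G (Cod G f)) f = f"
    and cmp_idn_right: "f \<in> Ar G \<Longrightarrow> Cmp G f (Idn G (Dom G f)) = f"
    and left_inverse: "f \<in> Ar G \<Longrightarrow>
          \<exists>g\<in>Ar G. Dom G g = Cod G f \<and> Cod G g = Dom G f \<and> Cmp G g f = Idn G (Dom G f)"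

definition arrows_from :: "('o, 'm) gpd \<Rightarrow> 'o \<Rightarrow> 'm set" where
  "arrows_from G x = {f \<in> Ar G. Dom G f = x}"

definition hom_set :: "('o, 'm) gpd \<Rightarrow> 'o \<Rightarrow> 'o \<Rightarrow> 'm set" where
  "hom_set G x y = {f \<in> Ar G. Dom G f = x \<and> Cod G f = y}"

text \<open>Arrows out of x rather than automorphisms of x: this number can be computed entry by
  entry in products, in the pullbacks that occur, in \<open>S_gpd\<close> and in homotopy fibres,
  without knowing the isomorphism classes. As \<open>card\<close> is 0 on infinite sets, it is used
  together with \<open>locally_finite\<close>.\<close>

definition outdeg :: "('o, 'm) gpd \<Rightarrow> 'o \<Rightarrow> nat" where
  "outdeg G x = card (arrows_from G x)"

definition locally_finite :: "('o, 'm) gpd \<Rightarrow> bool" where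
  "locally_finite G \<longleftrightarrow> (\<forall>x\<in>Ob G. finite (arrows_from G x))"

context groupoid
begin

text \<open>A left inverse g of f has itself a left inverse h, and h = h(gf) = (hg)f = f.\<close>

lemma inverse_exists:
  assumes f: "f \<in> Ar G"
  obtains g where "g \<in> Ar G" "Dom G g = Cod G f" "Cod G g = Dom G f"
    "Cmp G g f = Idn G (Dom G f)" "Cmp G f g = Idn G (Cod G f)"
proof -
  obtain g where g: "g \<in> Ar G" "Dom G g = Cod G f" "Cod G g = Dom G f" "Cmp G g f = Idn G (Dom G f)"
    using left_inverse[OF f] by blast
  obtain h where h: "h \<in> Ar G" "Dom G h = Cod G g" "Cod G h = Dom G g" "Cmp G h g = Idn G (Dom G g)"
    using left_inverse[OF g(1)] by blast
  have "h = Cmp G h (Cmp G g f)"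
    using cmp_idn_right[OF h(1)] by (simp add: g h)
  also have "\<dots> = Cmp G (Cmp G h g) f"
    by (rule cmp_assoc) (use f g h in auto)
  also have "\<dots> = f"
    using cmp_idn_left[OF f] by (simp add: g h)
  finally have "Cmp G f g = Idn G (Cod G f)" using h g by simp
  with g show ?thesis using that by blast
qed

lemma iso_rel_iff: "(x, y) \<in> iso_rel G \<longleftrightarrow> hom_set G x y \<noteq> {}"
  by (auto simp: iso_rel_def hom_set_def dom_ob cod_ob)

lemma equiv_iso_rel: "equiv (Ob G) (iso_rel G)"
proof (rule equivI)
  show "iso_rel G \<subseteq> Ob G \<times> Ob G" by (auto simp: iso_rel_def)
  show "refl_on (Ob G) (iso_rel G)"
    by (auto simp: refl_on_def iso_rel_def intro!: bexI[of _ "Idn G _"] idn_ar dom_idn cod_idn)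
  show "sym (iso_rel G)"
  proof (rule symI)
    fix x y assume "(x, y) \<in> iso_rel G"
    then obtain f where "f \<in> Ar G" "Dom G f = x" "Cod G f = y" "x \<in> Ob G" "y \<in> Ob G"
      by (auto simp: iso_rel_def)
    moreover from this obtain g where "g \<in> Ar G" "Dom G g = Cod G f" "Cod G g = Dom G f"
      using left_inverse by metis
    ultimately show "(y, x) \<in> iso_rel G"
      by (auto simp: iso_rel_def)
  qed
  show "trans (iso_rel G)"
  proof (rule transI)
    fix x y z assume "(x, y) \<in> iso_rel G" "(y, z) \<in> iso_rel G"
    then obtain f g where "f \<in> Ar G" "Dom G f = x" "Cod G f = y" "g \<in> Ar G" "Dom G g = y" "Cod G g = z"
      by (auto simp: iso_rel_def)
    then have "Cmp G g f \<in> hom_set G x z"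
      by (auto simp: hom_set_def cmp_ar dom_cmp cod_cmp)
    then show "(x, z) \<in> iso_rel G" by (auto simp: iso_rel_iff)
  qed
qed

lemma bij_betw_postcompose:
  assumes g: "g \<in> hom_set G y z"
  shows "bij_betw (Cmp G g) (hom_set G x y) (hom_set G x z)"
proof -
  have g': "g \<in> Ar G" "Dom G g = y" "Cod G g = z" using g by (auto simp: hom_set_def)
  obtain h where h: "h \<in> Ar G" "Dom G h = z" "Cod G h = y" "Cmp G h g = Idn G y" "Cmp G g h = Idn G z"
    using inverse_exists[OF g'(1)] g' by metis
  show ?thesis
    by (rule bij_betw_byWitness[where f' = "Cmp G h"])
       (auto simp: hom_set_def cmp_ar dom_cmp cod_cmp g' h cmp_assoc cmp_idn_left
          dest: cmp_idn_left)
qed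

lemma bij_betw_precompose:
  assumes g: "g \<in> hom_set G x y"
  shows "bij_betw (\<lambda>f. Cmp G f g) (hom_set G y z) (hom_set G x z)"
proof -
  have g': "g \<in> Ar G" "Dom G g = x" "Cod G g = y" using g by (auto simp: hom_set_def)
  obtain h where h: "h \<in> Ar G" "Dom G h = y" "Cod G h = x" "Cmp G h g = Idn G x" "Cmp G g h = Idn G y"
    using inverse_exists[OF g'(1)] g' by metis
  show ?thesis
    by (rule bij_betw_byWitness[where f' = "\<lambda>f. Cmp G f h"])
       (auto simp: hom_set_def cmp_ar dom_cmp cod_cmp g' h cmp_assoc[symmetric] cmp_idn_right
          dest: cmp_idn_right)
qed

lemma card_hom_set:
  assumes "(x, y) \<in> iso_rel G"
  shows "card (hom_set G x y) = card (Aut G x)" "card (hom_set G x y) = card (Aut G y)"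
proof -
  obtain f where f: "f \<in> hom_set G x y" using assms iso_rel_iff by auto
  have A: "Aut G z = hom_set G z z" for z by (auto simp: Aut_def hom_set_def)
  show "card (hom_set G x y) = card (Aut G x)"
    using bij_betw_same_card[OF bij_betw_postcompose[OF f, of x]] by (simp add: A)
  show "card (hom_set G x y) = card (Aut G y)"
    using bij_betw_same_card[OF bij_betw_precompose[OF f, of y]] by (simp add: A)
qed

lemma arrows_from_eq_UN: "arrows_from G x = (\<Union>y\<in>iso_rel G `` {x}. hom_set G x y)"
  by (auto simp: arrows_from_def hom_set_def iso_rel_def dom_ob cod_ob)

lemma finite_iso_class:
  assumes "finite (arrows_from G x)"
  shows "finite (iso_rel G `` {x})"
proof -
  have "iso_rel G `` {x} \<subseteq> Cod G ` arrows_from G x"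
    by (auto simp: iso_rel_def arrows_from_def)
  then show ?thesis using assms finite_surj by blast
qed

text \<open>Sort the arrows out of x by their target: every hom set that occurs is a translate of
  \<open>Aut G x\<close>.\<close>

lemma outdeg_eq:
  assumes fin: "finite (arrows_from G x)"
  shows "outdeg G x = card (iso_rel G `` {x}) * card (Aut G x)"
proof -
  have "outdeg G x = (\<Sum>y\<in>iso_rel G `` {x}. card (hom_set G x y))"
    unfolding outdeg_def arrows_from_eq_UN
  proof (rule card_UN_disjoint)
    show "finite (iso_rel G `` {x})" by (rule finite_iso_class[OF fin])
    show "\<forall>y\<in>iso_rel G `` {x}. finite (hom_set G x y)"
      using fin by (auto intro: finite_subset[of _ "arrows_from G x"] simp: hom_set_def arrows_from_def)
  qed (auto simp: hom_set_def)
  also have "\<dots> = (\<Sum>y\<in>iso_rel G `` {x}. card (Aut G x))"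
    by (rule sum.cong) (auto simp: card_hom_set)
  finally show ?thesis by simp
qed

lemma outdeg_pos:
  assumes "x \<in> Ob G" "finite (arrows_from G x)"
  shows "outdeg G x > 0"
proof -
  have "Idn G x \<in> arrows_from G x"
    using assms by (simp add: arrows_from_def idn_ar dom_idn)
  then show ?thesis using assms by (auto simp: outdeg_def card_gt_0_iff)
qed

text \<open>\<open>outdeg\<close> is constant on the class of x, namely its size times |Aut x|, so
  the members share the weight 1/|Aut x| equally.\<close>

lemma sum_iso_class:
  assumes lf: "locally_finite G" and x: "x \<in> Ob G"
  shows "(\<Sum>y\<in>iso_rel G `` {x}. 1 / rat_of_nat (outdeg G y)) = 1 / rat_of_nat (card (Aut G x))"
proof -
  note E = equiv_iso_rel
  let ?c = "iso_rel G `` {x}"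
  have fin: "finite (arrows_from G y)" if "y \<in> Ob G" for y
    using lf that by (simp add: locally_finite_def)
  have "outdeg G y = card ?c * card (Aut G x)" if y: "y \<in> ?c" for y
  proof -
    have xy: "(x, y) \<in> iso_rel G" using y by simp
    have "y \<in> Ob G" using xy by (auto simp: iso_rel_def)
    moreover have "iso_rel G `` {y} = ?c" using equiv_class_eq[OF E xy] by simp
    ultimately show ?thesis
      using outdeg_eq[OF fin] card_hom_set[OF xy] by simp
  qed
  then have "(\<Sum>y\<in>?c. 1 / rat_of_nat (outdeg G y))
      = (\<Sum>y\<in>?c. 1 / (rat_of_nat (card ?c) * rat_of_nat (card (Aut G x))))"
    by (intro sum.cong) auto
  moreover have "?c \<noteq> {}" using equiv_class_self[OF E x] by blast
  ultimately show ?thesis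
    using finite_iso_class[OF fin[OF x]] by simp
qed

text \<open>The choice hidden in \<open>rep\<close> disappears here, since a class sums to 1/|Aut|
  of whichever member is chosen.\<close>

lemma hcard_eq:
  assumes fin: "finite (Ob G)" and lf: "locally_finite G"
  shows "hcard G = (\<Sum>x\<in>Ob G. 1 / of_nat (outdeg G x))"
proof -
  note E = equiv_iso_rel
  have U: "\<Union>(pi0 G) = Ob G" unfolding pi0_def by (rule Union_quotient[OF E])
  have "(\<Sum>x\<in>Ob G. 1 / rat_of_nat (outdeg G x)) = (\<Sum>x\<in>\<Union>(pi0 G). 1 / rat_of_nat (outdeg G x))"
    by (simp add: U)
  also have "\<dots> = (\<Sum>c\<in>pi0 G. \<Sum>x\<in>c. 1 / rat_of_nat (outdeg G x))"
  proof (subst sum.Union_disjoint)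
    show "\<forall>A\<in>pi0 G. finite A"
      using U fin by (metis Union_upper finite_subset)
    show "\<forall>A\<in>pi0 G. \<forall>B\<in>pi0 G. A \<noteq> B \<longrightarrow> A \<inter> B = {}"
      using quotient_disj[OF E] by (auto simp: pi0_def)
  qed auto
  also have "\<dots> = hcard G"
    unfolding hcard_def
  proof (rule sum.cong)
    fix c assume c: "c \<in> pi0 G"
    then have ne: "c \<noteq> {}" using E by (simp add: pi0_def in_quotient_imp_non_empty)
    then have r: "rep c \<in> c" unfolding rep_def by (simp add: some_in_eq)
    then have "rep c \<in> Ob G" using U c by blast
    moreover have "c = iso_rel G `` {rep c}"
      using c r E unfolding pi0_def by (metis Image_singleton_iff equiv_class_eq_iff quotientE)
    ultimately show "(\<Sum>x\<in>c. 1 / rat_of_nat (outdeg G x)) = 1 / rat_of_nat (card (Aut G (rep c)))"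
      using sum_iso_class[OF lf] by metis
  qed simp
  finally show ?thesis by simp
qed

end

locale gfunctor = A: groupoid A + B: groupoid B
  for A :: "('o, 'm) gpd" and B :: "('p, 'n) gpd" +
  fixes F :: "('o, 'm, 'p, 'n) gfun"
  assumes fa_ar: "f \<in> Ar A \<Longrightarrow> Fa F f \<in> Ar B"
    and dom_fa: "f \<in> Ar A \<Longrightarrow> Dom B (Fa F f) = Fo F (Dom A f)"
    and cod_fa: "f \<in> Ar A \<Longrightarrow> Cod B (Fa F f) = Fo F (Cod A f)"
    and fa_cmp: "f \<in> Ar A \<Longrightarrow> g \<in> Ar A \<Longrightarrow> Dom A g = Cod A f \<Longrightarrow>
        Fa F (Cmp A g f) = Cmp B (Fa F g) (Fa F f)"
begin

lemma fo_ob: "x \<in> Ob A \<Longrightarrow> Fo F x \<in> Ob B"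
  by (metis A.dom_idn A.idn_ar B.dom_ob dom_fa fa_ar)

text \<open>The image of an identity is idempotent, and an idempotent arrow of a groupoid can be
  cancelled against its inverse.\<close>

lemma fa_idn:
  assumes x: "x \<in> Ob A"
  shows "Fa F (Idn A x) = Idn B (Fo F x)"
proof -
  let ?e = "Fa F (Idn A x)"
  have e: "?e \<in> Ar B" "Dom B ?e = Fo F x" "Cod B ?e = Fo F x"
    using x by (auto simp: A.idn_ar A.dom_idn A.cod_idn fa_ar dom_fa cod_fa)
  have ee: "Cmp B ?e ?e = ?e"
    using x by (metis A.cod_idn A.cmp_idn_left A.dom_idn A.idn_ar fa_cmp)
  obtain h where h: "h \<in> Ar B" "Dom B h = Fo F x" "Cod B h = Fo F x" "Cmp B h ?e = Idn B (Fo F x)"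
    using B.inverse_exists[OF e(1)] e by metis
  have "Idn B (Fo F x) = Cmp B h (Cmp B ?e ?e)" by (simp add: ee h)
  also have "\<dots> = Cmp B (Cmp B h ?e) ?e" by (rule B.cmp_assoc) (use e h in auto)
  also have "\<dots> = ?e" using B.cmp_idn_left[OF e(1)] by (simp add: h e)
  finally show ?thesis ..
qed

end

lemma gfunctor_gcomp:
  assumes "gfunctor A B F" "gfunctor B C G"
  shows "gfunctor A C (gcomp G F)"
proof -
  interpret F: gfunctor A B F by fact
  interpret G: gfunctor B C G by fact
  show ?thesis
    by unfold_locales
       (auto simp: gcomp_def F.fa_ar F.dom_fa F.cod_fa F.fa_cmp G.fa_ar G.dom_fa G.cod_fa G.fa_cmp)
qed

lemma groupoid_prod_gpd:
  assumes "groupoid A" "groupoid B"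
  shows "groupoid (prod_gpd A B)"
proof -
  interpret A: groupoid A by fact
  interpret B: groupoid B by fact
  show ?thesis
  proof
    fix f assume "f \<in> Ar (prod_gpd A B)"
    then obtain a b where ab: "f = (a, b)" "a \<in> Ar A" "b \<in> Ar B" by (auto simp: prod_gpd_def)
    obtain a' b' where "a' \<in> Ar A" "Dom A a' = Cod A a" "Cod A a' = Dom A a" "Cmp A a' a = Idn A (Dom A a)"
       "b' \<in> Ar B" "Dom B b' = Cod B b" "Cod B b' = Dom B b" "Cmp B b' b = Idn B (Dom B b)"
      using A.left_inverse[OF ab(2)] B.left_inverse[OF ab(3)] by blast
    then show "\<exists>g\<in>Ar (prod_gpd A B). Dom (prod_gpd A B) g = Cod (prod_gpd A B) f \<and>
       Cod (prod_gpd A B) g = Dom (prod_gpd A B) f \<and>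
       Cmp (prod_gpd A B) g f = Idn (prod_gpd A B) (Dom (prod_gpd A B) f)"
      by (intro bexI[of _ "(a', b')"]) (auto simp: prod_gpd_def ab)
  qed (auto simp: prod_gpd_def A.dom_ob A.cod_ob A.idn_ar A.dom_idn A.cod_idn A.cmp_ar A.dom_cmp A.cod_cmp
         A.cmp_assoc A.cmp_idn_left A.cmp_idn_right B.dom_ob B.cod_ob B.idn_ar B.dom_idn B.cod_idn
         B.cmp_ar B.dom_cmp B.cod_cmp B.cmp_assoc B.cmp_idn_left B.cmp_idn_right)
qed

lemma arrows_from_prod_gpd: "arrows_from (prod_gpd A B) (x, y) = arrows_from A x \<times> arrows_from B y"
  by (auto simp: arrows_from_def prod_gpd_def)

lemma outdeg_prod_gpd: "outdeg (prod_gpd A B) (x, y) = outdeg A x * outdeg B y"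
  by (simp add: outdeg_def arrows_from_prod_gpd card_cartesian_product)

lemma Ob_prod_gpd: "Ob (prod_gpd A B) = Ob A \<times> Ob B"
  by (simp add: prod_gpd_def)

lemma locally_finite_prod_gpd:
  "locally_finite A \<Longrightarrow> locally_finite B \<Longrightarrow> locally_finite (prod_gpd A B)"
  by (auto simp: locally_finite_def arrows_from_prod_gpd Ob_prod_gpd)

lemma Aut_prod_gpd: "Aut (prod_gpd A B) (x, y) = Aut A x \<times> Aut B y"
  by (auto simp: Aut_def prod_gpd_def)

lemma iso_rel_prod_gpd:
  "((x, y), (x', y')) \<in> iso_rel (prod_gpd A B) \<longleftrightarrow> (x, x') \<in> iso_rel A \<and> (y, y') \<in> iso_rel B"
  by (auto simp: iso_rel_def prod_gpd_def intro!: bexI[of _ "(_, _)"])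

lemma gfunctor_gpair:
  assumes "gfunctor A B F" "gfunctor A C G"
  shows "gfunctor A (prod_gpd B C) (gpair F G)"
proof -
  interpret F: gfunctor A B F by fact
  interpret G: gfunctor A C G by fact
  interpret P: groupoid "prod_gpd B C" by (rule groupoid_prod_gpd) unfold_locales
  show ?thesis
    by unfold_locales
       (auto simp: gpair_def prod_gpd_def F.fa_ar F.dom_fa F.cod_fa F.fa_cmp G.fa_ar G.dom_fa G.cod_fa G.fa_cmp)
qed

lemma groupoid_pullback_gpd:
  assumes "gfunctor A C F" "gfunctor B C G"
  shows "groupoid (pullback_gpd A B F G)"
proof -
  interpret F: gfunctor A C F by fact
  interpret G: gfunctor B C G by fact
  show ?thesis
  proof
    fix f assume "f \<in> Ar (pullback_gpd A B F G)"
    then obtain a b where ab: "f = (a, b)" "a \<in> Ar A" "b \<in> Ar B" and eq: "Fa F a = Fa G b"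
      by (auto simp: pullback_gpd_def)
    obtain a' b' where i: "a' \<in> Ar A" "Dom A a' = Cod A a" "Cod A a' = Dom A a" "Cmp A a' a = Idn A (Dom A a)"
       "b' \<in> Ar B" "Dom B b' = Cod B b" "Cod B b' = Dom B b" "Cmp B b b' = Idn B (Cod B b)"
       "Cmp B b' b = Idn B (Dom B b)"
      using F.A.left_inverse[OF ab(2)] G.A.inverse_exists[OF ab(3)] by metis
    let ?c = "Fa F a" and ?u = "Fa F a'" and ?v = "Fa G b'"
    have d: "Fo F (Dom A a) = Fo G (Dom B b)" "Fo F (Cod A a) = Fo G (Cod B b)"
      using eq ab F.dom_fa G.dom_fa F.cod_fa G.cod_fa by metis+
    \<comment> \<open>The inverses taken in A and B must have the same image in C. Their images are
      a left inverse \<open>?u\<close> and a right inverse \<open>?v\<close> of the common image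
      \<open>?c\<close>, hence equal.\<close>
    have uc: "Cmp C ?u ?c = Idn C (Fo F (Dom A a))"
      using F.fa_cmp[OF ab(2) i(1)] i F.fa_idn ab F.A.dom_ob by simp
    have cv: "Cmp C ?c ?v = Idn C (Fo F (Cod A a))"
      using G.fa_cmp[OF i(5) ab(3)] i G.fa_idn[OF G.A.cod_ob[OF ab(3)]] d ab by (simp add: eq)
    have "?u = Cmp C ?u (Cmp C ?c ?v)"
      using F.B.cmp_idn_right[OF F.fa_ar[OF i(1)]] by (simp add: cv F.dom_fa i)
    also have "\<dots> = Cmp C (Cmp C ?u ?c) ?v"
      by (rule F.B.cmp_assoc) (use ab i d eq in \<open>auto simp: F.fa_ar G.fa_ar F.dom_fa F.cod_fa G.dom_fa G.cod_fa\<close>)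
    also have "\<dots> = ?v"
      using F.B.cmp_idn_left[OF G.fa_ar[OF i(5)]] by (simp add: uc G.cod_fa i d)
    finally show "\<exists>g\<in>Ar (pullback_gpd A B F G). Dom (pullback_gpd A B F G) g = Cod (pullback_gpd A B F G) f \<and>
       Cod (pullback_gpd A B F G) g = Dom (pullback_gpd A B F G) f \<and>
       Cmp (pullback_gpd A B F G) g f = Idn (pullback_gpd A B F G) (Dom (pullback_gpd A B F G) f)"
      by (intro bexI[of _ "(a', b')"]) (use i in \<open>auto simp: pullback_gpd_def prod_gpd_def ab\<close>)
  qed (auto simp: prod_gpd_def pullback_gpd_def F.A.dom_ob F.A.cod_ob F.A.idn_ar F.A.dom_idn F.A.cod_idn F.A.cmp_ar F.A.dom_cmp F.A.cod_cmp
         F.A.cmp_assoc F.A.cmp_idn_left F.A.cmp_idn_right G.A.dom_ob G.A.cod_ob G.A.idn_ar G.A.dom_idn G.A.cod_idn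
         G.A.cmp_ar G.A.dom_cmp G.A.cod_cmp G.A.cmp_assoc G.A.cmp_idn_left G.A.cmp_idn_right F.fa_cmp G.fa_cmp F.fa_idn G.fa_idn
         F.dom_fa[symmetric] G.dom_fa[symmetric] F.cod_fa[symmetric] G.cod_fa[symmetric])
qed

lemma gfunctor_pullback_pr1:
  assumes "gfunctor A C F" "gfunctor B C G"
  shows "gfunctor (pullback_gpd A B F G) A pr1"
proof -
  interpret F: gfunctor A C F by fact
  interpret P: groupoid "pullback_gpd A B F G" by (rule groupoid_pullback_gpd) fact+
  show ?thesis by unfold_locales (auto simp: pullback_gpd_def prod_gpd_def pr1_def)
qed

lemma gfunctor_pullback_pr2:
  assumes "gfunctor A C F" "gfunctor B C G"
  shows "gfunctor (pullback_gpd A B F G) B pr2"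
proof -
  interpret F: gfunctor B C G by fact
  interpret P: groupoid "pullback_gpd A B F G" by (rule groupoid_pullback_gpd) fact+
  show ?thesis by unfold_locales (auto simp: pullback_gpd_def prod_gpd_def pr2_def)
qed

section \<open>Homotopy fibres and their cardinality\<close>

context gfunctor
begin

text \<open>Precomposition with F f is bijective on hom sets. Consequently the structure arrow at
  the target of an arrow of the homotopy fibre is forced by the one at its source.\<close>

lemma inverse_square:
  assumes f: "f \<in> Ar A" and \<phi>: "\<phi> \<in> Ar B" "Dom B \<phi> = Fo F (Dom A f)" "Cod B \<phi> = y"
  shows "\<exists>!\<phi>'. \<phi>' \<in> Ar B \<and> Dom B \<phi>' = Fo F (Cod A f) \<and> Cod B \<phi>' = y \<and> Cmp B \<phi>' (Fa F f) = \<phi>"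
proof -
  have "Fa F f \<in> hom_set B (Fo F (Dom A f)) (Fo F (Cod A f))"
    using f by (simp add: hom_set_def fa_ar dom_fa cod_fa)
  from B.bij_betw_precompose[OF this, of y]
  have inj: "inj_on (\<lambda>q. Cmp B q (Fa F f)) (hom_set B (Fo F (Cod A f)) y)"
    and im: "(\<lambda>q. Cmp B q (Fa F f)) ` hom_set B (Fo F (Cod A f)) y = hom_set B (Fo F (Dom A f)) y"
    by (auto simp: bij_betw_def)
  have "\<phi> \<in> hom_set B (Fo F (Dom A f)) y" using \<phi> by (simp add: hom_set_def)
  then obtain q where "q \<in> hom_set B (Fo F (Cod A f)) y" "\<phi> = Cmp B q (Fa F f)"
    using im by blast
  with inj have "\<exists>!\<phi>'. \<phi>' \<in> hom_set B (Fo F (Cod A f)) y \<and> Cmp B \<phi>' (Fa F f) = \<phi>"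
    by (intro ex1I[of _ q]) (auto dest: inj_onD)
  then show ?thesis by (simp add: hom_set_def conj_assoc)
qed

lemma groupoid_hofib: "groupoid (hofib A B F y)"
proof
  fix t assume t: "t \<in> Ar (hofib A B F y)"
  then obtain \<phi> f \<phi>' where tt: "t = (\<phi>, f, \<phi>')" by (cases t)
  with t have f: "f \<in> Ar A" and p: "\<phi> \<in> Ar B" "Dom B \<phi> = Fo F (Dom A f)" "Cod B \<phi> = y"
    "\<phi>' \<in> Ar B" "Dom B \<phi>' = Fo F (Cod A f)" "Cod B \<phi>' = y" "Cmp B \<phi>' (Fa F f) = \<phi>"
    by (auto simp: hofib_def)
  obtain g where g: "g \<in> Ar A" "Dom A g = Cod A f" "Cod A g = Dom A f"
    "Cmp A g f = Idn A (Dom A f)" "Cmp A f g = Idn A (Cod A f)"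
    using A.inverse_exists[OF f] by metis
  \<comment> \<open>The inverse of (\<phi>, f, \<phi>') is (\<phi>', g, \<phi>); this is the
    commuting triangle that it requires.\<close>
  have "Cmp B \<phi> (Fa F g) = Cmp B \<phi>' (Cmp B (Fa F f) (Fa F g))"
    using p f g by (subst B.cmp_assoc) (auto simp: fa_ar dom_fa cod_fa)
  also have "\<dots> = \<phi>'"
    using fa_cmp[OF g(1) f] g p B.cmp_idn_right[OF p(4)] fa_idn[OF A.cod_ob[OF f]] by simp
  finally have "(\<phi>', g, \<phi>) \<in> Ar (hofib A B F y)"
    using p f g by (auto simp: hofib_def)
  then show "\<exists>g\<in>Ar (hofib A B F y). Dom (hofib A B F y) g = Cod (hofib A B F y) t \<and>
       Cod (hofib A B F y) g = Dom (hofib A B F y) t \<and>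
       Cmp (hofib A B F y) g t = Idn (hofib A B F y) (Dom (hofib A B F y) t)"
    by (rule bexI[rotated]) (auto simp: hofib_def tt g)
next
  fix s t assume "s \<in> Ar (hofib A B F y)" "t \<in> Ar (hofib A B F y)"
    "Dom (hofib A B F y) t = Cod (hofib A B F y) s"
  then show "Cmp (hofib A B F y) t s \<in> Ar (hofib A B F y)"
    by (auto simp: hofib_def A.cmp_ar A.dom_cmp A.cod_cmp fa_cmp B.cmp_assoc fa_ar dom_fa cod_fa)
next
  fix x assume "x \<in> Ob (hofib A B F y)"
  then show "Idn (hofib A B F y) x \<in> Ar (hofib A B F y)"
    by (auto simp: hofib_def A.idn_ar A.dom_idn A.cod_idn fa_idn) (metis B.cmp_idn_right)
qed (auto simp: hofib_def A.dom_ob A.cod_ob A.dom_idn A.cod_idn A.dom_cmp A.cod_cmp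
      A.cmp_assoc A.cmp_idn_left A.cmp_idn_right)

lemma gfunctor_hofib_proj: "gfunctor (hofib A B F y) A hofib_proj"
proof -
  interpret H: groupoid "hofib A B F y" by (rule groupoid_hofib)
  show ?thesis by unfold_locales (auto simp: hofib_def hofib_proj_def)
qed

text \<open>The projection is a discrete opfibration: by \<open>inverse_square\<close> each arrow
  out of x lifts uniquely once \<phi> is given. Hence passing to a homotopy fibre preserves
  \<open>outdeg\<close>.\<close>

lemma bij_betw_arrows_from_hofib:
  assumes "(x, \<phi>) \<in> Ob (hofib A B F y)"
  shows "bij_betw (\<lambda>(\<phi>, f, \<phi>'). f) (arrows_from (hofib A B F y) (x, \<phi>)) (arrows_from A x)"
proof (rule bij_betwI')
  fix s t assume st: "s \<in> arrows_from (hofib A B F y) (x, \<phi>)" "t \<in> arrows_from (hofib A B F y) (x, \<phi>)"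
  obtain f p q f' p' q' where e: "s = (p, f, q)" "t = (p', f', q')" by (cases s, cases t)
  show "((case s of (\<phi>, f, \<phi>') \<Rightarrow> f) = (case t of (\<phi>, f, \<phi>') \<Rightarrow> f)) = (s = t)"
    using inverse_square[of f \<phi> y] st by (auto simp: e arrows_from_def hofib_def)
next
  fix s assume "s \<in> arrows_from (hofib A B F y) (x, \<phi>)"
  then show "(case s of (\<phi>, f, \<phi>') \<Rightarrow> f) \<in> arrows_from A x"
    by (auto simp: arrows_from_def hofib_def)
next
  fix f assume "f \<in> arrows_from A x"
  then have f: "f \<in> Ar A" "Dom A f = x" by (auto simp: arrows_from_def)
  from inverse_square[OF f(1), of \<phi> y] obtain q where
    "q \<in> Ar B" "Dom B q = Fo F (Cod A f)" "Cod B q = y" "Cmp B q (Fa F f) = \<phi>"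
    using assms f by (auto simp: hofib_def)
  then show "\<exists>s\<in>arrows_from (hofib A B F y) (x, \<phi>). f = (case s of (\<phi>, f, \<phi>') \<Rightarrow> f)"
    using f assms by (intro bexI[of _ "(\<phi>, f, q)"]) (auto simp: arrows_from_def hofib_def)
qed

lemma outdeg_hofib: "(x, \<phi>) \<in> Ob (hofib A B F y) \<Longrightarrow> outdeg (hofib A B F y) (x, \<phi>) = outdeg A x"
  unfolding outdeg_def by (rule bij_betw_same_card[OF bij_betw_arrows_from_hofib])

lemma locally_finite_hofib: "locally_finite A \<Longrightarrow> locally_finite (hofib A B F y)"
  unfolding locally_finite_def
proof (intro ballI)
  fix h assume "\<forall>x\<in>Ob A. finite (arrows_from A x)" and h: "h \<in> Ob (hofib A B F y)"
  then have "finite (arrows_from A (fst h))" by (auto simp: hofib_def)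
  with h show "finite (arrows_from (hofib A B F y) h)"
    using bij_betw_finite[OF bij_betw_arrows_from_hofib[of "fst h" "snd h" y]] by simp
qed

lemma Ob_hofib: "Ob (hofib A B F y) = (SIGMA x:{x\<in>Ob A. (Fo F x, y) \<in> iso_rel B}. hom_set B (Fo F x) y)"
  unfolding B.iso_rel_iff by (auto simp: hofib_def hom_set_def)

lemma finite_hom_set:
  assumes "locally_finite B" shows "finite (hom_set B z y)"
proof (cases "z \<in> Ob B")
  case True
  then have "finite (arrows_from B z)" using assms by (simp add: locally_finite_def)
  then show ?thesis by (rule rev_finite_subset) (auto simp: hom_set_def arrows_from_def)
next
  case False
  then have "hom_set B z y = {}" using B.dom_ob by (auto simp: hom_set_def)
  then show ?thesis by simp
qed

lemma finite_Ob_hofib: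
  assumes lf: "locally_finite B" and fin: "finite {x\<in>Ob A. (Fo F x, y) \<in> iso_rel B}"
  shows "finite (Ob (hofib A B F y))"
  unfolding Ob_hofib using fin finite_hom_set[OF lf] by auto

text \<open>Each x whose image is isomorphic to y carries |Aut y| structure arrows. The predicate P
  allows for a second homotopy fibre taken over this one, whose condition depends only on x.\<close>

lemma sum_Ob_hofib:
  fixes w :: "'o \<Rightarrow> rat"
  assumes lf: "locally_finite B" and fin: "finite {x\<in>Ob A. (Fo F x, y) \<in> iso_rel B}"
  shows "(\<Sum>h | h \<in> Ob (hofib A B F y) \<and> P (fst h). w (fst h))
    = of_nat (card (Aut B y)) * (\<Sum>x | x \<in> Ob A \<and> (Fo F x, y) \<in> iso_rel B \<and> P x. w x)"
proof -
  let ?S = "{x. x \<in> Ob A \<and> (Fo F x, y) \<in> iso_rel B \<and> P x}"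
  have finS: "finite ?S" by (rule finite_subset[OF _ fin]) auto
  have "{h. h \<in> Ob (hofib A B F y) \<and> P (fst h)} = (SIGMA x:?S. hom_set B (Fo F x) y)"
    unfolding Ob_hofib by auto
  then have "(\<Sum>h | h \<in> Ob (hofib A B F y) \<and> P (fst h). w (fst h))
     = (\<Sum>(x, \<phi>)\<in>(SIGMA x:?S. hom_set B (Fo F x) y). w x)"
    by (simp add: case_prod_unfold)
  also have "\<dots> = (\<Sum>x\<in>?S. \<Sum>\<phi>\<in>hom_set B (Fo F x) y. w x)"
    by (rule sum.Sigma[symmetric]) (use finS finite_hom_set[OF lf] in auto)
  also have "\<dots> = (\<Sum>x\<in>?S. of_nat (card (Aut B y)) * w x)"
    by (rule sum.cong) (auto simp: B.card_hom_set(2))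
  finally show ?thesis by (simp add: sum_distrib_left)
qed

lemma hcard_hofib:
  assumes lfA: "locally_finite A" and lf: "locally_finite B"
    and fin: "finite {x\<in>Ob A. (Fo F x, y) \<in> iso_rel B}"
  shows "hcard (hofib A B F y)
    = of_nat (card (Aut B y)) * (\<Sum>x | x \<in> Ob A \<and> (Fo F x, y) \<in> iso_rel B. 1 / of_nat (outdeg A x))"
proof -
  interpret H: groupoid "hofib A B F y" by (rule groupoid_hofib)
  have "hcard (hofib A B F y) = (\<Sum>h\<in>Ob (hofib A B F y). 1 / of_nat (outdeg (hofib A B F y) h))"
    by (rule H.hcard_eq[OF finite_Ob_hofib[OF lf fin] locally_finite_hofib[OF lfA]])
  also have "\<dots> = (\<Sum>h | h \<in> Ob (hofib A B F y) \<and> True. 1 / of_nat (outdeg A (fst h)))"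
    by (rule sum.cong) (auto simp: outdeg_hofib)
  also have "\<dots> = of_nat (card (Aut B y)) * (\<Sum>x | x \<in> Ob A \<and> (Fo F x, y) \<in> iso_rel B. 1 / of_nat (outdeg A x))"
    using sum_Ob_hofib[OF lf fin, of "\<lambda>x. 1 / of_nat (outdeg A x)" "\<lambda>_. True"] by simp
  finally show ?thesis .
qed

end

text \<open>Two nested homotopy fibres are evaluated. The outer one, over (a, b), contributes |Aut
  a| |Aut b|, which cancels the denominator of \<open>incidence_coeff\<close>; the inner one, over
  f, contributes |Aut f|, which stays. The weights remain those of \<open>simp2 X\<close>, because
  \<open>outdeg\<close> does not see structure arrows.\<close>

lemma incidence_coeff_eq:
  fixes X :: "('o0, 'm0, 'o1, 'm1, 'o2, 'm2) simp_gpd2"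
  assumes d0: "gfunctor (simp2 X) (simp1 X) (dface20 X)"
    and d1: "gfunctor (simp2 X) (simp1 X) (dface21 X)"
    and d2: "gfunctor (simp2 X) (simp1 X) (dface22 X)"
    and lf: "locally_finite (simp1 X)" "locally_finite (simp2 X)"
    and fin: "finite {x\<in>Ob (simp2 X). (Fo (dface21 X) x, rep f) \<in> iso_rel (simp1 X)}"
    and ob: "rep a \<in> Ob (simp1 X)" "rep b \<in> Ob (simp1 X)"
  shows "incidence_coeff X f a b = of_nat (card (Aut (simp1 X) (rep f))) *
    (\<Sum>x | x \<in> Ob (simp2 X) \<and> (Fo (dface21 X) x, rep f) \<in> iso_rel (simp1 X)
        \<and> (Fo (dface22 X) x, rep a) \<in> iso_rel (simp1 X) \<and> (Fo (dface20 X) x, rep b) \<in> iso_rel (simp1 X).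
        1 / of_nat (outdeg (simp2 X) x))"
proof -
  interpret D1: gfunctor "simp2 X" "simp1 X" "dface21 X" by fact
  let ?H = "hofib (simp2 X) (simp1 X) (dface21 X) (rep f)" and ?Z = "prod_gpd (simp1 X) (simp1 X)"
  let ?K = "gcomp (gpair (dface22 X) (dface20 X)) (hofib_proj :: (_, _, 'o2, 'm2) gfun)"
  interpret K: gfunctor ?H ?Z ?K
    by (rule gfunctor_gcomp[OF D1.gfunctor_hofib_proj gfunctor_gpair[OF d2 d0]])
  have lfZ: "locally_finite ?Z" by (rule locally_finite_prod_gpd[OF lf(1) lf(1)])
  have lfH: "locally_finite ?H" by (rule D1.locally_finite_hofib[OF lf(2)])
  have finH: "finite (Ob ?H)" by (rule D1.finite_Ob_hofib[OF lf(1) fin])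
  let ?A = "\<lambda>x. rat_of_nat (card (Aut (simp1 X) x))"
  have ob': "Idn (simp1 X) x \<in> Aut (simp1 X) x" if "x \<in> Ob (simp1 X)" for x
    using that by (simp add: Aut_def D1.B.idn_ar D1.B.dom_idn D1.B.cod_idn)
  have finAut: "finite (Aut (simp1 X) x)" for x
    using D1.finite_hom_set[OF lf(1), of x x] by (simp add: Aut_def hom_set_def)
  have nz: "?A (rep a) \<noteq> 0" "?A (rep b) \<noteq> 0"
    using ob'[OF ob(1)] ob'[OF ob(2)] finAut by auto
  let ?P = "\<lambda>x. (Fo (dface22 X) x, rep a) \<in> iso_rel (simp1 X) \<and> (Fo (dface20 X) x, rep b) \<in> iso_rel (simp1 X)"
  have "hcard (incidence_fibre X (rep f) (rep a) (rep b))
     = ?A (rep a) * ?A (rep b) * (\<Sum>h | h \<in> Ob ?H \<and> (Fo ?K h, (rep a, rep b)) \<in> iso_rel ?Z. 1 / of_nat (outdeg ?H h))"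
    unfolding incidence_fibre_def
    by (subst K.hcard_hofib[OF lfH lfZ]) (use finH in \<open>auto simp: Aut_prod_gpd card_cartesian_product\<close>)
  also have "(\<Sum>h | h \<in> Ob ?H \<and> (Fo ?K h, (rep a, rep b)) \<in> iso_rel ?Z. 1 / rat_of_nat (outdeg ?H h))
     = (\<Sum>h | h \<in> Ob ?H \<and> ?P (fst h). 1 / of_nat (outdeg (simp2 X) (fst h)))"
    by (rule sum.cong)
       (auto simp: D1.outdeg_hofib gcomp_def gpair_def hofib_proj_def iso_rel_prod_gpd)
  also have "\<dots> = ?A (rep f) * (\<Sum>x | x \<in> Ob (simp2 X) \<and> (Fo (dface21 X) x, rep f) \<in> iso_rel (simp1 X)
        \<and> ?P x. 1 / of_nat (outdeg (simp2 X) x))"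
    by (rule D1.sum_Ob_hofib[OF lf(1) fin, of "\<lambda>x. 1 / of_nat (outdeg (simp2 X) x)" ?P])
  finally show ?thesis using nz by (simp add: incidence_coeff_def)
qed

section \<open>The monad S\<close>

text \<open>Equations between arrows of S A are checked position by position, so membership is
  restated with the labels as a bijection of positions.\<close>

lemma Ar_S_gpd_iff:
  "\<phi> \<in> Ar (S_gpd A) \<longleftrightarrow> \<phi> \<noteq> [] \<and> (\<forall>i<length \<phi>. snd (\<phi> ! i) \<in> Ar A)
     \<and> bij_betw (\<lambda>i. fst (\<phi> ! i)) {..<length \<phi>} {..<length \<phi>}"
proof -
  have "distinct (map fst \<phi>) \<longleftrightarrow> inj_on (\<lambda>i. fst (\<phi> ! i)) {..<length \<phi>}"
    by (auto simp: distinct_conv_nth inj_on_def)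
  moreover have "fst ` set \<phi> = (\<lambda>i. fst (\<phi> ! i)) ` {..<length \<phi>}"
    by (auto simp: set_conv_nth)
  moreover have "snd ` set \<phi> \<subseteq> Ar A \<longleftrightarrow> (\<forall>i<length \<phi>. snd (\<phi> ! i) \<in> Ar A)"
    by (auto simp: set_conv_nth)
  ultimately show ?thesis by (simp add: S_gpd_def bij_betw_def)
qed

lemma Ar_S_gpdD:
  assumes "\<phi> \<in> Ar (S_gpd A)"
  shows "\<phi> \<noteq> []" "i < length \<phi> \<Longrightarrow> snd (\<phi> ! i) \<in> Ar A" "i < length \<phi> \<Longrightarrow> fst (\<phi> ! i) < length \<phi>"
    "bij_betw (\<lambda>i. fst (\<phi> ! i)) {..<length \<phi>} {..<length \<phi>}"
  using assms by (auto simp: Ar_S_gpd_iff dest: bij_betwE)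

lemma Ar_S_gpd_obtain:
  assumes "\<phi> \<in> Ar (S_gpd A)" "k < length \<phi>"
  obtains i where "i < length \<phi>" "fst (\<phi> ! i) = k"
proof -
  have "k \<in> (\<lambda>i. fst (\<phi> ! i)) ` {..<length \<phi>}"
    using Ar_S_gpdD(4)[OF assms(1)] assms(2) by (simp add: bij_betw_def)
  then show ?thesis using that by auto
qed

lemma Ob_S_gpd: "Ob (S_gpd A) = {xs. xs \<noteq> [] \<and> set xs \<subseteq> Ob A}"
  by (simp add: S_gpd_def)

lemma length_Dom_S_gpd [simp]: "length (Dom (S_gpd A) \<phi>) = length \<phi>"
  and length_Cod_S_gpd [simp]: "length (Cod (S_gpd A) \<phi>) = length \<phi>"
  and length_Cmp_S_gpd [simp]: "length (Cmp (S_gpd A) \<psi> \<phi>) = length \<psi>"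
  and length_Idn_S_gpd [simp]: "length (Idn (S_gpd A) xs) = length xs"
  by (simp_all add: S_gpd_def)

lemma nth_Dom_S_gpd:
  assumes "\<phi> \<in> Ar (S_gpd A)" "i < length \<phi>"
  shows "Dom (S_gpd A) \<phi> ! fst (\<phi> ! i) = Dom A (snd (\<phi> ! i))"
proof -
  have "distinct (map fst \<phi>)" using assms by (simp add: S_gpd_def)
  moreover have "(fst (\<phi> ! i), snd (\<phi> ! i)) \<in> set \<phi>" using assms by simp
  ultimately have "map_of \<phi> (fst (\<phi> ! i)) = Some (snd (\<phi> ! i))" by simp
  then show ?thesis using Ar_S_gpdD(3)[OF assms] by (simp add: S_gpd_def)
qed

lemma nth_Cod_S_gpd: "i < length \<phi> \<Longrightarrow> Cod (S_gpd A) \<phi> ! i = Cod A (snd (\<phi> ! i))"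
  by (simp add: S_gpd_def case_prod_unfold)

lemma nth_Idn_S_gpd: "i < length xs \<Longrightarrow> Idn (S_gpd A) xs ! i = (i, Idn A (xs ! i))"
  by (simp add: S_gpd_def nth_enumerate_eq)

lemma nth_Cmp_S_gpd: "i < length \<psi> \<Longrightarrow>
    Cmp (S_gpd A) \<psi> \<phi> ! i = (fst (\<phi> ! fst (\<psi> ! i)), Cmp A (snd (\<psi> ! i)) (snd (\<phi> ! fst (\<psi> ! i))))"
  by (simp add: S_gpd_def case_prod_unfold)

text \<open>Every source position is the label of exactly one component, so the domain can be tested
  through the labels, bypassing the lookup by \<open>map_of\<close>.\<close>

lemma Dom_S_gpd_eq_iff:
  assumes "\<phi> \<in> Ar (S_gpd A)"
  shows "Dom (S_gpd A) \<phi> = xs \<longleftrightarrow>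
    length xs = length \<phi> \<and> (\<forall>i<length \<phi>. xs ! fst (\<phi> ! i) = Dom A (snd (\<phi> ! i)))"
proof
  assume "length xs = length \<phi> \<and> (\<forall>i<length \<phi>. xs ! fst (\<phi> ! i) = Dom A (snd (\<phi> ! i)))"
  then show "Dom (S_gpd A) \<phi> = xs"
    by (intro nth_equalityI, simp, metis Ar_S_gpd_obtain[OF assms] length_Dom_S_gpd nth_Dom_S_gpd[OF assms])
qed (auto simp: nth_Dom_S_gpd[OF assms])

lemma composable_S_gpd:
  assumes "\<psi> \<in> Ar (S_gpd A)" "Dom (S_gpd A) \<psi> = Cod (S_gpd A) \<phi>"
  shows "length \<psi> = length \<phi>"
    "i < length \<phi> \<Longrightarrow> Dom A (snd (\<psi> ! i)) = Cod A (snd (\<phi> ! fst (\<psi> ! i)))"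
proof -
  show l: "length \<psi> = length \<phi>" using arg_cong[OF assms(2), of length] by simp
  show "i < length \<phi> \<Longrightarrow> Dom A (snd (\<psi> ! i)) = Cod A (snd (\<phi> ! fst (\<psi> ! i)))"
    using assms l Ar_S_gpdD(3)[OF assms(1)] by (metis nth_Cod_S_gpd nth_Dom_S_gpd)
qed

lemma groupoid_S_gpd:
  assumes "groupoid A"
  shows "groupoid (S_gpd A)"
proof -
  interpret groupoid A by fact
  have cmp: "Cmp (S_gpd A) \<psi> \<phi> \<in> Ar (S_gpd A)"
    if a: "\<phi> \<in> Ar (S_gpd A)" "\<psi> \<in> Ar (S_gpd A)" "Dom (S_gpd A) \<psi> = Cod (S_gpd A) \<phi>" for \<phi> \<psi>
  proof -
    note l = composable_S_gpd[OF a(2,3)]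
    have "bij_betw ((\<lambda>i. fst (\<phi> ! i)) \<circ> (\<lambda>i. fst (\<psi> ! i))) {..<length \<psi>} {..<length \<phi>}"
      using Ar_S_gpdD(4)[OF a(1)] Ar_S_gpdD(4)[OF a(2)] l(1) by (intro bij_betw_trans) auto
    then have "bij_betw (\<lambda>i. fst (Cmp (S_gpd A) \<psi> \<phi> ! i)) {..<length \<psi>} {..<length \<psi>}"
      by (subst bij_betw_cong[where g = "(\<lambda>i. fst (\<phi> ! i)) \<circ> (\<lambda>i. fst (\<psi> ! i))"])
         (auto simp: nth_Cmp_S_gpd l(1))
    moreover have "Cmp (S_gpd A) \<psi> \<phi> \<noteq> []"
      using Ar_S_gpdD(1)[OF a(2)] by (metis length_0_conv length_Cmp_S_gpd)
    ultimately show ?thesis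
      using Ar_S_gpdD(3)[OF a(2)]
      by (auto simp: Ar_S_gpd_iff nth_Cmp_S_gpd l Ar_S_gpdD(2)[OF a(1)] Ar_S_gpdD(2)[OF a(2)] intro!: cmp_ar)
  qed
  show ?thesis
  proof
    fix \<phi> assume a: "\<phi> \<in> Ar (S_gpd A)"
    show "Dom (S_gpd A) \<phi> \<in> Ob (S_gpd A)"
    proof -
      have "Dom (S_gpd A) \<phi> ! k \<in> Ob A" if "k < length \<phi>" for k
        using Ar_S_gpd_obtain[OF a that] Ar_S_gpdD(2)[OF a] nth_Dom_S_gpd[OF a] dom_ob by metis
      then show ?thesis
        using Ar_S_gpdD(1)[OF a] by (auto simp: Ob_S_gpd set_conv_nth simp flip: length_greater_0_conv)
    qed
    show "Cod (S_gpd A) \<phi> \<in> Ob (S_gpd A)"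
      using Ar_S_gpdD(1)[OF a]
      by (auto simp: Ob_S_gpd set_conv_nth nth_Cod_S_gpd Ar_S_gpdD(2)[OF a] intro!: cod_ob simp flip: length_greater_0_conv)
    have D: "Dom (S_gpd A) \<phi> ! fst (\<phi> ! i) = Dom A (snd (\<phi> ! i))" if "i < length \<phi>" for i
      using nth_Dom_S_gpd[OF a that] .
    show "Cmp (S_gpd A) (Idn (S_gpd A) (Cod (S_gpd A) \<phi>)) \<phi> = \<phi>"
      by (rule nth_equalityI)
         (auto simp: nth_Cmp_S_gpd nth_Idn_S_gpd nth_Cod_S_gpd cmp_idn_left Ar_S_gpdD[OF a])
    show "Cmp (S_gpd A) \<phi> (Idn (S_gpd A) (Dom (S_gpd A) \<phi>)) = \<phi>"
      by (rule nth_equalityI)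
         (auto simp: nth_Cmp_S_gpd nth_Idn_S_gpd D cmp_idn_right Ar_S_gpdD[OF a])
    \<comment> \<open>The inverse arrow \<psi> has at position k the inverse of the component of
      \<phi> labelled k, and that component stands at position \<sigma> k.\<close>
    define \<sigma> where "\<sigma> = inv_into {..<length \<phi>} (\<lambda>i. fst (\<phi> ! i))"
    have \<sigma>: "\<sigma> k < length \<phi>" "fst (\<phi> ! \<sigma> k) = k" if "k < length \<phi>" for k
      using bij_betw_inv_into[OF Ar_S_gpdD(4)[OF a]] that
        bij_betw_inv_into_right[OF Ar_S_gpdD(4)[OF a]] by (auto simp: \<sigma>_def dest: bij_betwE)
    have \<sigma>': "\<sigma> (fst (\<phi> ! i)) = i" if "i < length \<phi>" for i
      using bij_betw_inv_into_left[OF Ar_S_gpdD(4)[OF a]] that by (auto simp: \<sigma>_def)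
    have b\<sigma>: "bij_betw \<sigma> {..<length \<phi>} {..<length \<phi>}"
      unfolding \<sigma>_def by (rule bij_betw_inv_into[OF Ar_S_gpdD(4)[OF a]])
    define J where "J f = (SOME g. g \<in> Ar A \<and> Dom A g = Cod A f \<and> Cod A g = Dom A f \<and> Cmp A g f = Idn A (Dom A f))" for f
    have J: "J f \<in> Ar A" "Dom A (J f) = Cod A f" "Cod A (J f) = Dom A f" "Cmp A (J f) f = Idn A (Dom A f)"
      if "f \<in> Ar A" for f
      using someI_ex[OF left_inverse[OF that, unfolded Bex_def]] unfolding J_def by auto
    define \<psi> where "\<psi> = map (\<lambda>k. (\<sigma> k, J (snd (\<phi> ! \<sigma> k)))) [0..<length \<phi>]"
    have n\<psi>: "length \<psi> = length \<phi>" "\<And>k. k < length \<phi> \<Longrightarrow> \<psi> ! k = (\<sigma> k, J (snd (\<phi> ! \<sigma> k)))"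
      by (auto simp: \<psi>_def)
    have "bij_betw (\<lambda>i. fst (\<psi> ! i)) {..<length \<psi>} {..<length \<psi>}"
      using b\<sigma> by (subst bij_betw_cong[where g = \<sigma>]) (auto simp: n\<psi>)
    then have \<psi>: "\<psi> \<in> Ar (S_gpd A)"
      using Ar_S_gpdD(1)[OF a] by (auto simp: Ar_S_gpd_iff n\<psi> J \<sigma> Ar_S_gpdD(2)[OF a] simp flip: length_greater_0_conv)
    have "Dom (S_gpd A) \<psi> = Cod (S_gpd A) \<phi>"
      by (auto simp: Dom_S_gpd_eq_iff[OF \<psi>] n\<psi> \<sigma> J nth_Cod_S_gpd Ar_S_gpdD(2)[OF a])
    moreover have "Cod (S_gpd A) \<psi> = Dom (S_gpd A) \<phi>"
      by (intro nth_equalityI) (auto simp: n\<psi> nth_Cod_S_gpd J \<sigma> D[symmetric] Ar_S_gpdD(2)[OF a])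
    moreover have "Cmp (S_gpd A) \<psi> \<phi> = Idn (S_gpd A) (Dom (S_gpd A) \<phi>)"
      by (intro nth_equalityI) (auto simp: n\<psi> nth_Cmp_S_gpd nth_Idn_S_gpd J \<sigma> D[symmetric] Ar_S_gpdD(2)[OF a])
    ultimately show "\<exists>\<psi>\<in>Ar (S_gpd A). Dom (S_gpd A) \<psi> = Cod (S_gpd A) \<phi> \<and>
      Cod (S_gpd A) \<psi> = Dom (S_gpd A) \<phi> \<and> Cmp (S_gpd A) \<psi> \<phi> = Idn (S_gpd A) (Dom (S_gpd A) \<phi>)"
      using \<psi> by blast
  next
    fix xs assume "xs \<in> Ob (S_gpd A)"
    then have xs: "xs \<noteq> []" "\<And>i. i < length xs \<Longrightarrow> xs ! i \<in> Ob A" by (auto simp: Ob_S_gpd)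
    have "bij_betw (\<lambda>i. fst (Idn (S_gpd A) xs ! i)) {..<length xs} {..<length xs}"
      by (subst bij_betw_cong[where g = id]) (auto simp: nth_Idn_S_gpd)
    then show *: "Idn (S_gpd A) xs \<in> Ar (S_gpd A)"
      using xs by (auto simp: Ar_S_gpd_iff nth_Idn_S_gpd idn_ar simp flip: length_greater_0_conv)
    show "Dom (S_gpd A) (Idn (S_gpd A) xs) = xs"
      by (auto simp: Dom_S_gpd_eq_iff[OF *] nth_Idn_S_gpd dom_idn xs)
    show "Cod (S_gpd A) (Idn (S_gpd A) xs) = xs"
      by (rule nth_equalityI) (auto simp: nth_Cod_S_gpd nth_Idn_S_gpd cod_idn xs)
  next
    fix \<phi> \<psi> assume a: "\<phi> \<in> Ar (S_gpd A)" "\<psi> \<in> Ar (S_gpd A)" "Dom (S_gpd A) \<psi> = Cod (S_gpd A) \<phi>"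
    note l = composable_S_gpd[OF a(2,3)]
    show *: "Cmp (S_gpd A) \<psi> \<phi> \<in> Ar (S_gpd A)" by (rule cmp[OF a])
    show "Dom (S_gpd A) (Cmp (S_gpd A) \<psi> \<phi>) = Dom (S_gpd A) \<phi>"
      by (auto simp: Dom_S_gpd_eq_iff[OF *] nth_Cmp_S_gpd dom_cmp nth_Dom_S_gpd[OF a(1)]
            Ar_S_gpdD(2,3)[OF a(1)] Ar_S_gpdD(2)[OF a(2)] Ar_S_gpdD(3)[OF a(2), simplified l] l)
    show "Cod (S_gpd A) (Cmp (S_gpd A) \<psi> \<phi>) = Cod (S_gpd A) \<psi>"
      by (intro nth_equalityI) (auto simp: nth_Cod_S_gpd nth_Cmp_S_gpd cod_cmp
            Ar_S_gpdD(2,3)[OF a(1)] Ar_S_gpdD(2)[OF a(2)] Ar_S_gpdD(3)[OF a(2), simplified l] l)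
    fix \<chi> assume c: "\<chi> \<in> Ar (S_gpd A)" "Dom (S_gpd A) \<chi> = Cod (S_gpd A) \<psi>"
    note m = composable_S_gpd[OF c]
    show "Cmp (S_gpd A) \<chi> (Cmp (S_gpd A) \<psi> \<phi>) = Cmp (S_gpd A) (Cmp (S_gpd A) \<chi> \<psi>) \<phi>"
      by (intro nth_equalityI) (auto simp: nth_Cmp_S_gpd cmp_assoc l m
            Ar_S_gpdD(2,3)[OF a(1)] Ar_S_gpdD(2)[OF a(2)] Ar_S_gpdD(3)[OF a(2), simplified l]
            Ar_S_gpdD(2)[OF c(1)] Ar_S_gpdD(3)[OF c(1), simplified m l])
  qed
qed

lemma gfunctor_S_fun:
  assumes "gfunctor A B F"
  shows "gfunctor (S_gpd A) (S_gpd B) (S_fun F)"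
proof -
  interpret gfunctor A B F by fact
  interpret SA: groupoid "S_gpd A" by (rule groupoid_S_gpd) unfold_locales
  interpret SB: groupoid "S_gpd B" by (rule groupoid_S_gpd) unfold_locales
  have n: "length (Fa (S_fun F) \<phi>) = length \<phi>"
    "i < length \<phi> \<Longrightarrow> Fa (S_fun F) \<phi> ! i = (fst (\<phi> ! i), Fa F (snd (\<phi> ! i)))" for \<phi> i
    by (auto simp: S_fun_def case_prod_unfold)
  have o: "length (Fo (S_fun F) xs) = length xs"
    "i < length xs \<Longrightarrow> Fo (S_fun F) xs ! i = Fo F (xs ! i)" for xs i
    by (auto simp: S_fun_def)
  show ?thesis
  proof
    fix \<phi> assume a: "\<phi> \<in> Ar (S_gpd A)"
    have "bij_betw (\<lambda>i. fst (Fa (S_fun F) \<phi> ! i)) {..<length \<phi>} {..<length \<phi>}"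
      using Ar_S_gpdD(4)[OF a] by (subst bij_betw_cong[where g = "\<lambda>i. fst (\<phi> ! i)"]) (auto simp: n)
    then show *: "Fa (S_fun F) \<phi> \<in> Ar (S_gpd B)"
      using Ar_S_gpdD(1)[OF a] by (auto simp: Ar_S_gpd_iff n fa_ar Ar_S_gpdD(2)[OF a] simp flip: length_greater_0_conv)
    show "Dom (S_gpd B) (Fa (S_fun F) \<phi>) = Fo (S_fun F) (Dom (S_gpd A) \<phi>)"
      by (auto simp: Dom_S_gpd_eq_iff[OF *] n o nth_Dom_S_gpd[OF a] dom_fa Ar_S_gpdD(2,3)[OF a])
    show "Cod (S_gpd B) (Fa (S_fun F) \<phi>) = Fo (S_fun F) (Cod (S_gpd A) \<phi>)"
      by (intro nth_equalityI) (auto simp: n o nth_Cod_S_gpd cod_fa Ar_S_gpdD(2)[OF a])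
    fix \<psi> assume b: "\<psi> \<in> Ar (S_gpd A)" "Dom (S_gpd A) \<psi> = Cod (S_gpd A) \<phi>"
    note l = composable_S_gpd[OF b]
    show "Fa (S_fun F) (Cmp (S_gpd A) \<psi> \<phi>) = Cmp (S_gpd B) (Fa (S_fun F) \<psi>) (Fa (S_fun F) \<phi>)"
      by (intro nth_equalityI) (auto simp: n nth_Cmp_S_gpd fa_cmp l Ar_S_gpdD(2)[OF a]
            Ar_S_gpdD(2)[OF b(1)] Ar_S_gpdD(3)[OF b(1), simplified l])
  qed
qed

section \<open>Positions in concatenated lists and the multiplication of S\<close>

definition concat_offset :: "'a list list \<Rightarrow> nat \<Rightarrow> nat" where
  "concat_offset xss i = length (concat (take i xss))"

lemma concat_offset_eq_sum:
  "i \<le> length xss \<Longrightarrow> concat_offset xss i = (\<Sum>k<i. length (xss ! k))"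
  by (induction i) (auto simp: concat_offset_def take_Suc_conv_app_nth)

lemma concat_offset_mono: "i \<le> j \<Longrightarrow> concat_offset xss i \<le> concat_offset xss j"
proof (induction j rule: dec_induct)
  case (step j)
  then show ?case
    by (cases "j < length xss") (auto simp: concat_offset_def take_Suc_conv_app_nth)
qed simp

lemma concat_offset_Suc: "i < length xss \<Longrightarrow> concat_offset xss (Suc i) = concat_offset xss i + length (xss ! i)"
  by (simp add: concat_offset_def take_Suc_conv_app_nth)

lemma concat_offset_less:
  assumes "i < length xss" "j < length (xss ! i)"
  shows "concat_offset xss i + j < length (concat xss)"
proof -
  have "concat_offset xss i + j < concat_offset xss (Suc i)" using assms by (simp add: concat_offset_Suc)
  also have "\<dots> \<le> concat_offset xss (length xss)" using assms by (intro concat_offset_mono) simp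
  finally show ?thesis by (simp add: concat_offset_def)
qed

lemma nth_concat_offset:
  assumes "i < length xss" "j < length (xss ! i)"
  shows "concat xss ! (concat_offset xss i + j) = xss ! i ! j"
proof -
  have "concat xss = concat (take i xss) @ xss ! i @ concat (drop (Suc i) xss)"
    using id_take_nth_drop[OF assms(1)] by (metis concat.simps(2) concat_append)
  then show ?thesis using assms by (simp add: concat_offset_def nth_append)
qed

lemma concat_offset_obtain:
  assumes "p < length (concat xss)"
  obtains i j where "i < length xss" "j < length (xss ! i)" "p = concat_offset xss i + j"
proof -
  have "\<exists>i j. i < length xss \<and> j < length (xss ! i) \<and> p = concat_offset xss i + j"
    using assms
  proof (induction xss rule: rev_induct)
    case (snoc xs xss)
    have o: "concat_offset (xss @ [xs]) i = concat_offset xss i" if "i \<le> length xss" for i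
      using that by (simp add: concat_offset_def)
    show ?case
    proof (cases "p < length (concat xss)")
      case True
      from snoc.IH[OF this] obtain i j where "i < length xss" "j < length (xss ! i)"
        "p = concat_offset xss i + j" by blast
      then show ?thesis
        by (intro exI[of _ i] exI[of _ j]) (auto simp: o nth_append)
    next
      case False
      then show ?thesis using snoc.prems
        by (intro exI[of _ "length xss"] exI[of _ "p - length (concat xss)"])
           (auto simp: o nth_append, simp_all add: concat_offset_def)
    qed
  qed simp
  then show ?thesis using that by blast
qed

text \<open>Together with \<open>concat_offset_obtain\<close> this makes the pairs (block, place in
  the block) coordinates on the positions of \<open>concat xss\<close>. Flattened arrows are
  compared in these coordinates.\<close>

lemma concat_offset_inj:
  assumes "i < length xss" "j < length (xss ! i)" "i' < length xss" "j' < length (xss ! i')"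
    and eq: "concat_offset xss i + j = concat_offset xss i' + j'"
  shows "i = i' \<and> j = j'"
proof -
  have *: "concat_offset xss a + b < concat_offset xss a' + b'"
    if "a < a'" "a < length xss" "b < length (xss ! a)" for a b a' b'
  proof -
    have "concat_offset xss a + b < concat_offset xss (Suc a)" using that by (simp add: concat_offset_Suc)
    also have "\<dots> \<le> concat_offset xss a'" using that by (intro concat_offset_mono) simp
    finally show ?thesis by simp
  qed
  have "i = i'" using *[of i i' j j'] *[of i' i j' j] assms by (metis less_irrefl nat_neq_iff)
  then show ?thesis using eq by simp
qed

lemma concat_offset_cong:
  assumes "map length xss = map length yss"
  shows "concat_offset xss i = concat_offset yss i"
  using assms unfolding concat_offset_def length_concat by (metis take_map)

context
  fixes A :: "('o, 'm) gpd" and \<Phi> :: "(nat \<times> (nat \<times> 'm) list) list"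
  assumes \<Phi>: "\<Phi> \<in> Ar (S_gpd (S_gpd A))"
begin

text \<open>\<open>block_offset\<close> adds up the lengths of the inner arrows labelled below k, in
  target order. Reindexing along the outer permutation turns this into the lengths of the first k
  source lists.\<close>

lemma block_offset_eq:
  assumes k: "k \<le> length \<Phi>"
  shows "block_offset \<Phi> k = concat_offset (Dom (S_gpd (S_gpd A)) \<Phi>) k"
proof -
  let ?D = "Dom (S_gpd (S_gpd A)) \<Phi>"
  let ?h = "\<lambda>k'. if k' < k then length (?D ! k') else 0"
  have "block_offset \<Phi> k = sum_list (map (\<lambda>p. if fst p < k then length (snd p) else 0) \<Phi>)"
    by (simp add: block_offset_def sum_list_map_filter' case_prod_unfold)
  also have "\<dots> = (\<Sum>i<length \<Phi>. if fst (\<Phi> ! i) < k then length (snd (\<Phi> ! i)) else 0)"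
    by (simp add: sum_list_sum_nth atLeast0LessThan)
  also have "\<dots> = (\<Sum>i<length \<Phi>. ?h (fst (\<Phi> ! i)))"
    by (rule sum.cong) (auto simp: nth_Dom_S_gpd[OF \<Phi>])
  also have "\<dots> = (\<Sum>k'<length \<Phi>. ?h k')"
    by (rule sum.reindex_bij_betw[OF Ar_S_gpdD(4)[OF \<Phi>]])
  also have "\<dots> = (\<Sum>k'<k. ?h k')"
    using k by (intro sum.mono_neutral_right) auto
  also have "\<dots> = concat_offset ?D k"
    using k by (subst concat_offset_eq_sum) auto
  finally show ?thesis .
qed

lemma length_flatten_arrow: "length (flatten_arrow \<Phi>) = length (concat (Cod (S_gpd (S_gpd A)) \<Phi>))"
  and nth_flatten_arrow: "i < length \<Phi> \<Longrightarrow> j < length (snd (\<Phi> ! i)) \<Longrightarrow>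
    flatten_arrow \<Phi> ! (concat_offset (Cod (S_gpd (S_gpd A)) \<Phi>) i + j) =
      (concat_offset (Dom (S_gpd (S_gpd A)) \<Phi>) (fst (\<Phi> ! i)) + fst (snd (\<Phi> ! i) ! j), snd (snd (\<Phi> ! i) ! j))"
proof -
  let ?B = "map (\<lambda>(k, \<phi>). map (\<lambda>(j, f). (block_offset \<Phi> k + j, f)) \<phi>) \<Phi>"
  have e: "flatten_arrow \<Phi> = concat ?B" by (simp add: flatten_arrow_def)
  have ml: "map length ?B = map length (Cod (S_gpd (S_gpd A)) \<Phi>)"
    by (rule nth_equalityI) (auto simp: nth_Cod_S_gpd case_prod_unfold)
  show "length (flatten_arrow \<Phi>) = length (concat (Cod (S_gpd (S_gpd A)) \<Phi>))"
    unfolding e length_concat ml ..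
  assume ij: "i < length \<Phi>" "j < length (snd (\<Phi> ! i))"
  have "concat ?B ! (concat_offset ?B i + j) = ?B ! i ! j"
    by (rule nth_concat_offset) (use ij in \<open>auto simp: case_prod_unfold\<close>)
  also have "\<dots> = (block_offset \<Phi> (fst (\<Phi> ! i)) + fst (snd (\<Phi> ! i) ! j), snd (snd (\<Phi> ! i) ! j))"
    using ij by (simp add: case_prod_unfold)
  finally show "flatten_arrow \<Phi> ! (concat_offset (Cod (S_gpd (S_gpd A)) \<Phi>) i + j) =
      (concat_offset (Dom (S_gpd (S_gpd A)) \<Phi>) (fst (\<Phi> ! i)) + fst (snd (\<Phi> ! i) ! j), snd (snd (\<Phi> ! i) ! j))"
    using Ar_S_gpdD(3)[OF \<Phi> ij(1)]
    by (simp add: e concat_offset_cong[OF ml] block_offset_eq less_imp_le)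
qed

lemma length_concat_Dom:
  "length (concat (Dom (S_gpd (S_gpd A)) \<Phi>)) = length (concat (Cod (S_gpd (S_gpd A)) \<Phi>))"
proof -
  let ?D = "Dom (S_gpd (S_gpd A)) \<Phi>" and ?C = "Cod (S_gpd (S_gpd A)) \<Phi>"
  have "length (concat ?D) = (\<Sum>k<length \<Phi>. length (?D ! k))"
    using concat_offset_eq_sum[of "length \<Phi>" ?D] by (simp add: concat_offset_def)
  also have "\<dots> = (\<Sum>i<length \<Phi>. length (?D ! fst (\<Phi> ! i)))"
    by (rule sum.reindex_bij_betw[symmetric, OF Ar_S_gpdD(4)[OF \<Phi>]])
  also have "\<dots> = (\<Sum>i<length \<Phi>. length (?C ! i))"
    by (rule sum.cong) (auto simp: nth_Dom_S_gpd[OF \<Phi>] nth_Cod_S_gpd)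
  also have "\<dots> = length (concat ?C)"
    using concat_offset_eq_sum[of "length \<Phi>" ?C] by (simp add: concat_offset_def)
  finally show ?thesis .
qed

lemma flatten_position_obtain:
  assumes "p < length (flatten_arrow \<Phi>)"
  obtains i j where "i < length \<Phi>" "j < length (snd (\<Phi> ! i))"
    "p = concat_offset (Cod (S_gpd (S_gpd A)) \<Phi>) i + j"
  using assms by (auto simp: length_flatten_arrow nth_Cod_S_gpd elim!: concat_offset_obtain)

lemma flatten_source:
  assumes "i < length \<Phi>" "j < length (snd (\<Phi> ! i))"
  shows "fst (\<Phi> ! i) < length \<Phi>"
    "fst (snd (\<Phi> ! i) ! j) < length (Dom (S_gpd (S_gpd A)) \<Phi> ! fst (\<Phi> ! i))"
  using Ar_S_gpdD(3)[OF \<Phi> assms(1)] Ar_S_gpdD(3)[OF Ar_S_gpdD(2)[OF \<Phi> assms(1)] assms(2)]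
  by (auto simp: nth_Dom_S_gpd[OF \<Phi> assms(1)])

text \<open>The labels of the flattened arrow are positions in the flattened source. Equal labels
  mean the same source block and the same place in it; the outer permutation then determines the
  target block and the inner one the place. Source and target have equally many positions, so
  injectivity gives the bijection.\<close>

lemma flatten_arrow_Ar: "flatten_arrow \<Phi> \<in> Ar (S_gpd A)"
proof -
  let ?C = "Cod (S_gpd (S_gpd A)) \<Phi>" and ?D = "Dom (S_gpd (S_gpd A)) \<Phi>"
  let ?N = "length (flatten_arrow \<Phi>)" and ?f = "\<lambda>p. fst (flatten_arrow \<Phi> ! p)"
  have "0 < length \<Phi>" "0 < length (snd (\<Phi> ! 0))"
    using Ar_S_gpdD(1)[OF \<Phi>] Ar_S_gpdD(1)[OF Ar_S_gpdD(2)[OF \<Phi>]] by auto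
  then have "concat_offset ?C 0 + 0 < ?N"
    unfolding length_flatten_arrow by (intro concat_offset_less) (auto simp: nth_Cod_S_gpd)
  then have ne: "flatten_arrow \<Phi> \<noteq> []" by auto
  have inj: "inj_on ?f {..<?N}"
  proof (rule inj_onI)
    fix p p' assume "p \<in> {..<?N}" "p' \<in> {..<?N}" and eq: "?f p = ?f p'"
    then obtain i j i' j' where ij: "i < length \<Phi>" "j < length (snd (\<Phi> ! i))" "p = concat_offset ?C i + j"
       and ij': "i' < length \<Phi>" "j' < length (snd (\<Phi> ! i'))" "p' = concat_offset ?C i' + j'"
      by (auto elim!: flatten_position_obtain)
    have "fst (\<Phi> ! i) = fst (\<Phi> ! i') \<and> fst (snd (\<Phi> ! i) ! j) = fst (snd (\<Phi> ! i') ! j')"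
      using flatten_source[OF ij(1,2)] flatten_source[OF ij'(1,2)] eq
      by (intro concat_offset_inj[where xss = ?D]) (auto simp: ij ij' nth_flatten_arrow)
    moreover from this have "i = i'"
      using Ar_S_gpdD(4)[OF \<Phi>] ij ij' by (auto simp: bij_betw_def inj_on_def)
    ultimately have "i = i' \<and> j = j'"
      using Ar_S_gpdD(4)[OF Ar_S_gpdD(2)[OF \<Phi> ij(1)]] ij ij' by (auto simp: bij_betw_def inj_on_def)
    then show "p = p'" using ij ij' by simp
  qed
  have "?f ` {..<?N} \<subseteq> {..<?N}"
  proof safe
    fix p assume "p < ?N"
    then obtain i j where ij: "i < length \<Phi>" "j < length (snd (\<Phi> ! i))" "p = concat_offset ?C i + j"
      by (auto elim!: flatten_position_obtain)
    have "concat_offset ?D (fst (\<Phi> ! i)) + fst (snd (\<Phi> ! i) ! j) < length (concat ?D)"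
      by (rule concat_offset_less) (use flatten_source[OF ij(1,2)] in auto)
    then show "fst (flatten_arrow \<Phi> ! p) < ?N"
      using ij by (simp add: nth_flatten_arrow length_flatten_arrow length_concat_Dom)
  qed
  then have "bij_betw ?f {..<?N} {..<?N}"
    using inj endo_inj_surj[of "{..<?N}" ?f] by (simp add: bij_betw_def)
  moreover have "snd (flatten_arrow \<Phi> ! p) \<in> Ar A" if "p < ?N" for p
  proof -
    from that obtain i j where ij: "i < length \<Phi>" "j < length (snd (\<Phi> ! i))" "p = concat_offset ?C i + j"
      by (auto elim!: flatten_position_obtain)
    then show ?thesis
      using Ar_S_gpdD(2)[OF Ar_S_gpdD(2)[OF \<Phi> ij(1)] ij(2)] by (simp add: nth_flatten_arrow)
  qed
  ultimately show ?thesis using ne by (simp add: Ar_S_gpd_iff)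
qed

lemma Dom_flatten_arrow: "Dom (S_gpd A) (flatten_arrow \<Phi>) = concat (Dom (S_gpd (S_gpd A)) \<Phi>)"
  unfolding Dom_S_gpd_eq_iff[OF flatten_arrow_Ar]
proof (intro conjI allI impI)
  show "length (concat (Dom (S_gpd (S_gpd A)) \<Phi>)) = length (flatten_arrow \<Phi>)"
    by (simp add: length_flatten_arrow length_concat_Dom)
  fix p assume "p < length (flatten_arrow \<Phi>)"
  then obtain i j where ij: "i < length \<Phi>" "j < length (snd (\<Phi> ! i))"
    "p = concat_offset (Cod (S_gpd (S_gpd A)) \<Phi>) i + j"
    by (auto elim!: flatten_position_obtain)
  note s = flatten_source[OF ij(1,2)]
  show "concat (Dom (S_gpd (S_gpd A)) \<Phi>) ! fst (flatten_arrow \<Phi> ! p) = Dom A (snd (flatten_arrow \<Phi> ! p))"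
    using ij s nth_concat_offset[of "fst (\<Phi> ! i)" "Dom (S_gpd (S_gpd A)) \<Phi>" "fst (snd (\<Phi> ! i) ! j)"]
    by (simp add: nth_flatten_arrow nth_Dom_S_gpd[OF \<Phi>] nth_Dom_S_gpd[OF Ar_S_gpdD(2)[OF \<Phi>]])
qed

lemma Cod_flatten_arrow: "Cod (S_gpd A) (flatten_arrow \<Phi>) = concat (Cod (S_gpd (S_gpd A)) \<Phi>)"
proof (rule nth_equalityI)
  fix p assume "p < length (Cod (S_gpd A) (flatten_arrow \<Phi>))"
  then have p: "p < length (flatten_arrow \<Phi>)" by simp
  then obtain i j where ij: "i < length \<Phi>" "j < length (snd (\<Phi> ! i))"
    "p = concat_offset (Cod (S_gpd (S_gpd A)) \<Phi>) i + j"
    by (auto elim!: flatten_position_obtain)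
  show "Cod (S_gpd A) (flatten_arrow \<Phi>) ! p = concat (Cod (S_gpd (S_gpd A)) \<Phi>) ! p"
    using p ij nth_concat_offset[of i "Cod (S_gpd (S_gpd A)) \<Phi>" j]
    by (simp add: nth_Cod_S_gpd nth_flatten_arrow)
qed (simp add: length_flatten_arrow)

end

lemma flatten_arrow_Cmp:
  assumes "groupoid A"
    and \<Phi>: "\<Phi> \<in> Ar (S_gpd (S_gpd A))" and \<Psi>: "\<Psi> \<in> Ar (S_gpd (S_gpd A))"
    and c: "Dom (S_gpd (S_gpd A)) \<Psi> = Cod (S_gpd (S_gpd A)) \<Phi>"
  shows "flatten_arrow (Cmp (S_gpd (S_gpd A)) \<Psi> \<Phi>) = Cmp (S_gpd A) (flatten_arrow \<Psi>) (flatten_arrow \<Phi>)"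
proof -
  interpret SS: groupoid "S_gpd (S_gpd A)" by (intro groupoid_S_gpd) fact
  let ?X = "Cmp (S_gpd (S_gpd A)) \<Psi> \<Phi>"
  have X: "?X \<in> Ar (S_gpd (S_gpd A))" by (rule SS.cmp_ar[OF \<Phi> \<Psi> c])
  have CX: "Cod (S_gpd (S_gpd A)) ?X = Cod (S_gpd (S_gpd A)) \<Psi>" by (rule SS.cod_cmp[OF \<Phi> \<Psi> c])
  have DX: "Dom (S_gpd (S_gpd A)) ?X = Dom (S_gpd (S_gpd A)) \<Phi>" by (rule SS.dom_cmp[OF \<Phi> \<Psi> c])
  note l = composable_S_gpd[OF \<Psi> c]
  show ?thesis
  proof (rule nth_equalityI)
    show "length (flatten_arrow ?X) = length (Cmp (S_gpd A) (flatten_arrow \<Psi>) (flatten_arrow \<Phi>))"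
      by (simp add: length_flatten_arrow[OF X] length_flatten_arrow[OF \<Psi>] CX)
    fix p assume "p < length (flatten_arrow ?X)"
    then have p: "p < length (flatten_arrow \<Psi>)" by (simp add: length_flatten_arrow[OF X] length_flatten_arrow[OF \<Psi>] CX)
    then obtain i j where ij: "i < length \<Psi>" "j < length (snd (\<Psi> ! i))"
        "p = concat_offset (Cod (S_gpd (S_gpd A)) \<Psi>) i + j"
      by (auto elim!: flatten_position_obtain[OF \<Psi>])
    \<comment> \<open>(k, j') is the place in the middle list from which the entry (i, j) comes;
      both sides follow the same path from (i, j) through (k, j') back to the source.\<close>
    define k j' where "k = fst (\<Psi> ! i)" and "j' = fst (snd (\<Psi> ! i) ! j)"
    have k: "k < length \<Phi>" "j' < length (snd (\<Phi> ! k))"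
      using flatten_source[OF \<Psi> ij(1,2)] l(1) by (auto simp: c k_def j'_def nth_Cod_S_gpd)
    have X1: "flatten_arrow ?X ! p
       = (concat_offset (Dom (S_gpd (S_gpd A)) \<Phi>) (fst (\<Phi> ! k)) + fst (snd (\<Phi> ! k) ! j'),
          Cmp A (snd (snd (\<Psi> ! i) ! j)) (snd (snd (\<Phi> ! k) ! j')))"
      using nth_flatten_arrow[OF X, of i j] ij
      by (simp add: CX DX nth_Cmp_S_gpd k_def j'_def)
    have P1: "flatten_arrow \<Psi> ! p = (concat_offset (Cod (S_gpd (S_gpd A)) \<Phi>) k + j', snd (snd (\<Psi> ! i) ! j))"
      using nth_flatten_arrow[OF \<Psi> ij(1,2)] ij by (simp add: c k_def j'_def)
    show "flatten_arrow ?X ! p = Cmp (S_gpd A) (flatten_arrow \<Psi>) (flatten_arrow \<Phi>) ! p"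
      using p by (simp add: nth_Cmp_S_gpd P1 X1 nth_flatten_arrow[OF \<Phi> k])
  qed
qed

lemma gfunctor_S_mult:
  assumes "groupoid A"
  shows "gfunctor (S_gpd (S_gpd A)) (S_gpd A) S_mult"
proof -
  interpret SA: groupoid "S_gpd A" by (intro groupoid_S_gpd) fact
  interpret SSA: groupoid "S_gpd (S_gpd A)" by (intro groupoid_S_gpd) fact
  show ?thesis
    by unfold_locales
       (simp_all add: S_mult_def flatten_arrow_Ar Dom_flatten_arrow Cod_flatten_arrow flatten_arrow_Cmp[OF assms])
qed

section \<open>Strengths and local finiteness\<close>

text \<open>The composition of \<open>T_S Sym\<close> is assembled from the next three maps:
  \<open>S_zip\<close> pairs two lists carrying the same permutation, \<open>S_strength_left\<close>
  uses one fixed second argument along a list, and \<open>S_const\<close> makes one copy of its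
  first argument per entry of the second, permuting the copies along.\<close>

definition S_zip :: "('o list \<times> 'p list, (nat \<times> 'm) list \<times> (nat \<times> 'n) list,
    ('o \<times> 'p) list, (nat \<times> 'm \<times> 'n) list) gfun" where
  "S_zip = \<lparr>Fo = (\<lambda>(xs, ys). zip xs ys), Fa = (\<lambda>(\<Gamma>, \<phi>). map2 (\<lambda>(k, \<gamma>) (_, f). (k, (\<gamma>, f))) \<Gamma> \<phi>)\<rparr>"

definition S_strength_left :: "('o \<times> 'p, 'm \<times> 'n, 'q, 'k) gfun \<Rightarrow>
    ('o list \<times> 'p, (nat \<times> 'm) list \<times> 'n, 'q list, (nat \<times> 'k) list) gfun" where
  "S_strength_left K = \<lparr>Fo = (\<lambda>(xs, y). map (\<lambda>x. Fo K (x, y)) xs),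
     Fa = (\<lambda>(\<phi>, g). map (\<lambda>(k, f). (k, Fa K (f, g))) \<phi>)\<rparr>"

definition S_const :: "('o \<times> 'p list, 'm \<times> (nat \<times> 'n) list, 'o list, (nat \<times> 'm) list) gfun" where
  "S_const = \<lparr>Fo = (\<lambda>(x, ys). map (\<lambda>_. x) ys), Fa = (\<lambda>(f, \<psi>). map (\<lambda>(k, _). (k, f)) \<psi>)\<rparr>"

lemma gfunctor_S_strength_left:
  assumes A: "groupoid A" and B: "groupoid B" and K: "gfunctor (prod_gpd A B) C K"
  shows "gfunctor (prod_gpd (S_gpd A) B) (S_gpd C) (S_strength_left K)"
proof -
  interpret A: groupoid A by fact
  interpret B: groupoid B by fact
  interpret K: gfunctor "prod_gpd A B" C K by fact
  interpret P: groupoid "prod_gpd (S_gpd A) B" by (intro groupoid_prod_gpd groupoid_S_gpd A B)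
  interpret SC: groupoid "S_gpd C" by (intro groupoid_S_gpd) unfold_locales
  let ?F = "S_strength_left K"
  have n: "length (Fa ?F (\<phi>, g)) = length \<phi>"
    "i < length \<phi> \<Longrightarrow> Fa ?F (\<phi>, g) ! i = (fst (\<phi> ! i), Fa K (snd (\<phi> ! i), g))" for \<phi> g i
    by (auto simp: S_strength_left_def case_prod_unfold)
  have o: "length (Fo ?F (xs, y)) = length xs"
    "i < length xs \<Longrightarrow> Fo ?F (xs, y) ! i = Fo K (xs ! i, y)" for xs y i
    by (auto simp: S_strength_left_def)
  have K_simps: "Fa K (f, g) \<in> Ar C" "Dom C (Fa K (f, g)) = Fo K (Dom A f, Dom B g)"
    "Cod C (Fa K (f, g)) = Fo K (Cod A f, Cod B g)" if "f \<in> Ar A" "g \<in> Ar B" for f g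
    using K.fa_ar[of "(f, g)"] K.dom_fa[of "(f, g)"] K.cod_fa[of "(f, g)"] that
    by (auto simp: prod_gpd_def)
  have K_cmp: "Fa K (Cmp A f' f, Cmp B g' g) = Cmp C (Fa K (f', g')) (Fa K (f, g))"
    if "f \<in> Ar A" "g \<in> Ar B" "f' \<in> Ar A" "g' \<in> Ar B" "Dom A f' = Cod A f" "Dom B g' = Cod B g" for f g f' g'
    using K.fa_cmp[of "(f, g)" "(f', g')"] that by (auto simp: prod_gpd_def)
  have P_simps: "Dom (prod_gpd (S_gpd A) B) (\<phi>, g) = (Dom (S_gpd A) \<phi>, Dom B g)"
     "Cod (prod_gpd (S_gpd A) B) (\<phi>, g) = (Cod (S_gpd A) \<phi>, Cod B g)"
     "Cmp (prod_gpd (S_gpd A) B) (\<phi>', g') (\<phi>, g) = (Cmp (S_gpd A) \<phi>' \<phi>, Cmp B g' g)" for \<phi> g \<phi>' g'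
    by (simp_all add: prod_gpd_def)
  show ?thesis
  proof
    fix t assume "t \<in> Ar (prod_gpd (S_gpd A) B)"
    then obtain \<phi> g where t: "t = (\<phi>, g)" and a: "\<phi> \<in> Ar (S_gpd A)" and g: "g \<in> Ar B"
      by (auto simp: prod_gpd_def)
    note as = Ar_S_gpdD(2,3)[OF a]
    have "bij_betw (\<lambda>i. fst (Fa ?F t ! i)) {..<length \<phi>} {..<length \<phi>}"
      using Ar_S_gpdD(4)[OF a] by (subst bij_betw_cong[where g = "\<lambda>i. fst (\<phi> ! i)"]) (auto simp: n t)
    then show *: "Fa ?F t \<in> Ar (S_gpd C)"
      using Ar_S_gpdD(1)[OF a] by (auto simp: t Ar_S_gpd_iff n K_simps as g simp flip: length_greater_0_conv)
    show "Dom (S_gpd C) (Fa ?F t) = Fo ?F (Dom (prod_gpd (S_gpd A) B) t)"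
      using * by (auto simp: t Dom_S_gpd_eq_iff n o nth_Dom_S_gpd[OF a] K_simps P_simps as g)
    show "Cod (S_gpd C) (Fa ?F t) = Fo ?F (Cod (prod_gpd (S_gpd A) B) t)"
      by (rule nth_equalityI) (auto simp: t n o nth_Cod_S_gpd K_simps P_simps as g)
    fix s assume "s \<in> Ar (prod_gpd (S_gpd A) B)" and ds: "Dom (prod_gpd (S_gpd A) B) s = Cod (prod_gpd (S_gpd A) B) t"
    then obtain \<psi> h where s: "s = (\<psi>, h)" and b: "\<psi> \<in> Ar (S_gpd A)" and h: "h \<in> Ar B"
      by (auto simp: prod_gpd_def)
    have b': "Dom (S_gpd A) \<psi> = Cod (S_gpd A) \<phi>" and h': "Dom B h = Cod B g"
      using ds by (auto simp: s t P_simps)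
    note l = composable_S_gpd[OF b b']
    show "Fa ?F (Cmp (prod_gpd (S_gpd A) B) s t) = Cmp (S_gpd C) (Fa ?F s) (Fa ?F t)"
      by (rule nth_equalityI) (auto simp: s t n P_simps nth_Cmp_S_gpd l as g h h' K_cmp
          Ar_S_gpdD(2)[OF b] Ar_S_gpdD(3)[OF b, simplified l])
  qed
qed

lemma gfunctor_S_const:
  assumes A: "groupoid A" and B: "groupoid B"
  shows "gfunctor (prod_gpd A (S_gpd B)) (S_gpd A) S_const"
proof -
  interpret A: groupoid A by fact
  interpret B: groupoid B by fact
  interpret P: groupoid "prod_gpd A (S_gpd B)" by (intro groupoid_prod_gpd groupoid_S_gpd A B)
  interpret SA: groupoid "S_gpd A" by (intro groupoid_S_gpd A)
  let ?F = "S_const :: ('a \<times> 'c list, 'b \<times> (nat \<times> 'd) list, 'a list, (nat \<times> 'b) list) gfun"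
  have n: "length (Fa ?F (g, \<phi>)) = length \<phi>"
    "i < length \<phi> \<Longrightarrow> Fa ?F (g, \<phi>) ! i = (fst (\<phi> ! i), g)" for \<phi> g i
    by (auto simp: S_const_def case_prod_unfold)
  have o: "length (Fo ?F (y, xs)) = length xs"
    "i < length xs \<Longrightarrow> Fo ?F (y, xs) ! i = y" for xs y i
    by (auto simp: S_const_def)
  have P_simps: "Dom (prod_gpd A (S_gpd B)) (g, \<phi>) = (Dom A g, Dom (S_gpd B) \<phi>)"
     "Cod (prod_gpd A (S_gpd B)) (g, \<phi>) = (Cod A g, Cod (S_gpd B) \<phi>)"
     "Cmp (prod_gpd A (S_gpd B)) (g', \<phi>') (g, \<phi>) = (Cmp A g' g, Cmp (S_gpd B) \<phi>' \<phi>)" for \<phi> g \<phi>' g'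
    by (simp_all add: prod_gpd_def)
  show ?thesis
  proof
    fix t assume "t \<in> Ar (prod_gpd A (S_gpd B))"
    then obtain \<phi> g where t: "t = (g, \<phi>)" and a: "\<phi> \<in> Ar (S_gpd B)" and g: "g \<in> Ar A"
      by (auto simp: prod_gpd_def)
    note as = Ar_S_gpdD(2,3)[OF a]
    have "bij_betw (\<lambda>i. fst (Fa ?F t ! i)) {..<length \<phi>} {..<length \<phi>}"
      using Ar_S_gpdD(4)[OF a] by (subst bij_betw_cong[where g = "\<lambda>i. fst (\<phi> ! i)"]) (auto simp: n t)
    then show *: "Fa ?F t \<in> Ar (S_gpd A)"
      using Ar_S_gpdD(1)[OF a] by (auto simp: t Ar_S_gpd_iff n as g simp flip: length_greater_0_conv)
    show "Dom (S_gpd A) (Fa ?F t) = Fo ?F (Dom (prod_gpd A (S_gpd B)) t)"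
      using * by (auto simp: t Dom_S_gpd_eq_iff n o P_simps as)
    show "Cod (S_gpd A) (Fa ?F t) = Fo ?F (Cod (prod_gpd A (S_gpd B)) t)"
      by (rule nth_equalityI) (auto simp: t n o nth_Cod_S_gpd P_simps)
    fix s assume "s \<in> Ar (prod_gpd A (S_gpd B))" and ds: "Dom (prod_gpd A (S_gpd B)) s = Cod (prod_gpd A (S_gpd B)) t"
    then obtain \<psi> h where s: "s = (h, \<psi>)" and b: "\<psi> \<in> Ar (S_gpd B)" and h: "h \<in> Ar A"
      by (auto simp: prod_gpd_def)
    have b': "Dom (S_gpd B) \<psi> = Cod (S_gpd B) \<phi>" and h': "Dom A h = Cod A g"
      using ds by (auto simp: s t P_simps)
    note l = composable_S_gpd[OF b b']
    show "Fa ?F (Cmp (prod_gpd A (S_gpd B)) s t) = Cmp (S_gpd A) (Fa ?F s) (Fa ?F t)"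
      by (rule nth_equalityI) (auto simp: s t n P_simps nth_Cmp_S_gpd l
          Ar_S_gpdD(3)[OF b, simplified l])
  qed
qed

section \<open>Pullbacks over S of the terminal groupoid\<close>

context
  fixes A :: "('o, 'm) gpd" and B :: "('p, 'n) gpd" and F G
  assumes F: "gfunctor A terminal_gpd F" and G: "gfunctor B terminal_gpd G"
begin

interpretation F: gfunctor A terminal_gpd F by (rule F)
interpretation G: gfunctor B terminal_gpd G by (rule G)

text \<open>A functor to the terminal groupoid, applied entrywise, forgets everything but the length
  of a list and, on arrows, the permutation.\<close>

lemma Ob_pullback_S:
  "Ob (pullback_gpd (S_gpd A) (S_gpd B) (S_fun F) (S_fun G))
    = {(xs, ys). xs \<in> Ob (S_gpd A) \<and> ys \<in> Ob (S_gpd B) \<and> length xs = length ys}"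
  by (auto simp: pullback_gpd_def S_fun_def list_eq_iff_nth_eq)

lemma Ar_pullback_S:
  "Ar (pullback_gpd (S_gpd A) (S_gpd B) (S_fun F) (S_fun G))
    = {(\<phi>, \<psi>). \<phi> \<in> Ar (S_gpd A) \<and> \<psi> \<in> Ar (S_gpd B) \<and> map fst \<phi> = map fst \<psi>}"
  by (auto simp: pullback_gpd_def S_fun_def list_eq_iff_nth_eq case_prod_unfold)

lemma groupoid_pullback_S: "groupoid (pullback_gpd (S_gpd A) (S_gpd B) (S_fun F) (S_fun G))"
  by (rule groupoid_pullback_gpd gfunctor_S_fun F G)+

lemma pullback_S_simps:
  "Dom (pullback_gpd (S_gpd A) (S_gpd B) (S_fun F) (S_fun G)) (\<phi>, \<psi>) = (Dom (S_gpd A) \<phi>, Dom (S_gpd B) \<psi>)"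
  "Cod (pullback_gpd (S_gpd A) (S_gpd B) (S_fun F) (S_fun G)) (\<phi>, \<psi>) = (Cod (S_gpd A) \<phi>, Cod (S_gpd B) \<psi>)"
  "Cmp (pullback_gpd (S_gpd A) (S_gpd B) (S_fun F) (S_fun G)) (\<phi>', \<psi>') (\<phi>, \<psi>) =
     (Cmp (S_gpd A) \<phi>' \<phi>, Cmp (S_gpd B) \<psi>' \<psi>)"
  by (simp_all add: pullback_gpd_def prod_gpd_def)

lemma S_zip_nth:
  "length \<phi> = length \<psi> \<Longrightarrow> length (Fa S_zip (\<phi>, \<psi>)) = length \<psi>"
  "length \<phi> = length \<psi> \<Longrightarrow> i < length \<psi> \<Longrightarrow> Fa S_zip (\<phi>, \<psi>) ! i = (fst (\<phi> ! i), snd (\<phi> ! i), snd (\<psi> ! i))"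
  by (auto simp: S_zip_def case_prod_unfold)

lemma gfunctor_S_zip:
  "gfunctor (pullback_gpd (S_gpd A) (S_gpd B) (S_fun F) (S_fun G)) (S_gpd (prod_gpd A B)) S_zip"
    (is "gfunctor ?P ?C S_zip")
proof -
  interpret P: groupoid ?P by (rule groupoid_pullback_S)
  interpret C: groupoid ?C by (intro groupoid_S_gpd groupoid_prod_gpd) unfold_locales
  have AB: "Ar (prod_gpd A B) = Ar A \<times> Ar B" "Dom (prod_gpd A B) (f, g) = (Dom A f, Dom B g)"
    "Cod (prod_gpd A B) (f, g) = (Cod A f, Cod B g)"
    "Cmp (prod_gpd A B) (f', g') (f, g) = (Cmp A f' f, Cmp B g' g)" for f g f' g'
    by (simp_all add: prod_gpd_def)
  show ?thesis
  proof
    fix t assume "t \<in> Ar ?P"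
    then obtain \<phi> \<psi> where t: "t = (\<phi>, \<psi>)" and a: "\<phi> \<in> Ar (S_gpd A)" and b: "\<psi> \<in> Ar (S_gpd B)"
      and m: "map fst \<phi> = map fst \<psi>"
      by (auto simp: Ar_pullback_S)
    have l: "length \<phi> = length \<psi>" using m by (metis length_map)
    have k: "fst (\<phi> ! i) = fst (\<psi> ! i)" if "i < length \<psi>" for i
      using m that l by (metis nth_map)
    note as = Ar_S_gpdD(2,3)[OF a, unfolded l] Ar_S_gpdD(2,3)[OF b]
    have "bij_betw (\<lambda>i. fst (Fa S_zip t ! i)) {..<length \<psi>} {..<length \<psi>}"
      using Ar_S_gpdD(4)[OF b] by (subst bij_betw_cong[where g = "\<lambda>i. fst (\<psi> ! i)"]) (auto simp: S_zip_nth t l k)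
    then show *: "Fa S_zip t \<in> Ar ?C"
      using Ar_S_gpdD(1)[OF b] by (auto simp: t Ar_S_gpd_iff S_zip_nth l as AB simp flip: length_greater_0_conv)
    have o: "Fo S_zip (xs, ys) ! i = (xs ! i, ys ! i)" "length (Fo S_zip (xs, ys)) = length ys"
      if "length xs = length ys" "i < length ys" for xs ys i
      using that by (auto simp: S_zip_def)
    have o': "length (Fo S_zip (xs, ys)) = length ys"
      if "length xs = length ys" for xs ys
      using that by (auto simp: S_zip_def)
    show "Dom ?C (Fa S_zip t) = Fo S_zip (Dom ?P t)"
      unfolding Dom_S_gpd_eq_iff[OF *]
    proof (intro conjI allI impI)
      show "length (Fo S_zip (Dom ?P t)) = length (Fa S_zip t)"
        by (simp add: t S_zip_nth o' pullback_S_simps l)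
      fix i assume "i < length (Fa S_zip t)"
      then have i: "i < length \<psi>" by (simp add: t S_zip_nth l)
      then show "Fo S_zip (Dom ?P t) ! fst (Fa S_zip t ! i) = Dom (prod_gpd A B) (snd (Fa S_zip t ! i))"
        using nth_Dom_S_gpd[OF a, of i] nth_Dom_S_gpd[OF b i] Ar_S_gpdD(3)[OF b i]
        by (simp add: t S_zip_nth o pullback_S_simps l k AB)
    qed
    show "Cod ?C (Fa S_zip t) = Fo S_zip (Cod ?P t)"
      by (rule nth_equalityI) (auto simp: t S_zip_nth o o' nth_Cod_S_gpd pullback_S_simps l AB)
    fix s assume "s \<in> Ar ?P" and ds: "Dom ?P s = Cod ?P t"
    then obtain \<phi>' \<psi>' where s: "s = (\<phi>', \<psi>')" and a': "\<phi>' \<in> Ar (S_gpd A)" and b': "\<psi>' \<in> Ar (S_gpd B)"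
      and m': "map fst \<phi>' = map fst \<psi>'"
      by (auto simp: Ar_pullback_S)
    have d: "Dom (S_gpd A) \<phi>' = Cod (S_gpd A) \<phi>" "Dom (S_gpd B) \<psi>' = Cod (S_gpd B) \<psi>"
      using ds by (auto simp: s t pullback_S_simps)
    note l1 = composable_S_gpd[OF a' d(1)] and l2 = composable_S_gpd[OF b' d(2)]
    have l': "length \<phi>' = length \<psi>" "length \<psi>' = length \<psi>" using l1(1) l2(1) l by auto
    have k': "fst (\<phi>' ! i) = fst (\<psi>' ! i)" if "i < length \<psi>" for i
      using m' that l' by (metis nth_map)
    have k3: "fst (\<psi>' ! i) < length \<psi>" if "i < length \<psi>" for i
      using Ar_S_gpdD(3)[OF b'] that l' by simp
    show "Fa S_zip (Cmp ?P s t) = Cmp ?C (Fa S_zip s) (Fa S_zip t)"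
      by (rule nth_equalityI)
         (auto simp: s t pullback_S_simps S_zip_nth nth_Cmp_S_gpd l l' k' k3 AB)
  qed
qed

text \<open>The two arrows of a pair have equal labels, so zipping loses nothing and
  \<open>?U\<close> unzips again; \<open>S_zip\<close> is therefore bijective on the arrows out of
  (xs, ys). A pair of lists becomes a list of pairs, and \<open>outdeg_S_gpd\<close> applies to the
  latter.\<close>

lemma outdeg_pullback_S:
  assumes "length xs = length ys"
  shows "outdeg (pullback_gpd (S_gpd A) (S_gpd B) (S_fun F) (S_fun G)) (xs, ys)
      = outdeg (S_gpd (prod_gpd A B)) (zip xs ys)"
    and "finite (arrows_from (S_gpd (prod_gpd A B)) (zip xs ys)) \<Longrightarrow>
      finite (arrows_from (pullback_gpd (S_gpd A) (S_gpd B) (S_fun F) (S_fun G)) (xs, ys))"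
    (is "_ \<Longrightarrow> finite (arrows_from ?P _)")
proof -
  let ?Z = "S_zip :: ('o list \<times> 'p list, (nat \<times> 'm) list \<times> (nat \<times> 'n) list, ('o \<times> 'p) list, (nat \<times> 'm \<times> 'n) list) gfun"
  let ?U = "\<lambda>\<chi> :: (nat \<times> 'm \<times> 'n) list. (map (\<lambda>(k, f, g). (k, f)) \<chi>, map (\<lambda>(k, f, g). (k, g)) \<chi>)"
  interpret Z: gfunctor ?P "S_gpd (prod_gpd A B)" ?Z by (rule gfunctor_S_zip)
  have U_zip: "?U (Fa ?Z t) = t" if "t \<in> Ar ?P" for t
  proof -
    from that obtain \<phi> \<psi> where t: "t = (\<phi>, \<psi>)" "map fst \<phi> = map fst \<psi>"
      by (auto simp: Ar_pullback_S)
    then have "length \<phi> = length \<psi>" by (metis length_map)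
    moreover have "fst (\<phi> ! i) = fst (\<psi> ! i)" if "i < length \<psi>" for i
      using t that calculation by (metis nth_map)
    ultimately show ?thesis
      by (auto simp: t list_eq_iff_nth_eq S_zip_nth prod_eq_iff)
  qed
  have zip_U: "Fa ?Z (?U \<chi>) = \<chi>" for \<chi>
    by (auto simp: list_eq_iff_nth_eq S_zip_nth case_prod_unfold)
  have inj: "inj_on (Fa ?Z) (arrows_from ?P (xs, ys))"
    by (rule inj_on_inverseI[where g = ?U], rule U_zip) (simp add: arrows_from_def)
  have U_Ar: "?U \<chi> \<in> Ar ?P" if c: "\<chi> \<in> Ar (S_gpd (prod_gpd A B))" for \<chi>
  proof -
    have "snd (\<chi> ! i) \<in> Ar A \<times> Ar B" if "i < length \<chi>" for i
      using Ar_S_gpdD(2)[OF c that] by (simp add: prod_gpd_def)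
    then have "fst (snd (\<chi> ! i)) \<in> Ar A \<and> snd (snd (\<chi> ! i)) \<in> Ar B" if "i < length \<chi>" for i
      using that by (auto simp: mem_Times_iff)
    moreover have "bij_betw (\<lambda>i. fst (fst (?U \<chi>) ! i)) {..<length \<chi>} {..<length \<chi>}"
      "bij_betw (\<lambda>i. fst (snd (?U \<chi>) ! i)) {..<length \<chi>} {..<length \<chi>}"
      by (rule iffD2[OF bij_betw_cong Ar_S_gpdD(4)[OF c]]; simp add: case_prod_unfold)+
    ultimately show ?thesis
      using Ar_S_gpdD(1)[OF c] by (simp add: Ar_pullback_S Ar_S_gpd_iff case_prod_unfold)
  qed
  have im: "arrows_from (S_gpd (prod_gpd A B)) (zip xs ys) = Fa ?Z ` arrows_from ?P (xs, ys)"
  proof safe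
    fix \<chi> assume "\<chi> \<in> arrows_from (S_gpd (prod_gpd A B)) (zip xs ys)"
    then have c: "\<chi> \<in> Ar (S_gpd (prod_gpd A B))" and d: "Dom (S_gpd (prod_gpd A B)) \<chi> = zip xs ys"
      by (auto simp: arrows_from_def)
    have "Fo ?Z (Dom ?P (?U \<chi>)) = zip xs ys"
      using Z.dom_fa[OF U_Ar[OF c]] by (simp add: zip_U d)
    moreover have "length xs = length \<chi>" using arg_cong[OF d, of length] assms by simp
    ultimately have "Dom ?P (?U \<chi>) = (xs, ys)"
      using assms by (simp add: S_zip_def pullback_S_simps zip_eq_conv)
    then have "?U \<chi> \<in> arrows_from ?P (xs, ys)" using U_Ar[OF c] by (simp add: arrows_from_def)
    then show "\<chi> \<in> Fa ?Z ` arrows_from ?P (xs, ys)" by (rule image_eqI[where f = "Fa ?Z", rotated]) (rule zip_U[symmetric])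
  next
    fix t assume "t \<in> arrows_from ?P (xs, ys)"
    then show "Fa ?Z t \<in> arrows_from (S_gpd (prod_gpd A B)) (zip xs ys)"
      using Z.fa_ar Z.dom_fa by (auto simp: arrows_from_def S_zip_def)
  qed
  show "outdeg ?P (xs, ys) = outdeg (S_gpd (prod_gpd A B)) (zip xs ys)"
    by (simp add: outdeg_def im card_image[OF inj])
  show "finite (arrows_from (S_gpd (prod_gpd A B)) (zip xs ys)) \<Longrightarrow> finite (arrows_from ?P (xs, ys))"
    by (simp add: im finite_image_iff[OF inj])
qed

end

text \<open>This is the distributive law: expanding the product on the right chooses one x over each
  entry of ls. The semiring is arbitrary because the law serves with natural numbers (counting
  arrows), with rationals (weights) and with polynomials (comultiplication). Finiteness is proved
  along with it, since a sum over an infinite set would be 0.\<close>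

lemma sum_prod_list_fibres:
  fixes w :: "'a \<Rightarrow> 'c::comm_semiring_1"
  assumes "\<And>l. l \<in> set ls \<Longrightarrow> finite {x \<in> X. iv x = l}"
  shows "finite {xs. set xs \<subseteq> X \<and> map iv xs = ls} \<and>
    (\<Sum>xs | set xs \<subseteq> X \<and> map iv xs = ls. \<Prod>x\<leftarrow>xs. w x) = (\<Prod>l\<leftarrow>ls. \<Sum>x | x \<in> X \<and> iv x = l. w x)"
  using assms
proof (induction ls)
  case Nil
  have "{xs. set xs \<subseteq> X \<and> map iv xs = []} = {[]}" by auto
  then show ?case by simp
next
  case (Cons l ls)
  let ?Y = "{x \<in> X. iv x = l}" and ?Z = "{xs. set xs \<subseteq> X \<and> map iv xs = ls}"
  let ?c = "\<lambda>(x, xs). x # xs"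
  have e: "{xs. set xs \<subseteq> X \<and> map iv xs = l # ls} = ?c ` (?Y \<times> ?Z)"
    by (auto simp: map_eq_Cons_conv image_iff)
  have inj: "inj_on ?c (?Y \<times> ?Z)" by (auto simp: inj_on_def)
  have fY: "finite ?Y" using Cons.prems by simp
  have IH: "finite ?Z" "(\<Sum>xs\<in>?Z. \<Prod>x\<leftarrow>xs. w x) = (\<Prod>l\<leftarrow>ls. \<Sum>x | x \<in> X \<and> iv x = l. w x)"
    using Cons by auto
  have "(\<Sum>xs\<in>?c ` (?Y \<times> ?Z). \<Prod>x\<leftarrow>xs. w x) = (\<Sum>x\<in>?Y. \<Sum>xs\<in>?Z. w x * (\<Prod>x\<leftarrow>xs. w x))"
    unfolding sum.reindex[OF inj] by (subst sum.cartesian_product) (simp add: case_prod_unfold)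
  also have "\<dots> = (\<Sum>x\<in>?Y. w x) * (\<Prod>l\<leftarrow>ls. \<Sum>x | x \<in> X \<and> iv x = l. w x)"
    by (simp add: IH(2) sum_distrib_right flip: sum_distrib_left)
  finally show ?case unfolding e using fY IH(1) by auto
qed

text \<open>Components are listed by source position instead of target position:
  \<open>fs ! k\<close> is the one out of the k-th entry, and p is the list of labels. In this form
  the permutation and the arrows are chosen independently.\<close>

lemma arrows_from_S_gpd:
  "arrows_from (S_gpd A) xs = (if xs = [] then {} else
     (\<lambda>(p, fs). map (\<lambda>k. (k, fs ! k)) p) ` (permutations_of_set {..<length xs} \<times> {fs. set fs \<subseteq> Ar A \<and> map (Dom A) fs = xs}))"
  (is "_ = (if _ then _ else ?m ` (?P \<times> ?F))")
proof (cases "xs = []")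
  case True
  have False if "\<phi> \<in> Ar (S_gpd A)" "Dom (S_gpd A) \<phi> = []" for \<phi>
    using Ar_S_gpdD(1)[OF that(1)] arg_cong[OF that(2), of length] by simp
  then show ?thesis using True by (auto simp: arrows_from_def)
next
  case False
  have "arrows_from (S_gpd A) xs = ?m ` (?P \<times> ?F)"
  proof (intro equalityI subsetI)
    fix \<phi> assume "\<phi> \<in> arrows_from (S_gpd A) xs"
    then have a: "\<phi> \<in> Ar (S_gpd A)" and d: "Dom (S_gpd A) \<phi> = xs" by (auto simp: arrows_from_def)
    let ?fs = "map (\<lambda>k. the (map_of \<phi> k)) [0..<length \<phi>]"
    have dist: "distinct (map fst \<phi>)" and im: "fst ` set \<phi> = {..<length \<phi>}" using a by (auto simp: S_gpd_def)
    have lx: "length xs = length \<phi>" using arg_cong[OF d, of length] by simp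
    have fs: "?fs ! fst (\<phi> ! i) = snd (\<phi> ! i)" if "i < length \<phi>" for i
    proof -
      have "(fst (\<phi> ! i), snd (\<phi> ! i)) \<in> set \<phi>" using that by simp
      then have "map_of \<phi> (fst (\<phi> ! i)) = Some (snd (\<phi> ! i))" using dist by simp
      then show ?thesis using Ar_S_gpdD(3)[OF a that] by simp
    qed
    have "\<phi> = ?m (map fst \<phi>, ?fs)"
      by (rule nth_equalityI) (auto simp: fs)
    moreover have "map fst \<phi> \<in> ?P" using dist im lx by (simp add: permutations_of_set_def)
    moreover have "?fs \<in> ?F"
    proof -
      have "?fs ! k \<in> Ar A" if "k < length \<phi>" for k
        using Ar_S_gpd_obtain[OF a that] fs Ar_S_gpdD(2)[OF a] by metis
      moreover have "map (Dom A) ?fs = xs" using d by (simp add: S_gpd_def comp_def)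
      ultimately show ?thesis by (auto simp: set_conv_nth simp del: nth_map)
    qed
    ultimately show "\<phi> \<in> ?m ` (?P \<times> ?F)" by blast
  next
    fix \<phi> assume "\<phi> \<in> ?m ` (?P \<times> ?F)"
    then obtain p fs where p: "p \<in> ?P" and fs: "set fs \<subseteq> Ar A" "xs = map (Dom A) fs"
      and \<phi>: "\<phi> = map (\<lambda>k. (k, fs ! k)) p"
      by auto
    have lp: "length p = length xs" "distinct p" "set p = {..<length xs}"
      using p by (auto simp: permutations_of_set_def distinct_card[symmetric])
    have a: "map (\<lambda>k. (k, fs ! k)) p \<in> Ar (S_gpd A)"
      using lp fs False by (auto simp: S_gpd_def comp_def image_image)
    have pk: "p ! i < length fs" if "i < length xs" for i
      using lp fs that by (metis length_map lessThan_iff nth_mem)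
    have "Dom (S_gpd A) (map (\<lambda>k. (k, fs ! k)) p) = xs"
      unfolding Dom_S_gpd_eq_iff[OF a] using fs lp pk by auto
    then show "\<phi> \<in> arrows_from (S_gpd A) xs"
      using a by (simp add: \<phi> arrows_from_def)
  qed
  with False show ?thesis by simp
qed

lemma
  assumes lf: "locally_finite A" and xs: "xs \<in> Ob (S_gpd A)"
  shows outdeg_S_gpd: "outdeg (S_gpd A) xs = fact (length xs) * (\<Prod>x\<leftarrow>xs. outdeg A x)"
    and finite_arrows_from_S_gpd: "finite (arrows_from (S_gpd A) xs)"
proof -
  let ?m = "\<lambda>(p, fs). map (\<lambda>k. (k, fs ! k)) p :: (nat \<times> 'b) list"
  let ?P = "permutations_of_set {..<length xs}" and ?F = "{fs. set fs \<subseteq> Ar A \<and> map (Dom A) fs = xs}"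
  have e: "arrows_from (S_gpd A) xs = ?m ` (?P \<times> ?F)"
    using xs by (auto simp: arrows_from_S_gpd Ob_S_gpd)
  have inj: "inj_on ?m (?P \<times> ?F)"
  proof (rule inj_onI)
    fix u v assume u: "u \<in> ?P \<times> ?F" and v: "v \<in> ?P \<times> ?F" and eq: "?m u = ?m v"
    obtain p fs q gs where uv: "u = (p, fs)" "v = (q, gs)" by (cases u, cases v)
    have "map fst (?m u) = map fst (?m v)" using eq by simp
    then have pq: "p = q" by (simp add: uv comp_def)
    have l: "length fs = length xs" "length gs = length xs" using u v by (auto simp: uv dest: map_eq_imp_length_eq)
    have "fs ! k = gs ! k" if "k < length xs" for k
    proof -
      have "k \<in> set p" using u that by (auto simp: uv permutations_of_set_def)
      then show ?thesis using eq by (auto simp: uv pq)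
    qed
    then show "u = v" using l pq by (auto simp: uv list_eq_iff_nth_eq)
  qed
  have fin: "finite {f \<in> Ar A. Dom A f = x}" if "x \<in> set xs" for x
    using lf xs that by (auto simp: locally_finite_def arrows_from_def Ob_S_gpd)
  \<comment> \<open>With all weights equal to 1 the distributive law counts the admissible lists
    \<open>fs\<close>.\<close>
  note S = sum_prod_list_fibres[of xs "Ar A" "Dom A" "\<lambda>_. 1::nat", OF fin]
  have finF: "finite ?F" using S by blast
  show "finite (arrows_from (S_gpd A) xs)" unfolding e using finF by (intro finite_imageI finite_cartesian_product) auto
  have "card ?F = (\<Prod>x\<leftarrow>xs. outdeg A x)"
    using S by (simp add: outdeg_def arrows_from_def map_replicate_const)
  then show "outdeg (S_gpd A) xs = fact (length xs) * (\<Prod>x\<leftarrow>xs. outdeg A x)"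
    unfolding outdeg_def[of "S_gpd A"] e card_image[OF inj] by (simp add: card_cartesian_product)
qed

lemma locally_finite_S_gpd: "locally_finite A \<Longrightarrow> locally_finite (S_gpd A)"
  using finite_arrows_from_S_gpd by (auto simp: locally_finite_def)

text \<open>If \<open>iv\<close> is a complete isomorphism invariant on A, the multiset of its
  values is one on S A: equal multisets provide the permutation, and equal values provide a
  component at each position. Starting from the terminal groupoid this yields lengths, exponents and
  monomials as invariants on \<open>S1\<close>, \<open>S2\<close> and \<open>S3\<close>.\<close>

lemma iso_rel_S_gpd:
  assumes "groupoid A"
    and iv: "\<And>x y. x \<in> Ob A \<Longrightarrow> y \<in> Ob A \<Longrightarrow> (x, y) \<in> iso_rel A \<longleftrightarrow> iv x = iv y"
    and xs: "xs \<in> Ob (S_gpd A)" and ys: "ys \<in> Ob (S_gpd A)"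
  shows "(xs, ys) \<in> iso_rel (S_gpd A) \<longleftrightarrow> mset (map iv xs) = mset (map iv ys)"
proof
  interpret A: groupoid A by fact
  assume "(xs, ys) \<in> iso_rel (S_gpd A)"
  then obtain \<phi> where a: "\<phi> \<in> Ar (S_gpd A)" and d: "Dom (S_gpd A) \<phi> = xs" and c: "Cod (S_gpd A) \<phi> = ys"
    by (auto simp: iso_rel_def)
  have l: "length xs = length \<phi>" "length ys = length \<phi>"
    using arg_cong[OF d, of length] arg_cong[OF c, of length] by auto
  have "map iv ys ! i = map iv xs ! fst (\<phi> ! i)" if i: "i < length \<phi>" for i
  proof -
    have f: "snd (\<phi> ! i) \<in> Ar A" by (rule Ar_S_gpdD(2)[OF a i])
    then have "(Dom A (snd (\<phi> ! i)), Cod A (snd (\<phi> ! i))) \<in> iso_rel A"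
      by (auto simp: A.iso_rel_iff hom_set_def)
    then have "iv (Dom A (snd (\<phi> ! i))) = iv (Cod A (snd (\<phi> ! i)))"
      using iv f A.dom_ob A.cod_ob by blast
    then show ?thesis
      using i l Ar_S_gpdD(3)[OF a i] nth_Dom_S_gpd[OF a i] nth_Cod_S_gpd[OF i, of A] by (simp add: d c)
  qed
  then have "image_mset (\<lambda>i. map iv ys ! i) (mset_set {..<length \<phi>})
     = image_mset (\<lambda>i. map iv xs ! fst (\<phi> ! i)) (mset_set {..<length \<phi>})"
    by (intro image_mset_cong) auto
  also have "\<dots> = image_mset (\<lambda>k. map iv xs ! k) (image_mset (\<lambda>i. fst (\<phi> ! i)) (mset_set {..<length \<phi>}))"
    by (simp add: multiset.map_comp comp_def)
  also have "image_mset (\<lambda>i. fst (\<phi> ! i)) (mset_set {..<length \<phi>}) = mset_set {..<length \<phi>}"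
    using Ar_S_gpdD(4)[OF a] by (simp add: image_mset_mset_set bij_betw_def)
  finally have "image_mset (\<lambda>i. map iv ys ! i) (mset_set {..<length (map iv ys)})
     = image_mset (\<lambda>i. map iv xs ! i) (mset_set {..<length (map iv xs)})"
    by (simp only: length_map l)
  moreover have "image_mset (\<lambda>i. zs ! i) (mset_set {..<length zs}) = mset zs" for zs :: "'c list"
    by (metis map_nth mset_map mset_upt atLeast0LessThan)
  ultimately show "mset (map iv xs) = mset (map iv ys)" by (simp only:)
next
  interpret A: groupoid A by fact
  assume "mset (map iv xs) = mset (map iv ys)"
  then obtain p where p: "p permutes {..<length (map iv xs)}" "permute_list p (map iv xs) = map iv ys"
    using mset_eq_permutation by metis
  have l: "length ys = length xs" using arg_cong[OF p(2), of length] by simp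
  have pl: "p i < length xs" if "i < length xs" for i
    using p(1) that by (metis length_map lessThan_iff permutes_in_image)
  have "iv (xs ! p i) = iv (ys ! i)" if i: "i < length xs" for i
  proof -
    have "map iv ys ! i = map iv xs ! p i"
      using permute_list_nth[OF p(1), of i] i by (simp add: p(2))
    then show ?thesis using i l pl by simp
  qed
  moreover have ob: "xs ! i \<in> Ob A" "ys ! i \<in> Ob A" if "i < length xs" for i
    using xs ys l that by (auto simp: Ob_S_gpd)
  ultimately have "\<exists>f\<in>Ar A. Dom A f = xs ! p i \<and> Cod A f = ys ! i" if "i < length xs" for i
    using iv[OF ob(1)[OF pl[OF that]] ob(2)[OF that]] that by (auto simp: iso_rel_def)
  then obtain f where f: "\<And>i. i < length xs \<Longrightarrow> f i \<in> Ar A \<and> Dom A (f i) = xs ! p i \<and> Cod A (f i) = ys ! i"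
    by metis
  let ?\<phi> = "map (\<lambda>i. (p i, f i)) [0..<length xs]"
  have "bij_betw p {..<length xs} {..<length xs}" using p(1) by (simp add: permutes_imp_bij)
  then have "bij_betw (\<lambda>i. fst (?\<phi> ! i)) {..<length ?\<phi>} {..<length ?\<phi>}"
    by (subst bij_betw_cong[where g = p]) auto
  then have a: "?\<phi> \<in> Ar (S_gpd A)"
    using f xs by (auto simp: Ar_S_gpd_iff Ob_S_gpd)
  have "Dom (S_gpd A) ?\<phi> = xs" unfolding Dom_S_gpd_eq_iff[OF a] using f by auto
  moreover have "Cod (S_gpd A) ?\<phi> = ys" using f l by (intro nth_equalityI) (auto simp: nth_Cod_S_gpd)
  ultimately show "(xs, ys) \<in> iso_rel (S_gpd A)" using a xs ys by (auto simp: iso_rel_def)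
qed

section \<open>Multisets, exponents and the operad T(Sym)\<close>

text \<open>Exponents and monomials are finitely supported functions, while their orderings
  (\<open>permutations_of_multiset\<close>) and products with repetition belong to multisets. This
  is the translation between the two.\<close>

definition mset_of_pm :: "('i \<Rightarrow>\<^sub>0 nat) \<Rightarrow> 'i multiset" where
  "mset_of_pm p = (\<Sum>i\<in>Poly_Mapping.keys p. replicate_mset (Poly_Mapping.lookup p i) i)"

lemma count_mset_of_pm [simp]: "count (mset_of_pm p) i = Poly_Mapping.lookup p i"
proof -
  have "count (mset_of_pm p) i = (\<Sum>j\<in>Poly_Mapping.keys p. if i = j then Poly_Mapping.lookup p j else 0)"
    by (auto simp: mset_of_pm_def count_sum intro!: sum.cong)
  also have "\<dots> = Poly_Mapping.lookup p i"
    by (simp add: in_keys_iff)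
  finally show ?thesis .
qed

lemma set_mset_of_pm [simp]: "set_mset (mset_of_pm p) = Poly_Mapping.keys p"
  by (auto simp: set_mset_def in_keys_iff)

lemma mset_of_pm_inject: "mset_of_pm p = mset_of_pm q \<longleftrightarrow> p = q"
  by (metis count_mset_of_pm poly_mapping_eqI)

lemma prod_mset_of_pm:
  "(\<Prod>i\<in>#mset_of_pm p. f i) = (\<Prod>i\<in>Poly_Mapping.keys p. f i ^ Poly_Mapping.lookup p i :: 'c::comm_monoid_mult)"
proof -
  have "(\<Prod>i\<in>#(\<Sum>i\<in>S. replicate_mset (n i) i). f i) = (\<Prod>i\<in>S. f i ^ n i)" if "finite S" for S n
    using that by (induction S) (auto simp: prod_mset_replicate_mset)
  then show ?thesis by (simp add: mset_of_pm_def)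
qed

text \<open>For a complete invariant \<open>iv\<close> this exponent determines the component of a
  nonempty list in \<open>S_gpd\<close>. It is kept as a finitely supported function because
  concatenation of lists then becomes addition of exponents, that is, multiplication of
  monomials.\<close>

definition profile :: "('a \<Rightarrow> 'i) \<Rightarrow> 'a list \<Rightarrow> ('i \<Rightarrow>\<^sub>0 nat)" where
  "profile iv xs = (\<Sum>x\<leftarrow>xs. Poly_Mapping.single (iv x) 1)"

lemma profile_simps [simp]:
  "profile iv [] = 0" "profile iv (x # xs) = Poly_Mapping.single (iv x) 1 + profile iv xs"
  "profile iv (xs @ ys) = profile iv xs + profile iv ys"
  by (simp_all add: profile_def)

lemma profile_concat: "profile iv (concat xss) = (\<Sum>xs\<leftarrow>xss. profile iv xs)"
  by (induction xss) auto

lemma profile_map: "profile iv (map f xs) = profile (\<lambda>x. iv (f x)) xs"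
  by (simp add: profile_def comp_def)

lemma lookup_profile: "Poly_Mapping.lookup (profile iv xs) i = count (mset (map iv xs)) i"
  by (induction xs) (auto simp: lookup_add lookup_single when_def)

lemma mset_of_pm_profile [simp]: "mset_of_pm (profile iv xs) = mset (map iv xs)"
  by (rule multiset_eqI) (simp add: lookup_profile)

lemma profile_eq_iff: "profile iv xs = p \<longleftrightarrow> mset (map iv xs) = mset_of_pm p"
  by (metis mset_of_pm_profile mset_of_pm_inject)

lemma keys_profile: "Poly_Mapping.keys (profile iv xs) = iv ` set xs"
  by (metis mset_of_pm_profile set_mset_of_pm set_mset_mset set_map)

lemma profile_eq_0_iff: "profile iv xs = 0 \<longleftrightarrow> xs = []"
  by (metis keys_eq_empty keys_profile image_is_empty set_empty)

text \<open>Sort the lists xs by the sequence of their invariants. These sequences are the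
  arrangements of M, and by \<open>sum_prod_list_fibres\<close> all arrangements contribute the same
  product.\<close>

lemma
  fixes w :: "'a \<Rightarrow> 'c::comm_semiring_1"
  assumes fin: "\<And>l. l \<in># M \<Longrightarrow> finite {x \<in> X. iv x = l}"
  shows finite_mset_fibre: "finite {xs. set xs \<subseteq> X \<and> mset (map iv xs) = M}"
    and sum_prod_mset_fibre: "(\<Sum>xs | set xs \<subseteq> X \<and> mset (map iv xs) = M. \<Prod>x\<leftarrow>xs. w x)
      = of_nat (card (permutations_of_multiset M)) * (\<Prod>l\<in>#M. \<Sum>x | x \<in> X \<and> iv x = l. w x)"
proof -
  let ?S = "{xs. set xs \<subseteq> X \<and> mset (map iv xs) = M}"
  let ?L = "\<lambda>ls. {xs. set xs \<subseteq> X \<and> map iv xs = ls}"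
  have e: "?S = (\<Union>ls\<in>permutations_of_multiset M. ?L ls)"
    by (auto simp: permutations_of_multiset_def)
  have L: "finite (?L ls)" "(\<Sum>xs\<in>?L ls. \<Prod>x\<leftarrow>xs. w x) = (\<Prod>l\<in>#M. \<Sum>x | x \<in> X \<and> iv x = l. w x)"
    if "ls \<in> permutations_of_multiset M" for ls
  proof -
    have M: "mset ls = M" using that by (simp add: permutations_of_multiset_def)
    then have "finite {x \<in> X. iv x = l}" if "l \<in> set ls" for l
      using fin that by (metis set_mset_mset)
    note * = sum_prod_list_fibres[of ls X iv w, OF this]
    show "finite (?L ls)" using * by blast
    have "(\<Prod>l\<leftarrow>ls. f l) = (\<Prod>l\<in>#M. f l)" for f :: "_ \<Rightarrow> 'c"
      using M by (metis mset_map prod_mset_prod_list)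
    then show "(\<Sum>xs\<in>?L ls. \<Prod>x\<leftarrow>xs. w x) = (\<Prod>l\<in>#M. \<Sum>x | x \<in> X \<and> iv x = l. w x)"
      using * by simp
  qed
  show "finite ?S" unfolding e by (intro finite_UN_I L) auto
  have "(\<Sum>xs\<in>?S. \<Prod>x\<leftarrow>xs. w x) = (\<Sum>ls\<in>permutations_of_multiset M. \<Sum>xs\<in>?L ls. \<Prod>x\<leftarrow>xs. w x)"
    unfolding e using L(1) by (intro sum.UNION_disjoint) auto
  also have "\<dots> = (\<Sum>ls\<in>permutations_of_multiset M. \<Prod>l\<in>#M. \<Sum>x | x \<in> X \<and> iv x = l. w x)"
    using L(2) by (intro sum.cong) auto
  finally show "(\<Sum>xs\<in>?S. \<Prod>x\<leftarrow>xs. w x) = of_nat (card (permutations_of_multiset M)) *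
      (\<Prod>l\<in>#M. \<Sum>x | x \<in> X \<and> iv x = l. w x)"
    by simp
qed

section \<open>The groupoids S(1), S(S 1), S(S(S 1)) and the two-level trees\<close>

definition collapse :: "('o, 'm, unit, unit) gfun" where
  "collapse = \<lparr>Fo = (\<lambda>_. ()), Fa = (\<lambda>_. ())\<rparr>"

lemma groupoid_terminal_gpd: "groupoid terminal_gpd"
  by unfold_locales (auto simp: terminal_gpd_def)

lemma gfunctor_collapse:
  assumes "groupoid A" shows "gfunctor A terminal_gpd collapse"
proof -
  interpret A: groupoid A by fact
  interpret T: groupoid terminal_gpd by (rule groupoid_terminal_gpd)
  show ?thesis by unfold_locales (auto simp: terminal_gpd_def)
qed

lemma locally_finite_terminal_gpd: "locally_finite terminal_gpd"
  by (auto simp: locally_finite_def)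

lemma outdeg_terminal_gpd: "outdeg terminal_gpd x = 1"
  by (simp add: outdeg_def arrows_from_def terminal_gpd_def)

text \<open>For a single colour the side conditions of the T-construction (all inputs agree, common
  target) hold for every nonempty list, so its full subgroupoids are everything.\<close>

lemma full_sub_UNIV:
  assumes "Ob A \<subseteq> U" "groupoid A"
  shows "full_sub A U = A"
proof -
  interpret groupoid A by fact
  have "{x \<in> Ob A. x \<in> U} = Ob A" "{f \<in> Ar A. Dom A f \<in> U \<and> Cod A f \<in> U} = Ar A"
    using assms(1) dom_ob cod_ob by auto
  then show ?thesis by (simp add: full_sub_def)
qed

abbreviation "S1 \<equiv> S_gpd terminal_gpd"
abbreviation "S2 \<equiv> S_gpd S1"
abbreviation "S3 \<equiv> S_gpd S2"
abbreviation "SymT \<equiv> T_S Sym"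
abbreviation "trees \<equiv> trees2 SymT"

lemma groupoid_S123: "groupoid S1" "groupoid S2" "groupoid S3"
  by (intro groupoid_S_gpd groupoid_terminal_gpd)+

lemma locally_finite_S123: "locally_finite S1" "locally_finite S2" "locally_finite S3"
  by (intro locally_finite_S_gpd locally_finite_terminal_gpd)+

lemma Ob_terminal_gpd [simp]: "Ob terminal_gpd = UNIV"
  by (auto simp: terminal_gpd_def)

lemma Ob_S1: "Ob S1 = {xs. xs \<noteq> []}"
  by (simp add: Ob_S_gpd)

lemma nonempty_unit_set: "S \<noteq> {} \<Longrightarrow> S = {()}" for S :: "unit set"
  by auto

text \<open>The internal category \<open>T_cat Sym\<close> has one object and arrows
  \<open>S1\<close>, composed by concatenating copies. The last equation breaks the operadic
  composition into functors: pair each root entry with the list plugged into it, compose inside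
  every pair, and flatten.\<close>

lemma SymT_simps:
  "colours SymT = terminal_gpd" "opers SymT = S2"
  "inp SymT = S_fun collapse" "outp SymT = collapse"
  "units SymT = gcomp S_unit S_unit"
  "compos SymT = gcomp S_mult (gcomp (S_fun (S_strength_left (gcomp S_mult S_const))) S_zip)"
proof -
  have c: "iarr (T_cat Sym) = S1"
  proof -
    have "Ob S1 \<subseteq> {q. \<exists>c. set (Fo (inp Sym) q) = {c}}"
    proof
      fix q assume "q \<in> Ob S1"
      then have "set (Fo (inp Sym) q) \<noteq> {}" by (simp add: Ob_S1 Sym_def)
      then have "set (Fo (inp Sym) q) = {()}" by (rule nonempty_unit_set)
      then show "q \<in> {q. \<exists>c. set (Fo (inp Sym) q) = {c}}" by blast
    qed
    then have "full_sub S1 {q. \<exists>c. set (Fo (inp Sym) q) = {c}} = S1"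
      by (rule full_sub_UNIV[OF _ groupoid_S123(1)])
    then show ?thesis by (simp add: T_cat_def Sym_def)
  qed
  have k: "itgt (T_cat Sym) = collapse" "isrc (T_cat Sym) = collapse"
    by (auto simp: T_cat_def Sym_def collapse_def)
  have i: "icompos (T_cat Sym) = gcomp S_mult S_const"
    by (auto simp: T_cat_def Sym_def gcomp_def S_const_def S_mult_def pr1_def)
  show "colours SymT = terminal_gpd" by (simp add: T_S_def T_operad_def T_cat_def Sym_def)
  show "opers SymT = S2"
  proof -
    have "Ob S2 \<subseteq> {fs. \<exists>c. set (map (Fo (itgt (T_cat Sym))) fs) = {c}}"
    proof
      fix fs assume "fs \<in> Ob S2"
      then have "set (map (Fo (itgt (T_cat Sym))) fs) \<noteq> {}" by (simp add: Ob_S_gpd)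
      then have "set (map (Fo (itgt (T_cat Sym))) fs) = {()}" by (rule nonempty_unit_set)
      then show "fs \<in> {fs. \<exists>c. set (map (Fo (itgt (T_cat Sym))) fs) = {c}}" by blast
    qed
    then have "full_sub S2 {fs. \<exists>c. set (map (Fo (itgt (T_cat Sym))) fs) = {c}} = S2"
      by (rule full_sub_UNIV[OF _ groupoid_S123(2)])
    then show ?thesis by (simp only: T_S_def T_operad_def c operad.simps)
  qed
  show "inp SymT = S_fun collapse" "outp SymT = collapse"
    by (simp_all add: T_S_def T_operad_def k collapse_def)
  show "units SymT = gcomp S_unit S_unit"
    by (simp add: T_S_def T_operad_def T_cat_def Sym_def)
  show "compos SymT = gcomp S_mult (gcomp (S_fun (S_strength_left (gcomp S_mult S_const))) S_zip)"
    by (auto simp: T_S_def T_operad_def i gcomp_def S_mult_def S_fun_def S_strength_left_def S_zip_def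
         fun_eq_iff case_prod_unfold comp_def)
qed

lemma trees_eq: "trees = pullback_gpd S3 S2 (S_fun collapse) (S_fun collapse)"
  by (simp add: trees2_def SymT_simps)

lemma gfunctor_compos: "gfunctor trees S2 (compos SymT)"
proof -
  have K: "gfunctor (prod_gpd S1 S1) S1 (gcomp S_mult S_const)"
    by (rule gfunctor_gcomp[OF gfunctor_S_const gfunctor_S_mult])
       (intro groupoid_terminal_gpd groupoid_S123)+
  show ?thesis
    unfolding SymT_simps trees_eq
    by (rule gfunctor_gcomp[OF gfunctor_gcomp[OF gfunctor_S_zip gfunctor_S_fun] gfunctor_S_mult]
          gfunctor_S_strength_left gfunctor_collapse groupoid_S123 K)+
qed

lemma gfunctor_trees_pr: "gfunctor trees S3 pr1" "gfunctor trees S2 pr2"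
  unfolding trees_eq
  by (rule gfunctor_pullback_pr1[OF gfunctor_S_fun[OF gfunctor_collapse[OF groupoid_S123(2)]]
          gfunctor_S_fun[OF gfunctor_collapse[OF groupoid_S123(1)]]])
     (rule gfunctor_pullback_pr2[OF gfunctor_S_fun[OF gfunctor_collapse[OF groupoid_S123(2)]]
          gfunctor_S_fun[OF gfunctor_collapse[OF groupoid_S123(1)]]])

lemma Ob_trees: "Ob trees = {(gs, f). gs \<in> Ob S3 \<and> f \<in> Ob S2 \<and> length gs = length f}"
  unfolding trees_eq by (rule Ob_pullback_S) (rule gfunctor_collapse groupoid_S123)+

lemma outdeg_S1: "x \<in> Ob S1 \<Longrightarrow> outdeg S1 x = fact (length x)"
  by (simp add: outdeg_S_gpd locally_finite_terminal_gpd outdeg_terminal_gpd map_replicate_const)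

text \<open>The top level carries the same permutation as the root, so the factorial of the common
  length occurs only once. Together with the outdegrees of the root entries it makes up
  \<open>outdeg S2 f\<close>.\<close>

lemma outdeg_trees:
  assumes "(gs, f) \<in> Ob trees"
  shows "outdeg trees (gs, f) = outdeg S2 f * (\<Prod>g\<leftarrow>gs. outdeg S2 g)"
    and "finite (arrows_from trees (gs, f))"
proof -
  have o: "gs \<in> Ob S3" "f \<in> Ob S2" "length gs = length f" using assms by (auto simp: Ob_trees)
  have z: "zip gs f \<in> Ob (S_gpd (prod_gpd S2 S1))"
  proof -
    have "set gs \<subseteq> Ob S2" "gs \<noteq> []" using o(1) by (auto simp: Ob_S_gpd[of S2])
    moreover have "set f \<subseteq> Ob S1" "f \<noteq> []" using o(2) by (auto simp: Ob_S_gpd[of S1])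
    ultimately show ?thesis
      by (subst Ob_S_gpd) (auto simp: Ob_prod_gpd zip_eq_Nil_iff dest: set_zip_leftD set_zip_rightD)
  qed
  note c = gfunctor_collapse[OF groupoid_S123(2)] gfunctor_collapse[OF groupoid_S123(1)]
  have lf: "locally_finite (prod_gpd S2 S1)" by (intro locally_finite_prod_gpd locally_finite_S123)
  have "outdeg trees (gs, f) = fact (length f) * (\<Prod>p\<leftarrow>zip gs f. outdeg (prod_gpd S2 S1) p)"
    unfolding trees_eq using outdeg_pullback_S(1)[OF c o(3)] outdeg_S_gpd[OF lf z] o by simp
  also have "(\<Prod>p\<leftarrow>zip gs f. outdeg (prod_gpd S2 S1) p) = (\<Prod>g\<leftarrow>gs. outdeg S2 g) * (\<Prod>x\<leftarrow>f. outdeg S1 x)"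
    using o(3) by (induction gs f rule: list_induct2) (auto simp: outdeg_prod_gpd)
  finally show "outdeg trees (gs, f) = outdeg S2 f * (\<Prod>g\<leftarrow>gs. outdeg S2 g)"
    by (simp add: outdeg_S_gpd[OF locally_finite_S123(1) o(2)])
  show "finite (arrows_from trees (gs, f))"
    unfolding trees_eq
    by (rule outdeg_pullback_S(2)[OF c o(3) finite_arrows_from_S_gpd[OF lf z]])
qed

lemma locally_finite_trees: "locally_finite trees"
  using outdeg_trees(2) by (auto simp: locally_finite_def)

text \<open>An object of \<open>S2\<close> stands for the exponent \<open>\<lambda>\<close> in which \<open>\<lambda>\<^sub>i\<close> counts its members of length \<open>i\<close>.\<close>

abbreviation "lens \<equiv> profile (length :: unit list \<Rightarrow> nat)"

lemma iso_rel_S1: "x \<in> Ob S1 \<Longrightarrow> y \<in> Ob S1 \<Longrightarrow> (x, y) \<in> iso_rel S1 \<longleftrightarrow> length x = length y"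
proof -
  have "(x, y) \<in> iso_rel S1 \<longleftrightarrow> mset (map (\<lambda>_. ()) x) = mset (map (\<lambda>_. ()) y)"
    if "x \<in> Ob S1" "y \<in> Ob S1"
    using that by (intro iso_rel_S_gpd groupoid_terminal_gpd) (auto simp: iso_rel_def terminal_gpd_def)
  moreover have "mset (map (\<lambda>_. ()) z) = replicate_mset (length z) ()" for z :: "unit list"
    by (induction z) auto
  ultimately show "x \<in> Ob S1 \<Longrightarrow> y \<in> Ob S1 \<Longrightarrow> (x, y) \<in> iso_rel S1 \<longleftrightarrow> length x = length y"
    by (metis size_replicate_mset)
qed

lemma iso_rel_S2: "f \<in> Ob S2 \<Longrightarrow> g \<in> Ob S2 \<Longrightarrow> (f, g) \<in> iso_rel S2 \<longleftrightarrow> lens f = lens g"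
  by (subst iso_rel_S_gpd[where iv = length]) (auto simp: groupoid_S123 iso_rel_S1 profile_eq_iff)

lemma iso_rel_S3: "f \<in> Ob S3 \<Longrightarrow> g \<in> Ob S3 \<Longrightarrow> (f, g) \<in> iso_rel S3 \<longleftrightarrow> profile lens f = profile lens g"
  by (subst iso_rel_S_gpd[where iv = lens]) (auto simp: groupoid_S123 iso_rel_S2 profile_eq_iff)

lemma lens_in_Lam: "f \<in> Ob S2 \<Longrightarrow> lens f \<in> Lam"
  by (auto simp: Lam_def Ob_S_gpd Ob_S1 profile_eq_0_iff lookup_profile count_eq_zero_iff)

lemma Ob_S2_lens_iff:
  assumes "l \<in> Lam"
  shows "f \<in> Ob S2 \<and> lens f = l \<longleftrightarrow> set f \<subseteq> {x. x \<noteq> []} \<and> mset (map length f) = mset_of_pm l"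
proof -
  have "l \<noteq> 0" using assms by (simp add: Lam_def)
  then have "f \<noteq> []" if "lens f = l" using that by auto
  moreover have "set f \<subseteq> Ob S1 \<longleftrightarrow> set f \<subseteq> {x. x \<noteq> []}" by (simp only: Ob_S1)
  ultimately show ?thesis unfolding profile_eq_iff[symmetric] by (auto simp only: Ob_S_gpd mem_Collect_eq)
qed

lemma unit_lists_length: "{x :: unit list. length x = n} = {replicate n ()}"
  by (auto simp: list_eq_iff_nth_eq)

lemma finite_Ob_S2_fibre: "finite {f \<in> Ob S2. lens f = l}"
proof (cases "l \<in> Lam")
  case True
  have "finite {x \<in> {x. x \<noteq> []}. length (x :: unit list) = n}" for n
    using unit_lists_length[of n] by (auto intro: finite_subset[of _ "{x. length x = n}"])
  then show ?thesis unfolding Ob_S2_lens_iff[OF True] by (rule finite_mset_fibre)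
next
  case False
  then have "{f \<in> Ob S2. lens f = l} = {}" using lens_in_Lam by auto
  then show ?thesis by (simp only: finite.emptyI)
qed

lemma lam_aut_pos: "lam_aut l > 0"
  by (simp add: lam_aut_def prod_pos)

text \<open>In view of \<open>sum_iso_class\<close> this identifies \<open>lam_aut l\<close> as the
  order of the automorphism group of an object of type l. If l has n members counted with
  multiplicity, each f has outdegree n! times the factorials of its lengths, and there are n!
  divided by the factorials of the multiplicities such f; the n! cancels.\<close>

lemma sum_inverse_outdeg_S2:
  assumes l: "l \<in> Lam"
  shows "(\<Sum>f | f \<in> Ob S2 \<and> lens f = l. 1 / rat_of_nat (outdeg S2 f)) = 1 / lam_aut l"
proof -
  let ?M = "mset_of_pm l"
  let ?X = "{x :: unit list. x \<noteq> []}"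
  have fib: "{x \<in> ?X. length x = n} = {replicate n ()}" if "n \<in># ?M" for n
  proof -
    have "n \<noteq> 0" using that l by (cases n) (auto simp: Lam_def in_keys_iff)
    then have "{x \<in> ?X. length x = n} = {x. length x = n}" by auto
    then show ?thesis by (simp only: unit_lists_length)
  qed
  have d: "outdeg S2 f = fact (size ?M) * (\<Prod>x\<leftarrow>f. fact (length x))" if "f \<in> Ob S2" "lens f = l" for f
  proof -
    have "(\<Prod>x\<leftarrow>f. outdeg S1 x) = (\<Prod>x\<leftarrow>f. fact (length x))"
      using that by (intro arg_cong[where f = prod_list] map_cong) (auto simp: Ob_S_gpd outdeg_S1)
    moreover have "length f = size ?M"
      using that by (metis profile_eq_iff size_mset length_map)
    ultimately show ?thesis using that by (simp add: outdeg_S_gpd locally_finite_S123)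
  qed
  have inv_prod: "inverse (rat_of_nat (\<Prod>x\<leftarrow>f. fact (length x))) = (\<Prod>x\<leftarrow>f. 1 / fact (length x))" for f :: "unit list list"
    by (induction f) (auto simp: field_simps)
  have "(\<Sum>f | f \<in> Ob S2 \<and> lens f = l. 1 / rat_of_nat (outdeg S2 f))
     = (\<Sum>f | f \<in> Ob S2 \<and> lens f = l. 1 / fact (size ?M) * (\<Prod>x\<leftarrow>f. 1 / fact (length x)))"
    by (rule sum.cong) (auto simp: d inv_prod[symmetric] field_simps)
  also have "\<dots> = 1 / fact (size ?M) * (\<Sum>f | set f \<subseteq> ?X \<and> mset (map length f) = ?M. \<Prod>x\<leftarrow>f. 1 / fact (length x))"
    by (simp add: Ob_S2_lens_iff[OF l] sum_distrib_left)
  also have "(\<Sum>f | set f \<subseteq> ?X \<and> mset (map length f) = ?M. \<Prod>x\<leftarrow>f. 1 / (fact (length x) :: rat))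
     = of_nat (card (permutations_of_multiset ?M)) * (\<Prod>n\<in>#?M. \<Sum>x | x \<in> ?X \<and> length x = n. 1 / (fact (length x) :: rat))"
    by (rule sum_prod_mset_fibre) (simp only: fib finite.emptyI finite_insert)
  also have "(\<Prod>n\<in>#?M. \<Sum>x | x \<in> ?X \<and> length x = n. 1 / (fact (length x) :: rat)) = (\<Prod>n\<in>#?M. 1 / fact n)"
    by (rule arg_cong[where f = prod_mset], rule image_mset_cong) (simp add: fib[simplified])
  also have "\<dots> = (\<Prod>i\<in>Poly_Mapping.keys l. (1 / fact i) ^ Poly_Mapping.lookup l i)"
    by (rule prod_mset_of_pm)
  also have "rat_of_nat (card (permutations_of_multiset ?M))
     = fact (size ?M) / (\<Prod>i\<in>Poly_Mapping.keys l. fact (Poly_Mapping.lookup l i))"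
  proof -
    have "card (permutations_of_multiset ?M) * (\<Prod>i\<in>Poly_Mapping.keys l. fact (Poly_Mapping.lookup l i)) = fact (size ?M)"
      using card_permutations_of_multiset[of ?M] by simp
    from arg_cong[OF this, of rat_of_nat]
    have "rat_of_nat (card (permutations_of_multiset ?M)) * (\<Prod>i\<in>Poly_Mapping.keys l. fact (Poly_Mapping.lookup l i)) = fact (size ?M)"
      by (simp only: of_nat_mult of_nat_prod of_nat_fact)
    then show ?thesis by (simp add: field_simps)
  qed
  finally show ?thesis
    by (simp add: lam_aut_def prod.distrib power_divide prod_dividef)
qed

section \<open>Weighted counting of two-level trees\<close>

abbreviation compose :: "unit list list list \<times> unit list list \<Rightarrow> unit list list" where
  "compose \<equiv> Fo (compos SymT)"

lemma compose_eq:
  "compose (gs, f) = concat (map (\<lambda>(g, x). map (\<lambda>y. concat (map (\<lambda>_. y) x)) g) (zip gs f))"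
  by (simp add: SymT_simps gcomp_def S_mult_def S_fun_def S_strength_left_def S_zip_def S_const_def
      case_prod_unfold comp_def)

text \<open>Plugging y into the root entry x repeats y once per input of x, so lengths multiply. A
  root entry of length k therefore sends the variable with index i to the one with index k i, the
  substitution made by \<open>series_dilate k\<close>.\<close>

lemma lens_compose:
  "lens (compose (gs, f)) = (\<Sum>(g, x)\<leftarrow>zip gs f. profile (\<lambda>y. length x * length y) g)"
proof -
  have "length (concat (map (\<lambda>_. y) x)) = length x * length y" for x y :: "unit list"
    by (induction x) auto
  then show ?thesis
    by (simp add: compose_eq profile_concat profile_map comp_def case_prod_unfold)
qed

lemma finite_trees_fibre: "finite {t \<in> Ob trees. lens (compose t) = l}"
proof -
  \<comment> \<open>p is the number of members of the composite and q the sum of their lengths.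
    Every list in a tree being nonempty, p bounds the length of the root and of each list g of the
    top level. A product \<open>length x * length y\<close> is a member of
    \<open>mset_of_pm l\<close>, so both factors are at most q.\<close>
  let ?p = "size (mset_of_pm l)" and ?q = "\<Sum>i\<in>#mset_of_pm l. i"
  let ?X = "{x :: unit list. set x \<subseteq> UNIV \<and> length x \<le> ?q}"
  let ?Y = "{g. set g \<subseteq> ?X \<and> length g \<le> ?p}"
  have fX: "finite ?X" by (rule finite_lists_length_le) simp
  have fY: "finite ?Y" by (rule finite_lists_length_le[OF fX])
  have fZ: "finite {gs. set gs \<subseteq> ?Y \<and> length gs \<le> ?p}" by (rule finite_lists_length_le[OF fY])
  have "t \<in> {gs. set gs \<subseteq> ?Y \<and> length gs \<le> ?p} \<times> ?Y" if t: "t \<in> Ob trees" and l: "lens (compose t) = l" for t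
  proof -
    obtain gs f where tt: "t = (gs, f)" and o: "gs \<in> Ob S3" "f \<in> Ob S2" and len: "length gs = length f"
      using t by (auto simp: Ob_trees)
    let ?C = "compose (gs, f)"
    let ?b = "\<lambda>(g, x). map (\<lambda>y. concat (map (\<lambda>_. y) x)) g :: unit list list"
    have lC: "length ?C = ?p" "mset (map length ?C) = mset_of_pm l"
      using l by (auto simp: profile_eq_iff tt) (metis size_mset length_map mset_map)
    have lC': "length ?C = (\<Sum>z\<leftarrow>zip gs f. length (fst z))"
      by (simp add: compose_eq length_concat comp_def case_prod_unfold)
    have gs: "g \<noteq> []" "y \<in> set g \<Longrightarrow> y \<noteq> []" if "g \<in> set gs" for g y
      using that o(1) by (auto simp: Ob_S_gpd[of S2] Ob_S_gpd[of S1] Ob_S1)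
    have f: "x \<noteq> []" if "x \<in> set f" for x
      using that o(2) by (auto simp: Ob_S_gpd[of S1] Ob_S1)
    have "(\<Sum>z\<leftarrow>zip gs f. 1) \<le> (\<Sum>z\<leftarrow>zip gs f. length (fst z))"
      using gs(1) by (intro sum_list_mono) (auto dest!: set_zip_leftD simp: Suc_le_eq)
    then have r: "length f \<le> ?p" using len lC lC' by (simp add: sum_list_triv)
    have g: "length g \<le> ?p \<and> length x \<le> ?q \<and> (\<forall>y\<in>set g. length y \<le> ?q)" if z: "(g, x) \<in> set (zip gs f)" for g x
    proof (intro conjI ballI)
      have "length (fst (g, x)) \<le> (\<Sum>z\<leftarrow>zip gs f. length (fst z))"
        using z by (intro member_le_sum_list) (auto intro: rev_image_eqI)
      then show "length g \<le> ?p" using lC lC' by simp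
      have *: "length x * length y \<le> ?q" if y: "y \<in> set g" for y
      proof -
        have "concat (map (\<lambda>_. y) x) \<in> set ?C" using z y by (force simp: compose_eq)
        then have "length (concat (map (\<lambda>_. y) x)) \<in># mset_of_pm l"
          unfolding lC(2)[symmetric] by (metis image_eqI set_map set_mset_mset)
        moreover have "length (concat (map (\<lambda>_. y) x)) = length x * length y"
          by (induction x) auto
        ultimately have "length x * length y \<in># mset_of_pm l" by simp
        then obtain M where "mset_of_pm l = add_mset (length x * length y) M" by (meson mset_add)
        then show ?thesis by simp
      qed
      have ne: "x \<noteq> []" "g \<noteq> []" using f[OF set_zip_rightD[OF z]] gs(1)[OF set_zip_leftD[OF z]] .
      have y: "y \<noteq> []" if "y \<in> set g" for y using gs(2)[OF set_zip_leftD[OF z] that] .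
      have "length x * 1 \<le> length x * length (hd g)"
        using y[of "hd g"] ne(2) by (intro mult_left_mono) (auto simp: Suc_le_eq)
      also have "\<dots> \<le> ?q" by (rule *[OF hd_in_set[OF ne(2)]])
      finally show "length x \<le> ?q" by simp
      show "length y \<le> ?q" if "y \<in> set g" for y
      proof -
        have "1 * length y \<le> length x * length y" using ne(1) by (intro mult_right_mono) (auto simp: Suc_le_eq)
        also have "\<dots> \<le> ?q" by (rule *[OF that])
        finally show ?thesis by simp
      qed
    qed
    have "\<exists>x. (g, x) \<in> set (zip gs f)" if "g \<in> set gs" for g
      using that len by (metis in_set_impl_in_set_zip1)
    moreover have "\<exists>g. (g, x) \<in> set (zip gs f)" if "x \<in> set f" for x
      using that len by (metis in_set_impl_in_set_zip2)
    ultimately show ?thesis using g r len by (fastforce simp: tt)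
  qed
  then have "{t \<in> Ob trees. lens (compose t) = l} \<subseteq> {gs. set gs \<subseteq> ?Y \<and> length gs \<le> ?p} \<times> ?Y"
    by blast
  then show ?thesis using fZ fY by (meson finite_SigmaI finite_subset)
qed

text \<open>The common value of both comultiplications at the generator with index l. A tree
  contributes its top level as a monomial and its root as a single generator, with weight |Aut|/d(t)
  as in \<open>incidence_coeff_eq\<close>. The top level stands on the left because the left tensor
  factor is evaluated at F, which is substituted into G.\<close>

definition tree_gen :: "(nat \<Rightarrow>\<^sub>0 nat) \<Rightarrow> (A_monom \<times> A_monom \<Rightarrow>\<^sub>0 rat)" where
  "tree_gen l = (\<Sum>t | t \<in> Ob trees \<and> lens (compose t) = l.
     Poly_Mapping.single (profile lens (fst t), Poly_Mapping.single (lens (snd t)) 1)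
       (lam_aut l / of_nat (outdeg trees t)))"

lemma prod_list_single:
  "(\<Prod>t\<leftarrow>xs. Poly_Mapping.single (a t, b t) (c t))
     = Poly_Mapping.single (\<Sum>t\<leftarrow>xs. a t, \<Sum>t\<leftarrow>xs. b t) (\<Prod>t\<leftarrow>xs. c t :: 'c::comm_semiring_1)"
proof (induction xs)
  case Nil
  have "((0::'a), (0::'b)) = 0" by (simp add: zero_prod_def)
  then show ?case by simp
next
  case (Cons t xs)
  then show ?case by (simp add: mult_single)
qed

lemma of_nat_poly_mapping: "(of_nat n :: 'b::comm_monoid_add \<Rightarrow>\<^sub>0 'c::comm_semiring_1) = Poly_Mapping.single 0 (of_nat n)"
  by (induction n) (simp_all add: single_add)

lemma prod_mset_single_0:
  "(\<Prod>l\<in>#M. Poly_Mapping.single 0 (c l)) = (Poly_Mapping.single 0 (\<Prod>l\<in>#M. c l) :: 'b::comm_monoid_add \<Rightarrow>\<^sub>0 'c::comm_semiring_1)"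
  by (induction M) (simp_all add: mult_single)

lemma prod_list_inverse: "(\<Prod>x\<leftarrow>xs. 1 / (w x :: rat)) = 1 / (\<Prod>x\<leftarrow>xs. w x)"
  by (induction xs) auto

lemma of_nat_prod_list: "of_nat (\<Prod>x\<leftarrow>xs. w x) = (\<Prod>x\<leftarrow>xs. of_nat (w x) :: rat)"
  by (induction xs) auto

text \<open>The weights 1/d over the component of f sum to 1/|Aut f|, and
  \<open>sum_prod_mset_fibre\<close> evaluates the same sum. The number of arrangements is kept on
  the left because it is produced again, as a factor, when configurations of trees are
  summed.\<close>

lemma card_Aut_S3:
  assumes f: "f \<in> Ob S3"
  defines "M \<equiv> mset (map lens f)"
  shows "of_nat (card (Aut S3 f)) * of_nat (card (permutations_of_multiset M))
    = (fact (length f) * (\<Prod>l\<in>#M. lam_aut l) :: rat)"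
proof -
  interpret S3: groupoid S3 by (rule groupoid_S123)
  have Lam: "l \<in> Lam" if "l \<in># M" for l
    using that f lens_in_Lam by (auto simp: M_def Ob_S_gpd[of S2])
  let ?C = "{h. set h \<subseteq> Ob S2 \<and> mset (map lens h) = M}"
  have C: "iso_rel S3 `` {f} = ?C"
  proof -
    have "h \<noteq> []" if "mset (map lens h) = M" for h
      using that f by (auto simp: M_def Ob_S_gpd[of S2])
    then have "h \<in> iso_rel S3 `` {f} \<longleftrightarrow> h \<in> ?C" for h
      using f iso_rel_S3[OF f, of h]
      by (auto simp: Ob_S_gpd[of S2] profile_eq_iff M_def iso_rel_def)
    then show ?thesis by blast
  qed
  have od: "1 / rat_of_nat (outdeg S3 h) = 1 / fact (length f) * (\<Prod>g\<leftarrow>h. 1 / rat_of_nat (outdeg S2 g))"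
    if "h \<in> ?C" for h
  proof -
    have "length h = length f" using that by (metis (mono_tags) M_def length_map mem_Collect_eq size_mset)
    moreover have "h \<in> Ob S3" using that C S3.dom_ob by (auto simp: iso_rel_def)
    ultimately show ?thesis
      by (simp add: outdeg_S_gpd locally_finite_S123 of_nat_prod_list prod_list_inverse)
  qed
  have "1 / rat_of_nat (card (Aut S3 f)) = (\<Sum>h\<in>?C. 1 / rat_of_nat (outdeg S3 h))"
    using S3.sum_iso_class[OF locally_finite_S123(3) f] by (simp add: C)
  also have "\<dots> = (\<Sum>h\<in>?C. 1 / fact (length f) * (\<Prod>g\<leftarrow>h. 1 / rat_of_nat (outdeg S2 g)))"
    by (rule sum.cong[OF refl od])
  also have "\<dots> = 1 / fact (length f) * (\<Sum>h\<in>?C. \<Prod>g\<leftarrow>h. 1 / rat_of_nat (outdeg S2 g))"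
    by (simp add: sum_distrib_left)
  also have "(\<Sum>h\<in>?C. \<Prod>g\<leftarrow>h. 1 / rat_of_nat (outdeg S2 g))
     = of_nat (card (permutations_of_multiset M)) *
       (\<Prod>l\<in>#M. \<Sum>g | g \<in> Ob S2 \<and> lens g = l. 1 / rat_of_nat (outdeg S2 g))"
    by (rule sum_prod_mset_fibre) (rule finite_Ob_S2_fibre)
  also have "(\<Prod>l\<in>#M. \<Sum>g | g \<in> Ob S2 \<and> lens g = l. 1 / rat_of_nat (outdeg S2 g)) = (\<Prod>l\<in>#M. 1 / lam_aut l)"
    by (rule arg_cong[where f = prod_mset], rule image_mset_cong) (simp add: sum_inverse_outdeg_S2 Lam)
  also have "\<dots> = 1 / (\<Prod>l\<in>#M. lam_aut l)"
    by (induction M) auto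
  finally have e: "1 / rat_of_nat (card (Aut S3 f)) =
     1 / fact (length f) * (of_nat (card (permutations_of_multiset M)) * (1 / (\<Prod>l\<in>#M. lam_aut l)))" .
  have "(\<Prod>l\<in>#M. lam_aut l) \<noteq> 0"
    using lam_aut_pos by (induction M) (auto simp: less_le)
  moreover have "card (Aut S3 f) \<noteq> 0"
    using S3.outdeg_pos[OF f] S3.outdeg_eq[of f] locally_finite_S123(3) f by (auto simp: locally_finite_def)
  ultimately show ?thesis using e by (simp add: field_simps)
qed

lemma Ob_S_trees_fibre:
  assumes f: "f \<in> Ob S3"
  shows "{x \<in> Ob (S_gpd trees). profile lens (map compose x) = profile lens f}
    = {x. set x \<subseteq> Ob trees \<and> mset (map (\<lambda>t. lens (compose t)) x) = mset (map lens f)}"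
proof -
  have "x \<noteq> []" if "mset (map (\<lambda>t. lens (compose t)) x) = mset (map lens f)" for x
    using that f by (auto simp: Ob_S_gpd[of S2])
  then show ?thesis
    by (auto simp: Ob_S_gpd[of trees] profile_eq_iff multiset.map_comp comp_def)
qed

lemma finite_Ob_S_trees_fibre:
  assumes f: "f \<in> Ob S3"
  shows "finite {x \<in> Ob (S_gpd trees). profile lens (map compose x) = profile lens f}"
  unfolding Ob_S_trees_fibre[OF f] by (rule finite_mset_fibre) (rule finite_trees_fibre)

text \<open>All coefficients are treated at once in the convolution ring on pairs of monomials.
  There a list of trees is the product of its terms \<open>?e t\<close>, so
  \<open>sum_prod_mset_fibre\<close> factors the sum over configurations. What is left over, |Aut f|
  times the number of arrangements divided by the factorial of \<open>length f\<close>, becomes one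
  factor \<open>lam_aut l\<close> per member by \<open>card_Aut_S3\<close>.\<close>

lemma sum_S_trees_eq_prod_tree_gen:
  assumes f: "f \<in> Ob S3"
  shows "(\<Sum>x | x \<in> Ob (S_gpd trees) \<and> profile lens (map compose x) = profile lens f.
      Poly_Mapping.single (profile lens (concat (map fst x)), profile lens (map snd x))
        (of_nat (card (Aut S3 f)) / of_nat (outdeg (S_gpd trees) x)))
    = (\<Prod>l\<in>#mset (map lens f). tree_gen l)"
proof -
  let ?M = "mset (map lens f)" and ?A = "rat_of_nat (card (Aut S3 f))"
  let ?e = "\<lambda>t. Poly_Mapping.single (profile lens (fst t), Poly_Mapping.single (lens (snd t)) (1::nat))
     (1 / rat_of_nat (outdeg trees t))"
  let ?c = "\<lambda>a. Poly_Mapping.single 0 a :: A_monom \<times> A_monom \<Rightarrow>\<^sub>0 rat"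
  let ?X = "{x. set x \<subseteq> Ob trees \<and> mset (map (\<lambda>t. lens (compose t)) x) = ?M}"
  let ?P = "card (permutations_of_multiset ?M)"
  have term_eq: "Poly_Mapping.single (profile lens (concat (map fst x)), profile lens (map snd x))
        (?A / rat_of_nat (outdeg (S_gpd trees) x)) = ?c (?A / fact (length f)) * (\<Prod>t\<leftarrow>x. ?e t)"
    if x: "x \<in> ?X" for x
  proof -
    have "length x = length f" using x by (metis (mono_tags, lifting) length_map mem_Collect_eq size_mset)
    moreover have "x \<in> Ob (S_gpd trees)" using x Ob_S_trees_fibre[OF f] by blast
    ultimately have "?A / rat_of_nat (outdeg (S_gpd trees) x)
       = ?A / fact (length f) * (\<Prod>t\<leftarrow>x. 1 / rat_of_nat (outdeg trees t))"
      by (simp add: outdeg_S_gpd locally_finite_trees of_nat_prod_list prod_list_inverse)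
    moreover have "profile lens (concat (map fst x)) = (\<Sum>t\<leftarrow>x. profile lens (fst t))"
      by (simp add: profile_concat comp_def)
    moreover have "profile lens (map snd x) = (\<Sum>t\<leftarrow>x. Poly_Mapping.single (lens (snd t)) 1)"
      by (simp add: profile_def comp_def)
    ultimately show ?thesis by (simp only: prod_list_single mult_single add_0)
  qed
  have scale: "?c (?A / fact (length f)) * (of_nat ?P * X) = ?c (?A * of_nat ?P / fact (length f)) * X" for X
  proof -
    have "?c (?A / fact (length f)) * of_nat ?P = ?c (?A * of_nat ?P / fact (length f))"
      by (subst of_nat_poly_mapping, subst mult_single) simp
    then show ?thesis by (simp only: mult.assoc[symmetric])
  qed
  have gen: "tree_gen l = ?c (lam_aut l) * (\<Sum>t | t \<in> Ob trees \<and> lens (compose t) = l. ?e t)" for l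
    by (simp add: tree_gen_def sum_distrib_left mult_single)
  have "(\<Sum>x | x \<in> Ob (S_gpd trees) \<and> profile lens (map compose x) = profile lens f.
      Poly_Mapping.single (profile lens (concat (map fst x)), profile lens (map snd x))
        (?A / rat_of_nat (outdeg (S_gpd trees) x))) = (\<Sum>x\<in>?X. ?c (?A / fact (length f)) * (\<Prod>t\<leftarrow>x. ?e t))"
    unfolding Ob_S_trees_fibre[OF f] by (rule sum.cong[OF refl term_eq])
  also have "\<dots> = ?c (?A / fact (length f)) * (\<Sum>x\<in>?X. \<Prod>t\<leftarrow>x. ?e t)"
    by (simp add: sum_distrib_left)
  also have "(\<Sum>x\<in>?X. \<Prod>t\<leftarrow>x. ?e t) = of_nat ?P * (\<Prod>l\<in>#?M. \<Sum>t | t \<in> Ob trees \<and> lens (compose t) = l. ?e t)"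
    by (rule sum_prod_mset_fibre) (rule finite_trees_fibre)
  also have "?c (?A / fact (length f)) * \<dots>
     = ?c (?A * of_nat ?P / fact (length f)) * (\<Prod>l\<in>#?M. \<Sum>t | t \<in> Ob trees \<and> lens (compose t) = l. ?e t)"
    by (rule scale)
  also have "?A * of_nat ?P / fact (length f) = (\<Prod>l\<in>#?M. lam_aut l)"
    unfolding card_Aut_S3[OF f] by simp
  also have "?c (\<Prod>l\<in>#?M. lam_aut l) = (\<Prod>l\<in>#?M. ?c (lam_aut l))"
    by (rule prod_mset_single_0[symmetric])
  also have "\<dots> * (\<Prod>l\<in>#?M. \<Sum>t | t \<in> Ob trees \<and> lens (compose t) = l. ?e t) = (\<Prod>l\<in>#?M. tree_gen l)"
    by (simp only: gen prod_mset.distrib)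
  finally show ?thesis .
qed

text \<open>The degenerate configurations are the lists of copies of \<open>[[()]]\<close>, and
  \<open>[[()]]\<close> has the exponent of the variable x_1. If all n members of f have this
  exponent, there is one object of \<open>S1\<close> over f, and |Aut f| and its outdegree are both
  n!, so the quotient is 1. Otherwise the fibre is empty.\<close>

lemma hcard_unit_fibre:
  assumes f: "f \<in> Ob S3"
  shows "hcard (hofib S1 S3 (S_fun (gcomp S_unit S_unit)) f)
    = (\<Prod>l\<in>#mset (map lens f). if l = Poly_Mapping.single 1 1 then 1 else 0)"
proof -
  let ?F = "S_fun (gcomp S_unit S_unit) :: (unit list, (nat \<times> unit) list, _, _) gfun"
  let ?u = "Poly_Mapping.single 1 1 :: nat \<Rightarrow>\<^sub>0 nat" and ?M = "mset (map lens f)"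
  have su: "gfunctor A (S_gpd A) S_unit" if "groupoid A" for A :: "('a, 'b) gpd"
  proof -
    interpret A: groupoid A by fact
    interpret SA: groupoid "S_gpd A" by (rule groupoid_S_gpd) fact
    show ?thesis by unfold_locales (auto simp: S_unit_def S_gpd_def)
  qed
  interpret F: gfunctor S1 S3 ?F
    by (intro gfunctor_S_fun gfunctor_gcomp[OF su su] groupoid_terminal_gpd groupoid_S123)
  have Fo: "Fo ?F x = replicate (length x) [[()]]" for x
    by (induction x) (auto simp: S_fun_def gcomp_def S_unit_def)
  have iso: "(Fo ?F x, f) \<in> iso_rel S3 \<longleftrightarrow> ?M = replicate_mset (length x) ?u" if "x \<in> Ob S1" for x
    using iso_rel_S3[OF F.fo_ob[OF that] f]
    by (auto simp: Fo profile_eq_iff)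
  have set_eq: "{x \<in> Ob S1. (Fo ?F x, f) \<in> iso_rel S3}
     = (if ?M = replicate_mset (length f) ?u then {replicate (length f) ()} else {})"
  proof -
    have "f \<noteq> []" using f by (simp add: Ob_S_gpd)
    have "length x = length f" if "?M = replicate_mset (length x) ?u" for x :: "unit list"
      using arg_cong[OF that, of size] by simp
    moreover have "x = replicate (length f) ()" if "length x = length f" for x :: "unit list"
      using that unit_lists_length[of "length f"] by blast
    ultimately have "x \<in> Ob S1 \<and> (Fo ?F x, f) \<in> iso_rel S3 \<longleftrightarrow>
       ?M = replicate_mset (length f) ?u \<and> x = replicate (length f) ()" for x
      using iso[of x] \<open>f \<noteq> []\<close> by (auto simp: Ob_S1)
    then show ?thesis by auto
  qed
  have h: "hcard (hofib S1 S3 ?F f) = of_nat (card (Aut S3 f)) *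
     (\<Sum>x | x \<in> Ob S1 \<and> (Fo ?F x, f) \<in> iso_rel S3. 1 / of_nat (outdeg S1 x))"
    by (rule F.hcard_hofib) (simp_all only: locally_finite_S123 set_eq split: if_split, simp)
  show ?thesis
  proof (cases "?M = replicate_mset (length f) ?u")
    case True
    have lu: "lam_aut ?u = 1" by (simp add: lam_aut_def)
    have "card (permutations_of_multiset (replicate_mset (length f) ?u)) = 1"
      using f by (simp add: card_permutations_of_multiset Ob_S_gpd)
    moreover have "(\<Prod>l\<in>#replicate_mset (length f) ?u. lam_aut l) = 1"
      by (simp only: image_replicate_mset prod_mset_replicate_mset lu power_one)
    ultimately have "rat_of_nat (card (Aut S3 f)) = fact (length f)"
      using card_Aut_S3[OF f] by (simp only: True of_nat_1 mult_1_right)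
    moreover have "outdeg S1 (replicate (length f) ()) = fact (length f)"
      using f by (subst outdeg_S1) (auto simp: Ob_S1 Ob_S_gpd)
    ultimately show ?thesis
      unfolding h set_eq by (simp only: True) (simp add: prod_mset_replicate_mset)
  next
    case False
    have "\<exists>l. l \<in># ?M \<and> l \<noteq> ?u"
    proof (rule ccontr)
      assume "\<nexists>l. l \<in># ?M \<and> l \<noteq> ?u"
      then have "set_mset ?M \<subseteq> {?u}" by auto
      then have "?M = replicate_mset (size ?M) ?u"
        by (metis set_mset_subset_singletonD)
      with False show False by simp
    qed
    then obtain l N where "?M = add_mset l N" "l \<noteq> ?u" by (metis mset_add)
    then show ?thesis unfolding h set_eq using False by simp
  qed
qed

section \<open>Plethysm as a sum over trees\<close>

lemma lookup_vscale [simp]: "Poly_Mapping.lookup (vscale c v) k = c * Poly_Mapping.lookup v k"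
  by (simp add: vscale_def map.rep_eq when_def)

lemma lin_form_superset:
  assumes "finite S" "Poly_Mapping.keys v \<subseteq> S"
  shows "lin_form g v = (\<Sum>b\<in>S. Poly_Mapping.lookup v b * g b)"
  unfolding lin_form_def using assms by (intro sum.mono_neutral_left) (auto simp: in_keys_iff)

lemma lin_form_0 [simp]: "lin_form g 0 = 0"
  by (simp add: lin_form_def)

lemma lin_form_add: "lin_form g (v + w) = lin_form g v + lin_form g w"
proof -
  let ?S = "Poly_Mapping.keys v \<union> Poly_Mapping.keys w"
  have "Poly_Mapping.keys (v + w) \<subseteq> ?S" by (rule Poly_Mapping.keys_add)
  then show ?thesis
    by (subst (1 2 3) lin_form_superset[of ?S]) (auto simp: lookup_add algebra_simps sum.distrib)
qed

lemma lin_form_sum: "lin_form g (\<Sum>i\<in>A. v i) = (\<Sum>i\<in>A. lin_form g (v i))"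
  by (induction A rule: infinite_finite_induct) (auto simp: lin_form_add)

lemma lin_form_single [simp]: "lin_form g (Poly_Mapping.single b c) = c * g b"
  by (simp add: lin_form_def)

lemma mset_of_pm_simps [simp]:
  "mset_of_pm 0 = {#}" "mset_of_pm (p + q) = mset_of_pm p + mset_of_pm q"
  "mset_of_pm (Poly_Mapping.single i n) = replicate_mset n i"
  by (rule multiset_eqI; simp add: lookup_add lookup_single when_def)+

lemma monom_eval_eq: "monom_eval m F = (\<Prod>l\<in>#mset_of_pm m. A_coeff l F)"
  by (simp add: monom_eval_def prod_mset_of_pm)

lemma monom_eval_profile: "monom_eval (profile iv xs) F = (\<Prod>x\<leftarrow>xs. A_coeff (iv x) F)"
  by (simp add: monom_eval_eq multiset.map_comp comp_def prod_mset_prod_list flip: mset_map)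

text \<open>\<open>A_coeff\<close> carries the factor \<open>lam_aut\<close>, and the sum of 1/d
  over the lists g of one type removes it (\<open>sum_inverse_outdeg_S2\<close>), which leaves the
  plain coefficient of F. The scaled lengths account for the change of variables.\<close>

lemma series_dilate_coeff:
  assumes F: "F \<in> series_plus" and k: "k > 0"
  shows "finite {g \<in> Ob S2. profile (\<lambda>y. k * length y) g = \<alpha>}"
    and "series_coeff (series_dilate k F) \<alpha>
      = (\<Sum>g | g \<in> Ob S2 \<and> profile (\<lambda>y. k * length y) g = \<alpha>. A_coeff (lens g) F / of_nat (outdeg S2 g))"
proof -
  have inj: "inj (\<lambda>i. k * i)" using k by (auto simp: inj_def)
  let ?l = "Poly_Mapping.map_key (\<lambda>i. k * i) \<alpha>"
  have keys_dvd: "\<forall>j\<in>Poly_Mapping.keys \<alpha>. k dvd j" if "profile (\<lambda>y :: unit list. k * length y) g = \<alpha>" for g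
    unfolding that[symmetric] keys_profile by auto
  have lk: "Poly_Mapping.lookup (profile (\<lambda>y :: unit list. k * length y) g) (k * i) = Poly_Mapping.lookup (lens g) i" for g i
    using k by (induction g) (auto simp: lookup_add lookup_single when_def)
  \<comment> \<open>Pulling an exponent back along multiplication by k undoes the scaling of
    lengths, provided that only multiples of k occur in \<alpha>.\<close>
  have eq: "profile (\<lambda>y. k * length y) g = \<alpha> \<longleftrightarrow> (\<forall>j\<in>Poly_Mapping.keys \<alpha>. k dvd j) \<and> lens g = ?l" for g
  proof
    assume a: "profile (\<lambda>y. k * length y) g = \<alpha>"
    have "lens g = ?l"
      by (rule poly_mapping_eqI) (simp add: map_key.rep_eq[OF inj] a[symmetric] lk)
    with keys_dvd[OF a] show "(\<forall>j\<in>Poly_Mapping.keys \<alpha>. k dvd j) \<and> lens g = ?l" by blast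
  next
    assume a: "(\<forall>j\<in>Poly_Mapping.keys \<alpha>. k dvd j) \<and> lens g = ?l"
    show "profile (\<lambda>y. k * length y) g = \<alpha>"
    proof (rule poly_mapping_eqI)
      fix j
      show "Poly_Mapping.lookup (profile (\<lambda>y. k * length y) g) j = Poly_Mapping.lookup \<alpha> j"
      proof (cases "k dvd j")
        case True
        then obtain i where "j = k * i" by (auto elim: dvdE)
        then show ?thesis using a by (simp add: lk map_key.rep_eq[OF inj])
      next
        case False
        then have "j \<notin> Poly_Mapping.keys \<alpha>" "j \<notin> Poly_Mapping.keys (profile (\<lambda>y. k * length y) g)"
          using a by (auto simp: keys_profile)
        then show ?thesis by (simp add: in_keys_iff)
      qed
    qed
  qed
  show "finite {g \<in> Ob S2. profile (\<lambda>y. k * length y) g = \<alpha>}"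
    unfolding eq by (rule finite_subset[OF _ finite_Ob_S2_fibre[of ?l]]) blast
  show "series_coeff (series_dilate k F) \<alpha>
      = (\<Sum>g | g \<in> Ob S2 \<and> profile (\<lambda>y. k * length y) g = \<alpha>. A_coeff (lens g) F / of_nat (outdeg S2 g))"
  proof (cases "\<forall>j\<in>Poly_Mapping.keys \<alpha>. k dvd j")
    case True
    have "(\<Sum>g | g \<in> Ob S2 \<and> profile (\<lambda>y. k * length y) g = \<alpha>. A_coeff (lens g) F / of_nat (outdeg S2 g))
        = (\<Sum>g | g \<in> Ob S2 \<and> lens g = ?l. A_coeff ?l F * (1 / of_nat (outdeg S2 g)))"
      by (rule sum.cong) (use True eq in auto)
    also have "\<dots> = A_coeff ?l F * (\<Sum>g | g \<in> Ob S2 \<and> lens g = ?l. 1 / of_nat (outdeg S2 g))"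
      by (simp only: sum_distrib_left)
    also have "\<dots> = series_coeff F ?l"
    proof (cases "?l \<in> Lam")
      case True
      then show ?thesis using lam_aut_pos[of ?l] by (simp add: sum_inverse_outdeg_S2 A_coeff_def)
    next
      case False
      then have "series_coeff F ?l = 0" using F by (auto simp: series_plus_def)
      then show ?thesis by (simp add: A_coeff_def)
    qed
    finally show ?thesis using True by (simp add: series_dilate_def)
  next
    case False
    then have "{g. g \<in> Ob S2 \<and> profile (\<lambda>y. k * length y) g = \<alpha>} = {}" using eq by blast
    then show ?thesis using False by (simp only: series_dilate_def series_coeff_Series if_False sum.empty)
  qed
qed

text \<open>The top levels that complete the root \<open>f\<close> to a tree whose composite has exponent \<open>\<gamma>\<close>.\<close>

definition tops :: "unit list list \<Rightarrow> (nat \<Rightarrow>\<^sub>0 nat) \<Rightarrow> unit list list list set" where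
  "tops f \<gamma> = {gs. set gs \<subseteq> Ob S2 \<and> length gs = length f
      \<and> (\<Sum>(g, x)\<leftarrow>zip gs f. profile (\<lambda>y. length x * length y) g) = \<gamma>}"

text \<open>Separating the first member of the top level from the rest matches the splittings
  \<gamma> = \<alpha> + \<beta> in the product of series, so the claim follows by induction on the
  root.\<close>

lemma sum_tops:
  assumes F: "F \<in> series_plus" and f: "set f \<subseteq> {x. x \<noteq> []}"
  shows "finite (tops f \<gamma>) \<and> (\<Sum>gs\<in>tops f \<gamma>. \<Prod>g\<leftarrow>gs. A_coeff (lens g) F / of_nat (outdeg S2 g))
    = series_coeff (\<Prod>x\<leftarrow>f. series_dilate (length x) F) \<gamma>"
  using f
proof (induction f arbitrary: \<gamma>)
  case Nil
  have "tops [] \<gamma> = (if \<gamma> = 0 then {[]} else {})" by (auto simp: tops_def)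
  then show ?case by (simp add: one_series_def)
next
  case (Cons x f)
  let ?w = "\<lambda>g. A_coeff (lens g) F / rat_of_nat (outdeg S2 g)"
  let ?Y = "\<lambda>\<alpha>. {g \<in> Ob S2. profile (\<lambda>y. length x * length y) g = \<alpha>}"
  let ?P = "{(\<alpha>, \<beta>). \<alpha> + \<beta> = \<gamma>}"
  have x: "length x > 0" using Cons.prems by simp
  note Y = series_dilate_coeff[OF F x]
  have IH: "finite (tops f \<beta>)" "(\<Sum>gs\<in>tops f \<beta>. \<Prod>g\<leftarrow>gs. ?w g)
      = series_coeff (\<Prod>x\<leftarrow>f. series_dilate (length x) F) \<beta>" for \<beta>
    using Cons by auto
  let ?Z = "SIGMA p:?P. ?Y (fst p) \<times> tops f (snd p)"
  let ?c = "\<lambda>(p :: (nat \<Rightarrow>\<^sub>0 nat) \<times> (nat \<Rightarrow>\<^sub>0 nat), g :: unit list list, gs). g # gs"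
  have finZ: "finite ?Z" using finite_exponent_splits Y(1) IH(1) by (intro finite_SigmaI finite_cartesian_product) auto
  have im: "tops (x # f) \<gamma> = ?c ` ?Z"
  proof (intro equalityI subsetI)
    fix hs assume h: "hs \<in> tops (x # f) \<gamma>"
    then obtain g gs where hs: "hs = g # gs" by (cases hs) (auto simp: tops_def)
    let ?p = "(profile (\<lambda>y. length x * length y) g, \<Sum>(g, x)\<leftarrow>zip gs f. profile (\<lambda>y. length x * length y) g)"
    have "(?p, g, gs) \<in> ?Z" using h by (auto simp: tops_def hs)
    then show "hs \<in> ?c ` ?Z" unfolding hs by (rule rev_image_eqI) simp
  qed (auto simp: tops_def)
  have inj: "inj_on ?c ?Z" by (auto simp: inj_on_def tops_def)
  have "(\<Sum>gs\<in>tops (x # f) \<gamma>. \<Prod>g\<leftarrow>gs. ?w g) = (\<Sum>(p, g, gs)\<in>?Z. ?w g * (\<Prod>g\<leftarrow>gs. ?w g))"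
    unfolding im sum.reindex[OF inj] by (rule sum.cong) auto
  also have "\<dots> = (\<Sum>p\<in>?P. \<Sum>(g, gs)\<in>?Y (fst p) \<times> tops f (snd p). ?w g * (\<Prod>g\<leftarrow>gs. ?w g))"
    by (rule sum.Sigma[symmetric]) (use finite_exponent_splits Y(1) IH(1) in auto)
  also have "\<dots> = (\<Sum>p\<in>?P. (\<Sum>g\<in>?Y (fst p). ?w g) * (\<Sum>gs\<in>tops f (snd p). \<Prod>g\<leftarrow>gs. ?w g))"
    by (simp only: sum_product sum.cartesian_product)
  also have "\<dots> = series_coeff (\<Prod>x\<leftarrow>x # f. series_dilate (length x) F) \<gamma>"
    by (simp add: times_series_def Y(2) IH(2) case_prod_unfold)
  finally show ?case unfolding im using finZ by simp
qed

text \<open>If there were no such list, the sum in \<open>sum_inverse_outdeg_S2\<close> would be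
  empty, but its value is positive.\<close>

lemma ex_lens_eq: "l \<in> Lam \<Longrightarrow> \<exists>f\<in>Ob S2. lens f = l"
  using sum_inverse_outdeg_S2[of l] lam_aut_pos[of l]
  by (metis (mono_tags, lifting) empty_Collect_eq sum.empty zero_less_divide_1_iff less_irrefl)

lemma trees_fibre_eq:
  "{t \<in> Ob trees. lens (compose t) = l} = (\<lambda>(f, gs). (gs, f)) ` (SIGMA f:Ob S2. tops f l)"
proof -
  have "(gs, f) \<in> Ob trees \<and> lens (compose (gs, f)) = l \<longleftrightarrow> f \<in> Ob S2 \<and> gs \<in> tops f l" for gs f
  proof -
    have "gs \<noteq> []" if "f \<in> Ob S2" "length gs = length f" using that by (auto simp: Ob_S_gpd)
    then have "f \<in> Ob S2 \<Longrightarrow> length gs = length f \<Longrightarrow> gs \<in> Ob S3 \<longleftrightarrow> set gs \<subseteq> Ob S2"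
      by (simp only: Ob_S_gpd[of S2]) blast
    then show ?thesis by (auto simp: Ob_trees tops_def lens_compose)
  qed
  then have "t \<in> Ob trees \<and> lens (compose t) = l \<longleftrightarrow> snd t \<in> Ob S2 \<and> fst t \<in> tops (snd t) l" for t
    by (metis prod.collapse)
  then show ?thesis by (force simp: image_iff)
qed

text \<open>Sum over the top levels first: for a root f they give the coefficient at l of the
  product of the powers of F_k prescribed by \<mu> = \<open>lens f\<close>. Then the roots of type
  \<mu> have total weight 1 / \<open>lam_aut \<mu>\<close>, which turns
  \<open>A_coeff \<mu> G\<close> into the plain coefficient of G and leaves the definition of
  plethysm.\<close>

lemma tensor_eval_tree_gen:
  assumes F: "F \<in> series_plus" and G: "G \<in> series_plus"
  shows "tensor_eval (tree_gen l) F G = A_coeff l (plethysm G F)"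
proof -
  let ?w = "\<lambda>g. A_coeff (lens g) F / rat_of_nat (outdeg S2 g)"
  let ?Tr = "{t \<in> Ob trees. lens (compose t) = l}"
  let ?v = "\<lambda>f. A_coeff (lens f) G / rat_of_nat (outdeg S2 f)"
  define R where "R \<mu> = series_coeff (\<Prod>k\<in>Poly_Mapping.keys \<mu>. series_dilate k F ^ Poly_Mapping.lookup \<mu> k) l" for \<mu>
  have tops: "finite (tops f l)" "(\<Sum>gs\<in>tops f l. \<Prod>g\<leftarrow>gs. ?w g) = R (lens f)" if "f \<in> Ob S2" for f
  proof -
    have ne: "set f \<subseteq> {x. x \<noteq> []}" using that by (simp add: Ob_S_gpd[of S1] Ob_S1)
    show "finite (tops f l)" using sum_tops[OF F ne] by blast
    have "(\<Prod>x\<leftarrow>f. series_dilate (length x) F) = (\<Prod>k\<in>Poly_Mapping.keys (lens f). series_dilate k F ^ Poly_Mapping.lookup (lens f) k)"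
      by (simp add: prod_mset_of_pm[symmetric] multiset.map_comp comp_def prod_mset_prod_list flip: mset_map)
    then show "(\<Sum>gs\<in>tops f l. \<Prod>g\<leftarrow>gs. ?w g) = R (lens f)"
      using sum_tops[OF F ne, of l] by (simp add: R_def)
  qed
  \<comment> \<open>Only finitely many roots admit a top level. \<open>Fs'\<close> enlarges this set
    to all roots of the same types, so that the grouping by \<mu> below runs over complete fibres of
    \<open>lens\<close>.\<close>
  define Fs where "Fs = {f \<in> Ob S2. tops f l \<noteq> {}}"
  have "Fs = snd ` ?Tr" unfolding trees_fibre_eq Fs_def by (auto simp: image_iff)
  then have finFs: "finite Fs" using finite_trees_fibre by simp
  define Fs' where "Fs' = {f \<in> Ob S2. lens f \<in> lens ` Fs}"
  have "Fs' = (\<Union>\<mu>\<in>lens ` Fs. {f \<in> Ob S2. lens f = \<mu>})" by (auto simp: Fs'_def)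
  then have finFs': "finite Fs'" using finFs finite_Ob_S2_fibre by simp
  have inj: "inj_on (\<lambda>(f, gs). (gs, f)) A" for A :: "(unit list list \<times> unit list list list) set" by (auto simp: inj_on_def)
  have sub: "Fs \<subseteq> Fs'" by (auto simp: Fs_def Fs'_def)
  have Sig: "(SIGMA f:Ob S2. tops f l) = (SIGMA f:Fs'. tops f l)"
    using sub by (auto simp: Fs_def Fs'_def)
  have "tensor_eval (tree_gen l) F G
     = (\<Sum>t\<in>?Tr. lam_aut l / of_nat (outdeg trees t) * (monom_eval (profile lens (fst t)) F * A_coeff (lens (snd t)) G))"
    by (simp add: tensor_eval_def tree_gen_def lin_form_sum monom_eval_eq[of "Poly_Mapping.single _ _"])
  also have "\<dots> = (\<Sum>t\<in>?Tr. lam_aut l * (?v (snd t) * (\<Prod>g\<leftarrow>fst t. ?w g)))"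
  proof (rule sum.cong[OF refl])
    fix t assume t: "t \<in> ?Tr"
    then have o: "rat_of_nat (outdeg trees t) = of_nat (outdeg S2 (snd t)) * (\<Prod>g\<leftarrow>fst t. of_nat (outdeg S2 g))"
      using outdeg_trees(1)[of "fst t" "snd t"] by (simp add: of_nat_prod_list)
    have "(\<Prod>g\<leftarrow>gs. ?w g) = (\<Prod>g\<leftarrow>gs. A_coeff (lens g) F) / (\<Prod>g\<leftarrow>gs. of_nat (outdeg S2 g))" for gs
      by (induction gs) auto
    then show "lam_aut l / of_nat (outdeg trees t) * (monom_eval (profile lens (fst t)) F * A_coeff (lens (snd t)) G)
       = lam_aut l * (?v (snd t) * (\<Prod>g\<leftarrow>fst t. ?w g))"
      by (simp add: o monom_eval_profile)
  qed
  also have "\<dots> = lam_aut l * (\<Sum>t\<in>?Tr. ?v (snd t) * (\<Prod>g\<leftarrow>fst t. ?w g))"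
    by (simp only: sum_distrib_left)
  also have "(\<Sum>t\<in>?Tr. ?v (snd t) * (\<Prod>g\<leftarrow>fst t. ?w g)) = (\<Sum>(f, gs)\<in>(SIGMA f:Fs'. tops f l). ?v f * (\<Prod>g\<leftarrow>gs. ?w g))"
    unfolding trees_fibre_eq sum.reindex[OF inj] Sig by (rule sum.cong) auto
  also have "\<dots> = (\<Sum>f\<in>Fs'. \<Sum>gs\<in>tops f l. ?v f * (\<Prod>g\<leftarrow>gs. ?w g))"
    by (rule sum.Sigma[symmetric]) (use finFs' tops in \<open>auto simp: Fs'_def\<close>)
  also have "\<dots> = (\<Sum>f\<in>Fs'. ?v f * R (lens f))"
  proof (rule sum.cong[OF refl])
    fix f assume "f \<in> Fs'"
    then have "f \<in> Ob S2" by (simp add: Fs'_def)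
    then show "(\<Sum>gs\<in>tops f l. ?v f * (\<Prod>g\<leftarrow>gs. ?w g)) = ?v f * R (lens f)"
      by (simp only: sum_distrib_left[symmetric] tops(2))
  qed
  also have "\<dots> = (\<Sum>\<mu>\<in>lens ` Fs'. \<Sum>f | f \<in> Fs' \<and> lens f = \<mu>. ?v f * R (lens f))"
    by (rule sum.image_gen[OF finFs'])
  also have "\<dots> = (\<Sum>\<mu>\<in>lens ` Fs'. series_coeff G \<mu> * R \<mu>)"
  proof (rule sum.cong[OF refl])
    fix \<mu> assume m: "\<mu> \<in> lens ` Fs'"
    then have L: "\<mu> \<in> Lam" using lens_in_Lam by (auto simp: Fs'_def)
    have "(\<Sum>f | f \<in> Fs' \<and> lens f = \<mu>. ?v f * R (lens f))
       = (\<Sum>f | f \<in> Ob S2 \<and> lens f = \<mu>. A_coeff \<mu> G * R \<mu> * (1 / rat_of_nat (outdeg S2 f)))"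
      by (rule sum.cong) (use m in \<open>auto simp: Fs'_def\<close>)
    also have "\<dots> = A_coeff \<mu> G * R \<mu> * (1 / lam_aut \<mu>)"
      by (simp only: sum_distrib_left[symmetric] sum_inverse_outdeg_S2[OF L])
    also have "\<dots> = series_coeff G \<mu> * R \<mu>"
      using lam_aut_pos[of \<mu>] by (simp add: A_coeff_def)
    finally show "(\<Sum>f | f \<in> Fs' \<and> lens f = \<mu>. ?v f * R (lens f)) = series_coeff G \<mu> * R \<mu>" .
  qed
  also have "\<dots> = Sum_any (\<lambda>\<mu>. series_coeff G \<mu> * R \<mu>)"
  proof (rule Sum_any.expand_superset[symmetric])
    show "finite (lens ` Fs')" using finFs' by simp
    \<comment> \<open>If R \<mu> is nonzero, a root of type \<mu> has some top level, because the
      empty sum is 0.\<close>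
    show "{\<mu>. series_coeff G \<mu> * R \<mu> \<noteq> 0} \<subseteq> lens ` Fs'"
    proof safe
      fix \<mu> assume nz: "series_coeff G \<mu> * R \<mu> \<noteq> 0"
      then have "\<mu> \<in> Lam" using G by (auto simp: series_plus_def)
      then obtain f where f: "f \<in> Ob S2" "lens f = \<mu>" using ex_lens_eq by blast
      have "tops f l \<noteq> {}" using tops(2)[OF f(1)] nz f(2) by auto
      then have "f \<in> Fs'" using f sub by (auto simp: Fs_def)
      then show "\<mu> \<in> lens ` Fs'" using f by blast
    qed
  qed
  also have "lam_aut l * \<dots> = A_coeff l (plethysm G F)"
    by (simp add: A_coeff_def plethysm_def R_def)
  finally show ?thesis .
qed

section \<open>Independence of characters and uniqueness of the comultiplication\<close>

lemma characters_independent: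
  fixes \<chi> :: "'i \<Rightarrow> 'p \<Rightarrow> 'k::idom"
  assumes "finite S"
    and "\<And>i p q. i \<in> S \<Longrightarrow> \<chi> i (m p q) = \<chi> i p * \<chi> i q"
    and "\<And>i. i \<in> S \<Longrightarrow> \<chi> i e = 1"
    and "\<And>i j. i \<in> S \<Longrightarrow> j \<in> S \<Longrightarrow> i \<noteq> j \<Longrightarrow> \<exists>p. \<chi> i p \<noteq> \<chi> j p"
    and "\<And>p. (\<Sum>i\<in>S. c i * \<chi> i p) = 0"
  shows "\<forall>i\<in>S. c i = 0"
  using assms
proof (induction S arbitrary: c)
  case (insert a S)
  \<comment> \<open>Dedekind's argument: \<open>\<chi> a q\<close> times the relation at \<open>p\<close>, subtracted from the relation at \<open>m q p\<close>, eliminates \<open>a\<close>.\<close>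
  have "\<forall>i\<in>S. c i * (\<chi> i q - \<chi> a q) = 0" for q
  proof (rule insert.IH)
    fix p
    have "(\<Sum>i\<in>S. c i * (\<chi> i q - \<chi> a q) * \<chi> i p) = (\<Sum>i\<in>insert a S. c i * (\<chi> i q - \<chi> a q) * \<chi> i p)"
      using insert.hyps by simp
    also have "\<dots> = (\<Sum>i\<in>insert a S. c i * \<chi> i (m q p)) - \<chi> a q * (\<Sum>i\<in>insert a S. c i * \<chi> i p)"
      unfolding sum_distrib_left sum_subtractf[symmetric]
      by (rule sum.cong) (auto simp: insert.prems(1) algebra_simps)
    also have "\<dots> = 0" by (simp only: insert.prems(4)) simp
    finally show "(\<Sum>i\<in>S. c i * (\<chi> i q - \<chi> a q) * \<chi> i p) = 0" .
  qed (use insert.prems in auto)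
  then have S: "c i = 0" if "i \<in> S" for i
    using that insert.prems(3)[of i a] insert.hyps(2) by force
  have "c a * \<chi> a e = 0"
    using insert.prems(4)[of e] insert.hyps S by (simp add: sum.neutral)
  then show ?case using S insert.prems(2)[of a] by auto
qed simp

text \<open>Evaluation of a pair of monomials is multiplicative when the coordinates of F and of G
  are multiplied pointwise, so pairs of monomials are characters. They are separated by the families
  with value 2 at one index and 1 elsewhere, where a monomial takes the value 2 to the power of its
  exponent at that index. This is the uniqueness behind the \<open>THE\<close> in
  \<open>plethystic_comult_gen\<close>.\<close>

lemma tensor_eval_eqD:
  assumes t: "t \<in> free_space (A_monoms \<times> A_monoms)" and t': "t' \<in> free_space (A_monoms \<times> A_monoms)"
    and eq: "\<And>F G. F \<in> series_plus \<Longrightarrow> G \<in> series_plus \<Longrightarrow> tensor_eval t F G = tensor_eval t' F G"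
  shows "t = t'"
proof -
  let ?S = "Poly_Mapping.keys t \<union> Poly_Mapping.keys t'"
  define ev where "ev m u = (\<Prod>l\<in>#mset_of_pm m. u l)" for m :: A_monom and u :: "(nat \<Rightarrow>\<^sub>0 nat) \<Rightarrow> rat"
  let ?\<chi> = "\<lambda>i p. ev (fst i) (fst p) * ev (snd i) (snd p)"
  let ?m = "\<lambda>p q. (\<lambda>l. fst p l * fst q l :: rat, \<lambda>l. snd p l * snd q l :: rat)"
  have S: "m \<in> A_monoms \<and> n \<in> A_monoms" if "(m, n) \<in> ?S" for m n
    using that t t' by (auto simp: free_space_def)
  have ev1: "ev m (\<lambda>_. 1) = 1" for m by (simp add: ev_def)
  have ev_mult: "ev m (\<lambda>l. u l * v l) = ev m u * ev m v" for m u v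
    by (simp add: ev_def prod_mset.distrib)
  have ev2: "ev m (\<lambda>x. if x = l then 2 else 1) = 2 ^ Poly_Mapping.lookup m l" for m l
  proof -
    have "(\<Prod>x\<in>#M. if x = l then 2 else 1 :: rat) = 2 ^ count M l" for M
      by (induction M) auto
    then show ?thesis by (simp add: ev_def)
  qed
  \<comment> \<open>The values of \<open>A_coeff\<close> on \<open>Lam\<close> can be prescribed
    freely: \<open>ser u\<close> realises the family u.\<close>
  define ser where "ser u = Series (\<lambda>\<alpha>. if \<alpha> \<in> Lam then u \<alpha> / lam_aut \<alpha> else 0)" for u :: "(nat \<Rightarrow>\<^sub>0 nat) \<Rightarrow> rat"
  have ser: "ser u \<in> series_plus" for u by (simp add: ser_def series_plus_def)
  have A_ser: "A_coeff l (ser u) = u l" if "l \<in> Lam" for l u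
    using that lam_aut_pos[of l] by (simp add: A_coeff_def ser_def)
  have mev: "monom_eval m (ser u) = ev m u" if "m \<in> A_monoms" for m u
    unfolding monom_eval_eq ev_def
    by (rule arg_cong[where f = prod_mset], rule image_mset_cong) (use that A_ser in \<open>auto simp: A_monoms_def\<close>)
  have "\<forall>i\<in>?S. Poly_Mapping.lookup t i - Poly_Mapping.lookup t' i = 0"
  proof (rule characters_independent[where \<chi> = ?\<chi> and m = ?m and e = "(\<lambda>_. 1, \<lambda>_. 1)"])
    fix p :: "((nat \<Rightarrow>\<^sub>0 nat) \<Rightarrow> rat) \<times> ((nat \<Rightarrow>\<^sub>0 nat) \<Rightarrow> rat)"
    have *: "tensor_eval v (ser (fst p)) (ser (snd p)) = (\<Sum>i\<in>?S. Poly_Mapping.lookup v i * ?\<chi> i p)"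
      if "Poly_Mapping.keys v \<subseteq> ?S" for v
      unfolding tensor_eval_def lin_form_superset[OF _ that, simplified]
    proof (rule sum.cong[OF refl])
      fix i assume "i \<in> ?S"
      then have "fst i \<in> A_monoms" "snd i \<in> A_monoms" using S[of "fst i" "snd i"] by simp_all
      then show "Poly_Mapping.lookup v i * (case i of (m, n) \<Rightarrow> monom_eval m (ser (fst p)) * monom_eval n (ser (snd p)))
          = Poly_Mapping.lookup v i * ?\<chi> i p"
        by (simp add: case_prod_unfold mev)
    qed
    show "(\<Sum>i\<in>?S. (Poly_Mapping.lookup t i - Poly_Mapping.lookup t' i) * ?\<chi> i p) = 0"
      using eq[OF ser ser, of "fst p" "snd p"] *[of t] *[of t']
      by (simp add: left_diff_distrib sum_subtractf)
  next
    fix i j assume "i \<in> ?S" "j \<in> ?S" "i \<noteq> j"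
    then consider l where "Poly_Mapping.lookup (fst i) l \<noteq> Poly_Mapping.lookup (fst j) l"
      | l where "Poly_Mapping.lookup (snd i) l \<noteq> Poly_Mapping.lookup (snd j) l"
      by (metis poly_mapping_eqI prod_eqI)
    then show "\<exists>p. ?\<chi> i p \<noteq> ?\<chi> j p"
    proof cases
      case 1
      then show ?thesis by (intro exI[of _ "(\<lambda>x. if x = l then 2 else 1, \<lambda>_. 1)"]) (simp add: ev1 ev2)
    next
      case 2
      then show ?thesis by (intro exI[of _ "(\<lambda>_. 1, \<lambda>x. if x = l then 2 else 1)"]) (simp add: ev1 ev2)
    qed
  qed (simp_all add: ev1 ev_mult)
  then have all: "Poly_Mapping.lookup t i = Poly_Mapping.lookup t' i" if "i \<in> ?S" for i
    using that by simp
  show ?thesis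
  proof (rule poly_mapping_eqI)
    fix i
    show "Poly_Mapping.lookup t i = Poly_Mapping.lookup t' i"
    proof (cases "i \<in> ?S")
      case False
      then have "Poly_Mapping.lookup t i = 0" "Poly_Mapping.lookup t' i = 0" by (simp_all add: in_keys_iff)
      then show ?thesis by simp
    qed (rule all)
  qed
qed

lemma tree_gen_free_space: "tree_gen l \<in> free_space (A_monoms \<times> A_monoms)"
proof -
  have "Poly_Mapping.keys (\<Sum>t\<in>T. Poly_Mapping.single (a t) (c t :: rat)) \<subseteq> a ` T" if "finite T" for T a c
    using that by (induction T) (auto dest!: subsetD[OF Poly_Mapping.keys_add] split: if_splits)
  from this[OF finite_trees_fibre]
  have "Poly_Mapping.keys (tree_gen l) \<subseteq>
     (\<lambda>t. (profile lens (fst t), Poly_Mapping.single (lens (snd t)) 1)) ` {t \<in> Ob trees. lens (compose t) = l}"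
    unfolding tree_gen_def .
  also have "\<dots> \<subseteq> A_monoms \<times> A_monoms"
    by (auto simp: A_monoms_def keys_profile Ob_trees Ob_S_gpd[of S2] intro!: lens_in_Lam)
  finally show ?thesis by (simp add: free_space_def)
qed

text \<open>Existence is the expansion of plethysm over trees; uniqueness is
  \<open>tensor_eval_eqD\<close>.\<close>

lemma plethystic_comult_gen_eq: "plethystic_comult_gen l = tree_gen l"
  unfolding plethystic_comult_gen_def
proof (rule the_equality)
  show "tree_gen l \<in> free_space (A_monoms \<times> A_monoms) \<and>
    (\<forall>F\<in>series_plus. \<forall>G\<in>series_plus. tensor_eval (tree_gen l) F G = A_coeff l (plethysm G F))"
    using tree_gen_free_space tensor_eval_tree_gen by blast
qed (use tree_gen_free_space tensor_eval_tree_gen in \<open>auto intro: tensor_eval_eqD\<close>)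

section \<open>The isomorphism\<close>

lemma vscale_simps [simp]:
  "vscale c (Poly_Mapping.single b d) = Poly_Mapping.single b (c * d)" "vscale c 0 = 0"
  "vscale 0 v = 0" "vscale 1 v = v"
  "vscale c (vscale d v) = vscale (c * d) v"
  by (rule poly_mapping_eqI; simp add: lookup_single when_def)+

lemma vscale_add: "vscale c (v + w) = vscale c v + vscale c w"
  and vscale_add_left: "vscale (c + d) v = vscale c v + vscale d v"
  by (rule poly_mapping_eqI; simp add: lookup_add algebra_simps)+

lemma vscale_sum: "vscale c (\<Sum>i\<in>A. v i) = (\<Sum>i\<in>A. vscale c (v i))"
  by (induction A rule: infinite_finite_induct) (auto simp: vscale_add)

lemma lin_ext_superset:
  assumes "finite S" "Poly_Mapping.keys v \<subseteq> S"
  shows "lin_ext g v = (\<Sum>b\<in>S. vscale (Poly_Mapping.lookup v b) (g b))"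
  unfolding lin_ext_def using assms by (intro sum.mono_neutral_left) (auto simp: in_keys_iff)

lemma lin_ext_0 [simp]: "lin_ext g 0 = 0"
  by (simp add: lin_ext_def)

lemma lin_ext_add: "lin_ext g (v + w) = lin_ext g v + lin_ext g w"
proof -
  let ?S = "Poly_Mapping.keys v \<union> Poly_Mapping.keys w"
  have "Poly_Mapping.keys (v + w) \<subseteq> ?S" by (rule Poly_Mapping.keys_add)
  then show ?thesis
    by (subst (1 2 3) lin_ext_superset[of ?S]) (auto simp: lookup_add vscale_add_left sum.distrib)
qed

lemma lin_ext_sum: "lin_ext g (\<Sum>i\<in>A. v i) = (\<Sum>i\<in>A. lin_ext g (v i))"
  by (induction A rule: infinite_finite_induct) (auto simp: lin_ext_add)

lemma lin_ext_vscale: "lin_ext g (vscale c v) = vscale c (lin_ext g v)"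
proof -
  have "Poly_Mapping.keys (vscale c v) \<subseteq> Poly_Mapping.keys v" by (auto simp: in_keys_iff)
  then have "lin_ext g (vscale c v) = (\<Sum>b\<in>Poly_Mapping.keys v. vscale (c * Poly_Mapping.lookup v b) (g b))"
    by (subst lin_ext_superset[of "Poly_Mapping.keys v"]) auto
  then show ?thesis by (simp add: lin_ext_def vscale_sum)
qed

lemma lin_ext_single [simp]: "lin_ext g (Poly_Mapping.single b c) = vscale c (g b)"
  by (simp add: lin_ext_def)

lemma lin_ext_cong: "(\<And>b. b \<in> Poly_Mapping.keys v \<Longrightarrow> g b = g' b) \<Longrightarrow> lin_ext g v = lin_ext g' v"
  by (simp add: lin_ext_def)

lemma lin_ext_lin_ext: "lin_ext g (lin_ext g' v) = lin_ext (\<lambda>b. lin_ext g (g' b)) v"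
  by (simp add: lin_ext_def[of g'] lin_ext_sum lin_ext_vscale) (simp add: lin_ext_def[of "\<lambda>b. lin_ext g (g' b)"])

lemma lin_ext_id: "lin_ext (\<lambda>b. Poly_Mapping.single b 1) v = v"
  by (rule poly_mapping_eqI)
     (auto simp: lin_ext_def lookup_sum lookup_single when_def in_keys_iff)

lemma lin_form_vscale: "lin_form g (vscale c v) = c * lin_form g v"
proof -
  have "Poly_Mapping.keys (vscale c v) \<subseteq> Poly_Mapping.keys v" by (auto simp: in_keys_iff)
  then have "lin_form g (vscale c v) = (\<Sum>b\<in>Poly_Mapping.keys v. c * Poly_Mapping.lookup v b * g b)"
    by (subst lin_form_superset[of "Poly_Mapping.keys v"]) auto
  then show ?thesis by (simp add: lin_form_def sum_distrib_left mult.assoc)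
qed

lemma lin_form_lin_ext: "lin_form g (lin_ext g' v) = lin_form (\<lambda>b. lin_form g (g' b)) v"
  by (simp add: lin_ext_def[of g'] lin_form_sum lin_form_vscale)
     (simp add: lin_form_def[of "\<lambda>b. lin_form g (g' b)"])

lemma lin_form_cong: "(\<And>b. b \<in> Poly_Mapping.keys v \<Longrightarrow> g b = g' b) \<Longrightarrow> lin_form g v = lin_form g' v"
  by (simp add: lin_form_def)

text \<open>The convolution product is brought into the shape of \<open>bmult\<close> in
  \<open>incidence_bialgebra\<close>, so that multiplicativity reduces to pairs of basis
  vectors.\<close>

lemma times_eq_lin_ext:
  fixes v w :: "'b::comm_monoid_add \<Rightarrow>\<^sub>0 rat"
  shows "v * w = lin_ext (\<lambda>a. lin_ext (\<lambda>b. Poly_Mapping.single (a + b) 1) w) v"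
proof -
  have e: "u = (\<Sum>a\<in>Poly_Mapping.keys u. Poly_Mapping.single a (Poly_Mapping.lookup u a))" for u :: "'b \<Rightarrow>\<^sub>0 rat"
    using lin_ext_id[of u] by (simp add: lin_ext_def)
  have "v * w = (\<Sum>a\<in>Poly_Mapping.keys v. \<Sum>b\<in>Poly_Mapping.keys w.
      Poly_Mapping.single (a + b) (Poly_Mapping.lookup v a * Poly_Mapping.lookup w b))"
    by (subst e[of v], subst e[of w]) (simp only: sum_product mult_single)
  also have "\<dots> = lin_ext (\<lambda>a. lin_ext (\<lambda>b. Poly_Mapping.single (a + b) 1) w) v"
    by (simp add: lin_ext_def vscale_sum)
  finally show ?thesis .
qed

lemma lin_ext_single_free_space:
  assumes "\<psi> ` C \<subseteq> D" "v \<in> free_space C"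
  shows "lin_ext (\<lambda>a. Poly_Mapping.single (\<psi> a) 1) v \<in> free_space D"
proof -
  have "Poly_Mapping.lookup (lin_ext (\<lambda>a. Poly_Mapping.single (\<psi> a) 1) v) d = 0" if "d \<notin> D" for d
  proof -
    have "\<psi> a \<noteq> d" if "a \<in> Poly_Mapping.keys v" for a
      using that \<open>d \<notin> D\<close> assms by (auto simp: free_space_def)
    then show ?thesis
      by (simp add: lin_ext_def lookup_sum lookup_single when_def)
  qed
  then show ?thesis by (auto simp: free_space_def in_keys_iff)
qed

lemma lin_ext_single_inverse:
  assumes "\<And>c. c \<in> C \<Longrightarrow> \<psi>' (\<psi> c) = c" "v \<in> free_space C"
  shows "lin_ext (\<lambda>a. Poly_Mapping.single (\<psi>' a) 1) (lin_ext (\<lambda>a. Poly_Mapping.single (\<psi> a) 1) v) = v"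
proof -
  have "lin_ext (\<lambda>a. Poly_Mapping.single (\<psi>' (\<psi> a)) 1) v = lin_ext (\<lambda>a. Poly_Mapping.single a 1) v"
    by (rule lin_ext_cong) (use assms in \<open>auto simp: free_space_def\<close>)
  then show ?thesis by (simp add: lin_ext_lin_ext lin_ext_id)
qed

lemma bij_betw_lin_ext_single:
  assumes \<phi>: "bij_betw \<phi> A B"
  shows "bij_betw (lin_ext (\<lambda>a. Poly_Mapping.single (\<phi> a) 1)) (free_space A) (free_space B)"
proof -
  let ?\<psi> = "inv_into A \<phi>"
  have im: "\<phi> ` A \<subseteq> B" "?\<psi> ` B \<subseteq> A"
    using \<phi> bij_betw_inv_into[OF \<phi>] by (simp_all add: bij_betw_def)
  show ?thesis
  proof (rule bij_betw_byWitness[where f' = "lin_ext (\<lambda>b. Poly_Mapping.single (?\<psi> b) 1)"])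
    show "\<forall>v\<in>free_space A. lin_ext (\<lambda>b. Poly_Mapping.single (?\<psi> b) 1) (lin_ext (\<lambda>a. Poly_Mapping.single (\<phi> a) 1) v) = v"
      using lin_ext_single_inverse[of A ?\<psi> \<phi>] bij_betw_inv_into_left[OF \<phi>] by blast
    show "\<forall>v\<in>free_space B. lin_ext (\<lambda>a. Poly_Mapping.single (\<phi> a) 1) (lin_ext (\<lambda>b. Poly_Mapping.single (?\<psi> b) 1) v) = v"
      using lin_ext_single_inverse[of B \<phi> ?\<psi>] bij_betw_inv_into_right[OF \<phi>] by blast
  qed (use lin_ext_single_free_space im in blast)+
qed

lemma single_sum: "(\<Sum>i\<in>A. Poly_Mapping.single k (c i)) = Poly_Mapping.single k (\<Sum>i\<in>A. c i)"
  by (induction A rule: infinite_finite_induct) (auto simp: single_add)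

text \<open>The empty list is not an object of \<open>S3\<close>, so the monomial 1 has to go to the
  adjoined unit \<open>None\<close>. Every other component is described by its invariant, with no
  representative named.\<close>

definition config_class :: "A_monom \<Rightarrow> unit list list list set option" where
  "config_class m = (if m = 0 then None else Some {f \<in> Ob S3. profile lens f = m})"

lemma profile_lens_in_A_monoms: "f \<in> Ob S3 \<Longrightarrow> profile lens f \<in> A_monoms"
  by (auto simp: A_monoms_def keys_profile Ob_S_gpd[of S2] intro!: lens_in_Lam)

lemma ex_profile_eq:
  assumes "m \<in> A_monoms" "m \<noteq> 0"
  shows "\<exists>f\<in>Ob S3. profile lens f = m"
proof -
  obtain ls where ls: "mset ls = mset_of_pm m" by (metis ex_mset)
  have "\<forall>l\<in>set ls. \<exists>g\<in>Ob S2. lens g = l"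
    using ls assms(1) ex_lens_eq by (metis A_monoms_def mem_Collect_eq set_mset_mset set_mset_of_pm subsetD)
  then obtain g where g: "\<And>l. l \<in> set ls \<Longrightarrow> g l \<in> Ob S2 \<and> lens (g l) = l" by metis
  have "profile lens (map g ls) = m"
    unfolding profile_eq_iff using g ls by (simp add: comp_def cong: map_cong)
  moreover have "map g ls \<noteq> []" using calculation assms(2) by (metis profile_eq_0_iff)
  ultimately show ?thesis using g by (intro bexI[of _ "map g ls"]) (auto simp: Ob_S_gpd[of S2])
qed

lemma profile_class:
  assumes "f \<in> Ob S3"
  shows "{h \<in> Ob S3. profile lens h = profile lens f} = iso_rel S3 `` {f}"
proof -
  have "h \<in> Ob S3" if "(f, h) \<in> iso_rel S3" for h using that by (simp add: iso_rel_def)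
  then have "h \<in> Ob S3 \<and> profile lens h = profile lens f \<longleftrightarrow> (f, h) \<in> iso_rel S3" for h
    using iso_rel_S3[OF assms, of h] by metis
  then show ?thesis by (simp add: Image_def)
qed

lemma config_class_profile:
  assumes "f \<in> Ob S3"
  shows "config_class (profile lens f) = Some (iso_rel S3 `` {f})"
  using assms profile_class[OF assms] by (simp add: config_class_def profile_eq_0_iff Ob_S_gpd[of S2])

text \<open>\<open>rep\<close> makes an arbitrary choice in the component; its profile ties the
  chosen list back to the monomial m.\<close>

lemma rep_config_class:
  assumes "m \<in> A_monoms" "m \<noteq> 0"
  obtains c where "config_class m = Some c" "c \<in> pi0 S3" "rep c \<in> Ob S3" "profile lens (rep c) = m"
proof -
  obtain f where f: "f \<in> Ob S3" "profile lens f = m" using ex_profile_eq[OF assms] by blast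
  let ?c = "{h \<in> Ob S3. profile lens h = m}"
  have "rep ?c \<in> ?c" unfolding rep_def by (rule someI_ex) (use f in auto)
  moreover have "?c \<in> pi0 S3"
    unfolding f(2)[symmetric] profile_class[OF f(1)] pi0_def by (rule quotientI[OF f(1)])
  ultimately show ?thesis using that[of ?c] assms by (simp add: config_class_def)
qed

lemma rep_pi0_S3:
  assumes "c \<in> pi0 S3"
  shows "rep c \<in> Ob S3" "c = iso_rel S3 `` {rep c}"
proof -
  interpret S3: groupoid S3 by (rule groupoid_S123)
  obtain f where f: "f \<in> Ob S3" "c = iso_rel S3 `` {f}" using assms by (auto simp: pi0_def elim: quotientE)
  have "rep c \<in> c" unfolding rep_def f(2)
    by (rule someI[of _ f]) (rule equiv_class_self[OF S3.equiv_iso_rel f(1)])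
  then have r: "(f, rep c) \<in> iso_rel S3" by (simp add: f(2))
  then show "rep c \<in> Ob S3" by (auto simp: iso_rel_def)
  show "c = iso_rel S3 `` {rep c}" using equiv_class_eq[OF S3.equiv_iso_rel r] f(2) by simp
qed

lemma bij_betw_config_class: "bij_betw config_class A_monoms (insert None (Some ` pi0 S3))"
proof (rule bij_betwI')
  fix m n assume mn: "m \<in> A_monoms" "n \<in> A_monoms"
  show "config_class m = config_class n \<longleftrightarrow> m = n"
    using ex_profile_eq[OF mn(1)] ex_profile_eq[OF mn(2)] by (auto simp: config_class_def)
next
  fix m assume m: "m \<in> A_monoms"
  show "config_class m \<in> insert None (Some ` pi0 S3)"
  proof (cases "m = 0")
    case False
    then show ?thesis using rep_config_class[OF m False] by (metis image_eqI insertI2)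
  qed (simp add: config_class_def)
next
  fix u assume u: "u \<in> insert None (Some ` pi0 S3)"
  show "\<exists>m\<in>A_monoms. u = config_class m"
  proof (cases u)
    case None
    then show ?thesis by (intro bexI[of _ 0]) (auto simp: config_class_def A_monoms_def)
  next
    case (Some c)
    then have c: "c \<in> pi0 S3" using u by auto
    show ?thesis
      using config_class_profile[OF rep_pi0_S3(1)[OF c]] rep_pi0_S3[OF c] Some profile_lens_in_A_monoms by metis
  qed
qed

section \<open>Comparison of the structure maps\<close>

abbreviation "BT \<equiv> bar SymT"

lemma bar_simps:
  "simp0 BT = S1" "simp1 BT = S3" "simp2 BT = S_gpd trees"
  "dface20 BT = S_fun pr2" "dface21 BT = S_fun (compos SymT)" "dface22 BT = gcomp S_mult (S_fun pr1)"
  "sdegen00 BT = S_fun (gcomp S_unit S_unit)"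
  by (simp_all add: bar_def SymT_simps)

lemma gfunctor_bar:
  "gfunctor (S_gpd trees) S3 (S_fun pr2)" "gfunctor (S_gpd trees) S3 (S_fun (compos SymT))"
  "gfunctor (S_gpd trees) S3 (gcomp S_mult (S_fun pr1))"
  by (rule gfunctor_S_fun gfunctor_compos gfunctor_trees_pr)+
     (rule gfunctor_gcomp[OF gfunctor_S_fun[OF gfunctor_trees_pr(1)] gfunctor_S_mult[OF groupoid_S123(2)]])

lemma face_Fo:
  "Fo (S_fun pr2) x = map snd x" "Fo (S_fun (compos SymT)) x = map compose x"
  "Fo (gcomp S_mult (S_fun pr1)) x = concat (map fst x)"
  by (simp_all add: S_fun_def gcomp_def S_mult_def pr1_def pr2_def)

lemma face_Ob:
  assumes "x \<in> Ob (S_gpd trees)"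
  shows "map snd x \<in> Ob S3" "map compose x \<in> Ob S3" "concat (map fst x) \<in> Ob S3"
  using gfunctor.fo_ob[OF gfunctor_bar(1) assms] gfunctor.fo_ob[OF gfunctor_bar(2) assms]
    gfunctor.fo_ob[OF gfunctor_bar(3) assms] by (simp_all add: face_Fo)

text \<open>The definition runs over pairs of components. Here the sum runs over the configurations
  x of trees, each contributing to the single pair of components that contains its outer faces. This
  is the left side of \<open>sum_S_trees_eq_prod_tree_gen\<close> with components in place of
  monomials.\<close>

lemma incidence_comult_basis_eq:
  assumes c: "c \<in> pi0 S3"
  shows "incidence_comult_basis BT (Some c) =
    (\<Sum>x | x \<in> Ob (S_gpd trees) \<and> profile lens (map compose x) = profile lens (rep c).
      Poly_Mapping.single (Some (iso_rel S3 `` {concat (map fst x)}), Some (iso_rel S3 `` {map snd x}))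
        (of_nat (card (Aut S3 (rep c))) / of_nat (outdeg (S_gpd trees) x)))"
proof -
  interpret S3: groupoid S3 by (rule groupoid_S123)
  let ?X = "{x. x \<in> Ob (S_gpd trees) \<and> profile lens (map compose x) = profile lens (rep c)}"
  let ?w = "\<lambda>x. rat_of_nat (card (Aut S3 (rep c))) / of_nat (outdeg (S_gpd trees) x)"
  let ?p = "\<lambda>x. (iso_rel S3 `` {concat (map fst x)}, iso_rel S3 `` {map snd x})"
  note r = rep_pi0_S3[OF c]
  have finX: "finite ?X" by (rule finite_Ob_S_trees_fibre[OF r(1)])
  have X: "{x \<in> Ob (S_gpd trees). (map compose x, rep c) \<in> iso_rel S3} = ?X"
    using iso_rel_S3[OF face_Ob(2) r(1)] by blast
  have iso_iff: "(h, rep a) \<in> iso_rel S3 \<longleftrightarrow> iso_rel S3 `` {h} = a" if "a \<in> pi0 S3" "h \<in> Ob S3" for h a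
    using eq_equiv_class_iff[OF S3.equiv_iso_rel that(2) rep_pi0_S3(1)[OF that(1)]] rep_pi0_S3(2)[OF that(1)] by simp
  have coeff: "incidence_coeff BT c a b = (\<Sum>x | x \<in> ?X \<and> ?p x = (a, b). ?w x)"
    if ab: "a \<in> pi0 S3" "b \<in> pi0 S3" for a b
  proof -
    have fin: "finite {x \<in> Ob (simp2 BT). (Fo (dface21 BT) x, rep c) \<in> iso_rel (simp1 BT)}"
      unfolding bar_simps face_Fo X by (rule finX)
    have set_eq: "{x. x \<in> Ob (S_gpd trees) \<and> (map compose x, rep c) \<in> iso_rel S3
         \<and> (concat (map fst x), rep a) \<in> iso_rel S3 \<and> (map snd x, rep b) \<in> iso_rel S3}
       = {x. x \<in> ?X \<and> ?p x = (a, b)}"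
      using X iso_iff[OF ab(1) face_Ob(3)] iso_iff[OF ab(2) face_Ob(1)] by blast
    have "incidence_coeff BT c a b = of_nat (card (Aut S3 (rep c))) *
      (\<Sum>x | x \<in> Ob (S_gpd trees) \<and> (map compose x, rep c) \<in> iso_rel S3
         \<and> (concat (map fst x), rep a) \<in> iso_rel S3 \<and> (map snd x, rep b) \<in> iso_rel S3.
         1 / of_nat (outdeg (S_gpd trees) x))"
      using incidence_coeff_eq[of BT c a b, unfolded bar_simps face_Fo, OF gfunctor_bar
          locally_finite_S123(3) locally_finite_S_gpd[OF locally_finite_trees] fin[unfolded bar_simps face_Fo]
          rep_pi0_S3(1)[OF ab(1)] rep_pi0_S3(1)[OF ab(2)]] .
    then show ?thesis unfolding set_eq by (simp add: sum_distrib_left)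
  qed
  have pi0_p: "?p x \<in> pi0 S3 \<times> pi0 S3" if "x \<in> ?X" for x
    using face_Ob[of x] that by (auto simp: pi0_def intro: quotientI)
  have "incidence_comult_basis BT (Some c) = (\<Sum>(a, b) | a \<in> pi0 S3 \<and> b \<in> pi0 S3 \<and> incidence_coeff BT c a b \<noteq> 0.
         Poly_Mapping.single (Some a, Some b) (incidence_coeff BT c a b))"
    by (simp add: incidence_comult_basis_def bar_simps)
  \<comment> \<open>The finite image of \<open>?X\<close> replaces the index set of the definition:
    a nonzero coefficient forces some x over (a, b), and the remaining pairs in the image have
    coefficient 0.\<close>
  also have "\<dots> = (\<Sum>(a, b)\<in>?p ` ?X. Poly_Mapping.single (Some a, Some b) (incidence_coeff BT c a b))"
  proof (rule sum.mono_neutral_left)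
    show "finite (?p ` ?X)" using finX by simp
    show "{(a, b). a \<in> pi0 S3 \<and> b \<in> pi0 S3 \<and> incidence_coeff BT c a b \<noteq> 0} \<subseteq> ?p ` ?X"
    proof safe
      fix a b assume ab: "a \<in> pi0 S3" "b \<in> pi0 S3" "incidence_coeff BT c a b \<noteq> 0"
      have "{x. x \<in> ?X \<and> ?p x = (a, b)} \<noteq> {}"
      proof
        assume "{x. x \<in> ?X \<and> ?p x = (a, b)} = {}"
        then have "incidence_coeff BT c a b = 0" unfolding coeff[OF ab(1,2)] by (simp only: sum.empty)
        with ab(3) show False by simp
      qed
      then obtain x where "x \<in> ?X" "?p x = (a, b)" by blast
      then show "(a, b) \<in> ?p ` ?X" by (intro rev_image_eqI[of x]) (simp_all only:)
    qed
  qed (use pi0_p in force)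
  also have "\<dots> = (\<Sum>q\<in>?p ` ?X. \<Sum>x | x \<in> ?X \<and> ?p x = q. Poly_Mapping.single (Some (fst (?p x)), Some (snd (?p x))) (?w x))"
  proof (rule sum.cong[OF refl])
    fix q assume "q \<in> ?p ` ?X"
    then have q: "fst q \<in> pi0 S3" "snd q \<in> pi0 S3" using pi0_p by auto
    have "(\<Sum>x | x \<in> ?X \<and> ?p x = q. Poly_Mapping.single (Some (fst (?p x)), Some (snd (?p x))) (?w x))
      = (\<Sum>x | x \<in> ?X \<and> ?p x = q. Poly_Mapping.single (Some (fst q), Some (snd q)) (?w x))"
      by (rule sum.cong) auto
    also have "\<dots> = Poly_Mapping.single (Some (fst q), Some (snd q)) (incidence_coeff BT c (fst q) (snd q))"
      unfolding single_sum coeff[OF q] prod.collapse ..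
    finally show "(case q of (a, b) \<Rightarrow> Poly_Mapping.single (Some a, Some b) (incidence_coeff BT c a b))
       = (\<Sum>x | x \<in> ?X \<and> ?p x = q. Poly_Mapping.single (Some (fst (?p x)), Some (snd (?p x))) (?w x))"
      by (simp add: case_prod_unfold)
  qed
  also have "\<dots> = (\<Sum>x\<in>?X. Poly_Mapping.single (Some (fst (?p x)), Some (snd (?p x))) (?w x))"
    by (rule sum.image_gen[OF finX, symmetric])
  finally show ?thesis by simp
qed

text \<open>After the product of the \<open>tree_gen l\<close> is rewritten as a sum over
  configurations, \<open>config_class\<close> matches the two sums term by term. For the empty
  monomial both sides are the grouplike unit.\<close>

lemma comult_agrees:
  assumes m: "m \<in> A_monoms"
  shows "lin_ext (\<lambda>(a, b). Poly_Mapping.single (config_class a, config_class b) 1)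
      (\<Prod>l\<in>#mset_of_pm m. tree_gen l) = incidence_comult_basis BT (config_class m)"
proof (cases "m = 0")
  case True
  have one: "(1 :: A_monom \<times> A_monom \<Rightarrow>\<^sub>0 rat) = Poly_Mapping.single (0, 0) 1"
    by (simp flip: zero_prod_def)
  show ?thesis
    unfolding True mset_of_pm_simps image_mset_empty prod_mset_empty one lin_ext_single
    by (simp add: config_class_def incidence_comult_basis_def)
next
  case False
  obtain c where c: "config_class m = Some c" "c \<in> pi0 S3" "rep c \<in> Ob S3" "profile lens (rep c) = m"
    using rep_config_class[OF m False] .
  have "mset_of_pm m = mset (map lens (rep c))" unfolding c(4)[symmetric] by (rule mset_of_pm_profile)
  then have "(\<Prod>l\<in>#mset_of_pm m. tree_gen l) =
    (\<Sum>x | x \<in> Ob (S_gpd trees) \<and> profile lens (map compose x) = profile lens (rep c).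
      Poly_Mapping.single (profile lens (concat (map fst x)), profile lens (map snd x))
        (of_nat (card (Aut S3 (rep c))) / of_nat (outdeg (S_gpd trees) x)))"
    by (simp only: sum_S_trees_eq_prod_tree_gen[OF c(3)])
  then show ?thesis
    unfolding c(1) incidence_comult_basis_eq[OF c(2)]
    by (simp only: lin_ext_sum) (rule sum.cong[OF refl], simp add: config_class_profile face_Ob)
qed

text \<open>The value of \<open>A_coeff l\<close> at \<open>series_x1\<close> is 1 for the exponent
  of x_1 and 0 otherwise, the same factor that each member contributes in
  \<open>hcard_unit_fibre\<close>.\<close>

lemma counit_agrees:
  assumes m: "m \<in> A_monoms"
  shows "incidence_counit_basis BT (config_class m)
    = (\<Prod>l\<in>Poly_Mapping.keys m. A_coeff l series_x1 ^ Poly_Mapping.lookup m l)"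
proof (cases "m = 0")
  case True
  then show ?thesis by (simp add: config_class_def incidence_counit_basis_def)
next
  case False
  obtain c where c: "config_class m = Some c" "rep c \<in> Ob S3" "profile lens (rep c) = m"
    using rep_config_class[OF m False] .
  have A: "A_coeff l series_x1 = (if l = Poly_Mapping.single 1 1 then 1 else 0)" for l
    by (simp add: A_coeff_def series_x1_def lam_aut_def)
  have "incidence_counit_basis BT (config_class m) = (\<Prod>l\<in>#mset (map lens (rep c)). A_coeff l series_x1)"
    unfolding c(1) A by (simp only: incidence_counit_basis_def option.case bar_simps hcard_unit_fibre[OF c(2)])
  also have "mset (map lens (rep c)) = mset_of_pm m"
    unfolding c(3)[symmetric] by (rule mset_of_pm_profile[symmetric])
  finally show ?thesis by (simp add: prod_mset_of_pm)
qed

text \<open>\<open>profile\<close> turns concatenation into addition, whichever representatives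
  \<open>juxtapose\<close> concatenates.\<close>

lemma juxtapose_config_class:
  assumes m: "m \<in> A_monoms" and n: "n \<in> A_monoms"
  shows "juxtapose BT (config_class m) (config_class n) = config_class (m + n)"
proof (cases "m = 0 \<or> n = 0")
  case True
  then show ?thesis by (auto simp: config_class_def juxtapose_def split: option.split)
next
  case False
  obtain c where c: "config_class m = Some c" "rep c \<in> Ob S3" "profile lens (rep c) = m"
    using rep_config_class[OF m] False by blast
  obtain d where d: "config_class n = Some d" "rep d \<in> Ob S3" "profile lens (rep d) = n"
    using rep_config_class[OF n] False by blast
  have "rep c @ rep d \<in> Ob S3" using c(2) d(2) by (auto simp: Ob_S_gpd[of S2])
  from config_class_profile[OF this] show ?thesis
    by (simp add: c d juxtapose_def bar_simps)
qed

text \<open>All structure maps are linear extensions from basis vectors, so each clause is an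
  identity on the basis: the two comultiplications, counits and products agree there by the
  preceding lemmas.\<close>

lemma bialg_iso_config_class:
  "bialg_iso plethystic_bialgebra (incidence_bialgebra BT)
     (lin_ext (\<lambda>m. Poly_Mapping.single (config_class m) 1))"
  unfolding bialg_iso_def
proof (intro conjI ballI allI)
  let ?h = "lin_ext (\<lambda>m. Poly_Mapping.single (config_class m) 1)"
  have sel: "bbasis plethystic_bialgebra = A_monoms" "bmult plethystic_bialgebra = (*)"
    "bunit plethystic_bialgebra = 1" "bcomult plethystic_bialgebra = plethystic_comult"
    "bcounit plethystic_bialgebra = plethystic_counit"
    "bbasis (incidence_bialgebra BT) = insert None (Some ` pi0 S3)"
    by (simp_all add: plethystic_bialgebra_def incidence_bialgebra_def bar_simps)
  show "bij_betw ?h (free_space (bbasis plethystic_bialgebra)) (free_space (bbasis (incidence_bialgebra BT)))"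
    unfolding sel by (rule bij_betw_lin_ext_single[OF bij_betw_config_class])
  show "?h (v + w) = ?h v + ?h w" for v w by (rule lin_ext_add)
  show "?h (vscale c v) = vscale c (?h v)" for c v by (rule lin_ext_vscale)
  show "?h (bunit plethystic_bialgebra) = bunit (incidence_bialgebra BT)"
    unfolding sel by (simp add: incidence_bialgebra_def config_class_def flip: single_one)
  fix v assume "v \<in> free_space (bbasis plethystic_bialgebra)"
  then have v: "Poly_Mapping.keys v \<subseteq> A_monoms" by (simp add: sel free_space_def)
  show "?h (bmult plethystic_bialgebra v w) = bmult (incidence_bialgebra BT) (?h v) (?h w)"
    if "w \<in> free_space (bbasis plethystic_bialgebra)" for w
  proof -
    from that have w: "Poly_Mapping.keys w \<subseteq> A_monoms" by (simp add: sel free_space_def)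
    have "bmult (incidence_bialgebra BT) (?h v) (?h w)
      = lin_ext (\<lambda>m. lin_ext (\<lambda>n. Poly_Mapping.single (juxtapose BT (config_class m) (config_class n)) 1) w) v"
      by (simp add: incidence_bialgebra_def lin_ext_lin_ext)
    also have "\<dots> = lin_ext (\<lambda>m. lin_ext (\<lambda>n. Poly_Mapping.single (config_class (m + n)) 1) w) v"
      by (intro lin_ext_cong) (simp only: juxtapose_config_class[OF subsetD[OF v] subsetD[OF w]])
    also have "\<dots> = ?h (v * w)"
      by (simp add: times_eq_lin_ext[of v w] lin_ext_lin_ext)
    finally show ?thesis by (simp add: sel)
  qed
  have tm: "tensor_map ?h = lin_ext (\<lambda>(a, b). Poly_Mapping.single (config_class a, config_class b) 1)"
    by (simp add: tensor_map_def tensor_def fun_eq_iff)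
  have comult: "plethystic_comult v = lin_ext (\<lambda>m. \<Prod>l\<in>#mset_of_pm m. tree_gen l) v"
    by (simp add: plethystic_comult_def plethystic_comult_gen_eq prod_mset_of_pm)
  have "lin_ext (\<lambda>m. lin_ext (\<lambda>(a, b). Poly_Mapping.single (config_class a, config_class b) 1)
        (\<Prod>l\<in>#mset_of_pm m. tree_gen l)) v = lin_ext (\<lambda>m. incidence_comult_basis BT (config_class m)) v"
    by (rule lin_ext_cong) (use v comult_agrees in blast)
  then show "tensor_map ?h (bcomult plethystic_bialgebra v) = bcomult (incidence_bialgebra BT) (?h v)"
    by (simp add: sel tm comult lin_ext_lin_ext incidence_bialgebra_def)
  have "lin_form (\<lambda>m. incidence_counit_basis BT (config_class m)) v = plethystic_counit v"
    unfolding plethystic_counit_def by (rule lin_form_cong) (use v counit_agrees in blast)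
  then show "bcounit (incidence_bialgebra BT) (?h v) = bcounit plethystic_bialgebra v"
    by (simp add: sel incidence_bialgebra_def lin_form_lin_ext)
qed

theorem theorem5p3:
  shows "bialg_isomorphic plethystic_bialgebra (incidence_bialgebra (bar (T_S Sym)))"
  unfolding bialg_isomorphic_def using bialg_iso_config_class by blast

end
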